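(* For every integer $C\ge1$, the expected number of misses of the tagged document in an LRU cache of size $C$ is $$\mathbb{E}[\mu_C]=\mathbb{E}[m(T_C)],$$ where $T_C=T_C^0$ is the exit time for a document requested at time zero and the function $m$ is defined by $$m(t)=\mathbb{E}\left[\int_0^\infty \lambda(u)\,e^{-(\Lambda(u+t)-\Lambda(u))}\,du\right],\qquad t\ge0.$$ Moreover, $m$ is nonincreasing and $\lim_{t\to\infty}m(t)=m_0$, where $m_0=\mathbb{E}[1-e^{-\Lambda(\infty)}]$.
   Context: Model. $\Gamma^g$ is a homogeneous Poisson process on $\mathbb{R}$ with intensity $\gamma>0$; its points $a$ are the arrival times of documents to a catalog. Each $a\in\Gamma^g$ carries a document request process $\xi_a$, a Cox point process on $\mathbb{R}$ directed by a random intensity function $\lambda_a\ge0$. Given $\Gamma^g$, the pairs $(\lambda_a,\xi_a)$, $a\in\Gamma^g$, are independent; $\lambda_a(t)=0$ for $t<a$; and $\lambda_a(\cdot)$ has the same law as $\lambda(\cdot-a)$, where $\lambda=\lambda_0$ is a canonical random intensity supported in $[0,\infty)$. Set $\Lambda_a(t)=\int_a^t\lambda_a(u)\,du$ for $t\ge a$ (and $\Lambda_a(t)=0$ for $t<a$), and $\Lambda=\Lambda_0$. It is assumed that $\Lambda(\infty)<\infty$ almost surely and that $\int_{-\infty}^t\mathbb{E}[1-e^{-(\Lambda_a(t)-\Lambda_a(s))}]\,da<\infty$ for all $s\le t$. Tagged document and rest. The probability space carries two independent objects: (i) a tagged document arriving at time $0$, with canonical intensity $\lambda$ and request process $\xi$,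 a Cox process directed by $\lambda$; (ii) the rest, a marked point process with the same law as $\sum_{a\in\Gamma^g}\delta_{(a,\xi_a)}$, where $\Gamma^g$ is the homogeneous Poisson process on $\mathbb{R}$ with intensity $\gamma$ and, given $\Gamma^g$, the marks $\xi_a$, $a\in\Gamma^g$, are independent Cox processes directed by the random intensities $\lambda_a$, with $\lambda_a(\cdot)$ distributed as $\lambda(\cdot-a)$. Let $N$ be the number of points of $\xi$ (finite almost surely) and $\Theta_1<\dots<\Theta_N$ its points, the request times of the tagged document. Exit times. For $s\in\mathbb{R}$ and $t\ge s$, let $X_t^s$ be the number of documents $(a,\xi_a)$ of the rest having at least one request in $[s,t]$ (i.e. the number of distinct documents of the rest requested in $[s,t]$), and $T_C^s=\inf\{t\ge s: X_t^s=C\}$. LRU misses. An LRU cache of size $C$ holds $C$ unit-size documents as a list. A requested document is placed at the front; if it was not already present (a miss), the last document in the list is removed. Hence a document requested at time $s$ and not requested again leaves the cache at time $T_C^s$. The first request of the tagged document is always a miss and, for $r\ge2$, the request at $\Theta_r$ is a miss iff $\Theta_r>T_C^{\Theta_{r-1}}$. The number of misses of the tagged document is therefore $$\mu_C=\mathbf{1}\{N\ge1\}+\mathbf{1}\{N\ge2\}\sum_{r=2}^{N}\mathbf{1}\{\Theta_r>T_C^{\Theta_{r-1}}\}.$$ Conventions: $\inf\emptyset=\infty$ and $m(\infty)=\lim_{t\to\infty}m(t)$. *)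

theory Defs
  imports "HOL-Probability.Probability"
begin

section \<open>Point processes on the real line\<close>

text \<open>All processes below are simple, so a realisation is identified with the locally finite
  set of its points, and the number of points in \<open>B\<close> is the cardinality of \<open>S \<inter> B\<close>.\<close>

definition locally_finite_set :: "real set \<Rightarrow> bool" where
  "locally_finite_set S \<longleftrightarrow> (\<forall>B. bounded B \<longrightarrow> finite (S \<inter> B))"

definition config :: "real set measure" where
  "config = sigma {S. locally_finite_set S}
     {{S. locally_finite_set S \<and> card (S \<inter> B) = k} | B k. B \<in> sets borel \<and> bounded B}"

definition test_sets :: "nat \<Rightarrow> (nat \<Rightarrow> real set) \<Rightarrow> bool" where
  "test_sets m B \<longleftrightarrow>
     disjoint_family_on B {..<m} \<and> (\<forall>j<m. B j \<in> sets borel \<and> bounded (B j))"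

definition counts :: "nat \<Rightarrow> (nat \<Rightarrow> real set) \<Rightarrow> (nat \<Rightarrow> nat) \<Rightarrow> real set \<Rightarrow> bool" where
  "counts m B k S \<longleftrightarrow> (\<forall>j<m. card (S \<inter> B j) = k j)"

text \<open>The probability that a Poisson process with intensity function \<open>f\<close> (nonnegative, locally
  integrable) has exactly \<open>k j\<close> points in \<open>B j\<close> for all \<open>j < m\<close>. The product form encodes the
  independence of the counts on disjoint sets.\<close>

definition poisson_prob ::
  "(real \<Rightarrow> real) \<Rightarrow> nat \<Rightarrow> (nat \<Rightarrow> real set) \<Rightarrow> (nat \<Rightarrow> nat) \<Rightarrow> real" where
  "poisson_prob f m B k =
     (\<Prod>j<m. exp (- (LBINT u:B j. f u)) * (LBINT u:B j. f u) ^ k j / fact (k j))"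

definition poisson_process :: "'w measure \<Rightarrow> (real \<Rightarrow> real) \<Rightarrow> ('w \<Rightarrow> real set) \<Rightarrow> bool" where
  "poisson_process M f \<Gamma> \<longleftrightarrow>
     \<Gamma> \<in> M \<rightarrow>\<^sub>M config \<and>
     (\<forall>m B k. test_sets m B \<longrightarrow>
        measure M {\<omega> \<in> space M. counts m B k (\<Gamma> \<omega>)} = poisson_prob f m B k)"

definition random_intensity :: "'w measure \<Rightarrow> ('w \<Rightarrow> real \<Rightarrow> real) \<Rightarrow> bool" where
  "random_intensity M l \<longleftrightarrow>
     (\<lambda>(\<omega>, u). l \<omega> u) \<in> borel_measurable (M \<Otimes>\<^sub>M borel) \<and>
     (\<forall>\<omega>\<in>space M. \<forall>u. 0 \<le> l \<omega> u)"

text \<open>The \<open>\<sigma>\<close>-algebra generated by the family of random variables \<open>(Y i)\<close>, for \<open>i\<close> ranging over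
  a type; \<open>Y\<close> is curried with the outcome first.\<close>

definition generated_by :: "'w measure \<Rightarrow> ('w \<Rightarrow> 'i \<Rightarrow> real) \<Rightarrow> 'w measure" where
  "generated_by M Y = vimage_algebra (space M) Y (PiM UNIV (\<lambda>_. borel))"

text \<open>\<open>\<xi>\<close> is a Cox process directed by \<open>l\<close>: conditionally on \<open>l\<close>, it is a Poisson process with
  intensity function \<open>l\<close>.\<close>

definition cox_process ::
  "'w measure \<Rightarrow> ('w \<Rightarrow> real \<Rightarrow> real) \<Rightarrow> ('w \<Rightarrow> real set) \<Rightarrow> bool" where
  "cox_process M l \<xi> \<longleftrightarrow>
     \<xi> \<in> M \<rightarrow>\<^sub>M config \<and>
     (\<forall>m B k. test_sets m B \<longrightarrow>
        (AE \<omega> in M.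
           real_cond_exp M (generated_by M l)
             (indicator {\<omega> \<in> space M. counts m B k (\<xi> \<omega>)}) \<omega>
           = poisson_prob (l \<omega>) m B k))"

text \<open>The (unconditional) finite-dimensional distributions of a Cox process whose directing
  intensity has the law of \<open>l\<close> under \<open>M\<close>.\<close>

definition cox_prob ::
  "'w measure \<Rightarrow> ('w \<Rightarrow> real \<Rightarrow> real) \<Rightarrow> nat \<Rightarrow> (nat \<Rightarrow> real set) \<Rightarrow> (nat \<Rightarrow> nat) \<Rightarrow> real" where
  "cox_prob M l m B k = (\<integral>\<omega>. poisson_prob (l \<omega>) m B k \<partial>M)"


text \<open>Independence of two random elements; the library's \<open>indep_var\<close> is restricted to random
  elements whose values have the same type.\<close>

definition independent_elements ::
  "'w measure \<Rightarrow> 'a measure \<Rightarrow> ('w \<Rightarrow> 'a) \<Rightarrow> 'b measure \<Rightarrow> ('w \<Rightarrow> 'b) \<Rightarrow> bool" where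
  "independent_elements M P X Q Y \<longleftrightarrow>
     X \<in> M \<rightarrow>\<^sub>M P \<and> Y \<in> M \<rightarrow>\<^sub>M Q \<and>
     prob_space.indep_set M (sets (vimage_algebra (space M) X P)) (sets (vimage_algebra (space M) Y Q))"


section \<open>The catalog\<close>

text \<open>The intensity of a document arriving at \<open>a\<close> is distributed as \<open>shift_intensity a l\<close>, that
  is, as \<open>l(\<cdot> - a)\<close>, where \<open>l\<close> is the canonical intensity.\<close>

definition shift_intensity :: "real \<Rightarrow> ('w \<Rightarrow> real \<Rightarrow> real) \<Rightarrow> 'w \<Rightarrow> real \<Rightarrow> real" where
  "shift_intensity a l = (\<lambda>\<omega> u. l \<omega> (u - a))"

text \<open>The integral of \<open>f\<close> from \<open>a\<close> to \<open>t\<close>, equal to \<open>0\<close> for \<open>t < a\<close>.\<close>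

definition cumulative :: "(real \<Rightarrow> real) \<Rightarrow> real \<Rightarrow> real \<Rightarrow> real" where
  "cumulative f a t = (LBINT u:{a..t}. f u)"

text \<open>The marked point process of all pairs \<open>(A n, \<Xi> n)\<close>, \<open>n \<in> \<nat>\<close>, where \<open>A\<close> enumerates, without
  repetition, the almost surely infinitely many points of a homogeneous Poisson process on the
  whole line. Given the arrival times, the marks are independent, and the mark of a document
  arriving at \<open>a\<close> is a Cox process directed by a random intensity distributed as \<open>l(\<cdot> - a)\<close>.
  On the right-hand side of the last equation, the integral inside \<open>cox_prob\<close> averages over the
  law of \<open>l\<close> only, with the arrival times \<open>A i \<omega>\<close> held fixed.\<close>

definition document_process ::
  "'w measure \<Rightarrow> real \<Rightarrow> ('w \<Rightarrow> real \<Rightarrow> real) \<Rightarrow> (nat \<Rightarrow> 'w \<Rightarrow> real) \<Rightarrow> (nat \<Rightarrow> 'w \<Rightarrow> real set) \<Rightarrow> bool"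
  where
  "document_process M \<gamma> l A \<Xi> \<longleftrightarrow>
     (\<forall>n. A n \<in> borel_measurable M) \<and>
     (\<forall>n. \<Xi> n \<in> M \<rightarrow>\<^sub>M config) \<and>
     (AE \<omega> in M. inj (\<lambda>n. A n \<omega>)) \<and>
     poisson_process M (\<lambda>_. \<gamma>) (\<lambda>\<omega>. range (\<lambda>n. A n \<omega>)) \<and>
     (\<forall>n m B k. (\<forall>i<n. test_sets m (B i)) \<longrightarrow>
        (AE \<omega> in M.
           real_cond_exp M (generated_by M (\<lambda>\<omega> n. A n \<omega>))
             (indicator {\<omega> \<in> space M. \<forall>i<n. counts m (B i) (k i) (\<Xi> i \<omega>)}) \<omega>
           = (\<Prod>i<n. cox_prob M (shift_intensity (A i \<omega>) l) m (B i) (k i))))"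


section \<open>Exit times and misses\<close>

text \<open>In this section \<open>S n\<close> is the set of request times of document \<open>n\<close> of the rest and \<open>R\<close> is
  the set of request times of the tagged document. As \<open>card\<close> is \<open>0\<close> on infinite sets,
  \<open>exit_time\<close> is meaningful only for \<open>C \<ge> 1\<close>.\<close>

definition distinct_requested :: "(nat \<Rightarrow> real set) \<Rightarrow> real \<Rightarrow> real \<Rightarrow> nat" where
  "distinct_requested S s t = card {n. S n \<inter> {s..t} \<noteq> {}}"

definition exit_time :: "nat \<Rightarrow> (nat \<Rightarrow> real set) \<Rightarrow> real \<Rightarrow> ereal" where
  "exit_time C S s = Inf {ereal t | t. s \<le> t \<and> distinct_requested S s t = C}"

definition request_time :: "real set \<Rightarrow> nat \<Rightarrow> real" where
  "request_time R r = sorted_list_of_set R ! (r - 1)"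

definition misses :: "nat \<Rightarrow> (nat \<Rightarrow> real set) \<Rightarrow> real set \<Rightarrow> nat" where
  "misses C S R =
     of_bool (card R \<ge> 1) +
     of_bool (card R \<ge> 2) *
       (\<Sum>r = 2..card R.
          of_bool (ereal (request_time R r) > exit_time C S (request_time R (r - 1))))"


section \<open>The function m\<close>

text \<open>The value may be \<open>\<infinity>\<close> (at \<open>t = 0\<close>, where it is the mean number of requests).\<close>

definition mean_misses :: "'w measure \<Rightarrow> ('w \<Rightarrow> real \<Rightarrow> real) \<Rightarrow> real \<Rightarrow> ennreal" where
  "mean_misses M l t =
     (\<integral>\<^sup>+\<omega>. (\<integral>\<^sup>+u\<in>{0..}.
        ennreal (l \<omega> u * exp (- (cumulative (l \<omega>) 0 (u + t) - cumulative (l \<omega>) 0 u)))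
      \<partial>lborel) \<partial>M)"

definition mean_misses_ext :: "'w measure \<Rightarrow> ('w \<Rightarrow> real \<Rightarrow> real) \<Rightarrow> ereal \<Rightarrow> ennreal" where
  "mean_misses_ext M l x =
     (if x = \<infinity> then Lim at_top (mean_misses M l) else mean_misses M l (real_of_ereal x))"

end

theory Submission
  imports Defs
begin

text \<open>Index a miss by the request before it: \<open>\<Theta>\<^sub>r\<close> is a miss iff the exit time started at
  \<open>x = \<Theta>\<^bsub>r-1\<^esub>\<close> lies before \<open>\<Theta>\<^sub>r\<close>, that is, iff no request falls in \<open>(x, T\<^sup>x]\<close>. The last request has no
  successor, so this condition always holds for it, and it stands in for the first request, which
  is always a miss. Hence the number of misses is the number of requests \<open>x\<close> of the tagged document
  such that \<open>(x, T\<^sup>x]\<close> contains no further request. The theorem follows from three facts.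

  Stationarity (\<open>filled_before_shift\<close>): the law of \<open>T\<^sup>s - s\<close> does not depend on \<open>s\<close>. The
  documents of the rest come in some enumeration \<open>(A n, \<Xi> n)\<close>, which is not stationary itself, so
  one works with symmetric functions of the documents. Given the arrival times the marks are
  independent, so the mean of a product of functions of the single marks is the mean of
  \<open>\<Prod>n. h (A n)\<close> for a suitable \<open>h\<close>, and a shift of the window shifts \<open>h\<close>. Such means are invariant
  under shifts because they are limits of means of functions of Poisson counts
  (\<open>arrival_product_shift\<close>). For a suitable product the mean is the generating function of the
  number of documents requested by time \<open>t\<close>, restricted to the event that no new document is
  requested between \<open>t\<close> and \<open>t'\<close> (\<open>settled_pgf\<close>). Its coefficients give the probability that the
  number of distinct requested documents is \<open>C\<close> both at \<open>t\<close> and at \<open>t'\<close>. That number is monotone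
  in time, and for a monotone path these two-time probabilities determine the law of the
  first time at which the level \<open>C\<close> is attained (\<open>finite_levels_shift\<close>).

  The Cox property (\<open>mean_gaps\<close>): for every \<open>\<tau> \<ge> 0\<close>, the mean number of requests \<open>x\<close> with no
  further request in \<open>(x, x + \<tau>]\<close> is \<open>m \<tau>\<close>. Given the intensity, a request falls at \<open>u\<close> with
  density \<open>l u\<close>, and it is followed by silence with probability \<open>exp (- (\<Lambda> (u + \<tau>) - \<Lambda> u))\<close>. The
  proof counts on dyadic grids the cells that contain a request and are followed by silence.
  For \<open>\<tau> = \<infinity>\<close> only the last request counts, and the mean is \<open>m\<^sub>0\<close> (\<open>prob_requested\<close>).

  Finiteness (\<open>mean_misses_finite\<close>): \<open>m h < \<infinity>\<close> for \<open>h > 0\<close>, although \<open>m 0\<close>, the mean number of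
  requests, may be infinite. A request followed by a gap of length \<open>h\<close> keeps the document active,
  in windows of length \<open>h\<close>, for a time \<open>h\<close> that no other such request covers. So \<open>h * m h\<close> is at
  most the mean total time for which the document is active, and the assumption on the catalog
  says that this time is finite (\<open>gap_bound\<close>, \<open>finite_window_rate\<close>). Dominated convergence then
  gives \<open>m t \<longlongrightarrow> m\<^sub>0\<close>, the limit being evaluated by the identity
  \<open>\<integral> l u * exp (- (\<Lambda> \<infinity> - \<Lambda> u)) du = 1 - exp (- \<Lambda> \<infinity>)\<close>.

  By stationarity and independence of the tagged document and the rest, the exit times at
  all requests may be replaced by the one exit time \<open>T\<^sup>0\<close>; averaging over the tagged
  document first then gives \<open>m (T\<^sup>0)\<close> by the Cox property (\<open>mean_misses_LRU\<close>).\<close>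

section \<open>The primitive of an integrable intensity\<close>

definition primitive :: "(real \<Rightarrow> real) \<Rightarrow> real \<Rightarrow> real" where
  "primitive f x = (LBINT u:{..x}. f u)"

text \<open>The density of a request at \<open>u\<close> that is followed by silence until \<open>v\<close>.\<close>

abbreviation survival :: "(real \<Rightarrow> real) \<Rightarrow> real \<Rightarrow> real \<Rightarrow> real" where
  "survival f u v \<equiv> f u * exp (- (primitive f v - primitive f u))"

text \<open>The measure with density \<open>f\<close> is finite and has no atoms, so \<open>F\<close> is its continuous
  distribution function.\<close>

locale integrable_intensity =
  fixes f :: "real \<Rightarrow> real"
  assumes nonneg: "0 \<le> f u"
    and integrable: "integrable lborel f"
begin

abbreviation F where "F \<equiv> primitive f"

lemma measurable_f [measurable]: "f \<in> borel_measurable borel"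
  using integrable by auto

lemma set_integrable: "B \<in> sets borel \<Longrightarrow> set_integrable lborel B f"
  unfolding set_integrable_def using integrable_mult_indicator[OF _ integrable, of B] by simp

lemma emeasure_eq: 
  assumes B: "B \<in> sets borel"
  shows "emeasure (density lborel f) B = ennreal (LBINT u:B. f u)"
proof -
  have "emeasure (density lborel f) B = (\<integral>\<^sup>+u. ennreal (f u) * indicator B u \<partial>lborel)"
    using B by (subst emeasure_density) auto
  also have "\<dots> = (\<integral>\<^sup>+u. ennreal (indicator B u *\<^sub>R f u) \<partial>lborel)"
    by (intro nn_integral_cong) (auto split: split_indicator)
  also have "\<dots> = ennreal (\<integral>u. indicator B u *\<^sub>R f u \<partial>lborel)"
    using set_integrable[OF B] nonneg unfolding set_integrable_def
    by (intro nn_integral_eq_integral) auto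
  finally show ?thesis by (simp add: set_lebesgue_integral_def)
qed

lemma set_integral_nonneg: "0 \<le> (LBINT u:B. f u)"
  unfolding set_lebesgue_integral_def using nonneg by (intro integral_nonneg_AE) auto

lemma measure_eq: "B \<in> sets borel \<Longrightarrow> measure (density lborel f) B = (LBINT u:B. f u)"
  using emeasure_eq[of B] set_integral_nonneg[of B] by (simp add: measure_def)

lemma finite_borel_density: "finite_borel_measure (density lborel f)"
proof -
  have "finite_measure (density lborel f)"
    using emeasure_eq[of UNIV] by (intro finite_measureI) simp
  then show ?thesis
    unfolding finite_borel_measure_def finite_borel_measure_axioms_def by simp
qed

sublocale nu: finite_borel_measure "density lborel f"
  by (rule finite_borel_density)

lemma F_eq_cdf: "F = cdf (density lborel f)"
  by (auto simp: fun_eq_iff primitive_def cdf_def2 measure_eq)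

lemma F_mono: "x \<le> y \<Longrightarrow> F x \<le> F y"
  unfolding F_eq_cdf by (rule nu.cdf_nondecreasing)

lemma F_nonneg: "0 \<le> F x"
  unfolding F_eq_cdf by (rule nu.cdf_nonneg)

lemma measure_singleton: "measure (density lborel f) {x} = 0"
proof -
  have "AE u in lborel. u \<in> {x} \<longrightarrow> f u \<le> 0"
    by (rule AE_I[of _ _ "{x}"]) auto
  then have "emeasure (density lborel f) {x} = 0"
    by (subst emeasure_density) (auto simp: nn_integral_0_iff_AE intro!: AE_I[of _ _ "{x}"])
  then show ?thesis by (simp add: measure_def)
qed

lemma F_isCont: "isCont F x"
  unfolding F_eq_cdf nu.isCont_cdf by (rule measure_singleton)

lemma F_cont: "continuous_on S F"
  by (simp add: F_isCont continuous_at_imp_continuous_on)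

lemma F_measurable [measurable]: "F \<in> borel_measurable borel"
  by (intro borel_measurable_continuous_onI F_cont)

lemma F_lim: "(F \<longlongrightarrow> (LBINT u. f u)) at_top"
proof -
  have "(F \<longlongrightarrow> measure (density lborel f) UNIV) at_top"
    using nu.cdf_lim_at_top unfolding F_eq_cdf by simp
  then show ?thesis by (simp add: measure_eq set_lebesgue_integral_def)
qed

lemma F_bounded: "F x \<le> (LBINT u. f u)"
  using nu.cdf_bounded[of x] by (simp add: F_eq_cdf measure_eq set_lebesgue_integral_def)

lemma integral_Ioc: "a \<le> b \<Longrightarrow> (LBINT u:{a<..b}. f u) = F b - F a"
  using nu.cdf_diff_eq[of a b]
  by (cases "a = b") (auto simp: F_eq_cdf measure_eq set_lebesgue_integral_def)

lemma integral_Icc: assumes "a \<le> b" shows "(LBINT u:{a..b}. f u) = F b - F a"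
proof -
  have "measure (density lborel f) {a..b} = measure (density lborel f) ({a} \<union> {a<..b})"
    using assms by (intro arg_cong[where f="measure _"]) auto
  also have "\<dots> = measure (density lborel f) {a} + measure (density lborel f) {a<..b}"
    by (intro nu.finite_measure_Union) auto
  finally show ?thesis using assms by (simp add: measure_singleton measure_eq integral_Ioc)
qed

lemma integral_Ico: assumes "a \<le> b" shows "(LBINT u:{a..<b}. f u) = F b - F a"
proof (cases "a = b")
  case False
  have "measure (density lborel f) {a..b} = measure (density lborel f) ({b} \<union> {a..<b})"
    using assms by (intro arg_cong[where f="measure _"]) auto
  also have "\<dots> = measure (density lborel f) {b} + measure (density lborel f) {a..<b}"
    by (intro nu.finite_measure_Union) auto
  finally show ?thesis using assms integral_Icc[OF assms] by (simp add: measure_singleton measure_eq)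
qed (simp add: set_lebesgue_integral_def)

text \<open>The probability integral transform for an intensity that is merely integrable. It replaces
  the chain rule for \<open>exp \<circ> F\<close>, which is not available pointwise because \<open>F\<close> need not be
  differentiable.\<close>

lemma distr_F:
  assumes ab: "a \<le> b"
  shows "distr (density lborel (\<lambda>u. f u * indicator {a<..b} u)) borel F
       = density lborel (indicator {F a<..F b})" (is "?L = ?R")
proof (rule cdf_unique')
  let ?d = "density lborel (\<lambda>u. f u * indicator {a<..b} u)"
  interpret g: integrable_intensity "\<lambda>u. f u * indicator {a<..b} u"
    using nonneg integrable_mult_indicator[OF _ integrable, of "{a<..b}"]
    by unfold_locales (auto simp: mult.commute)
  have "finite_measure ?L"
    by (rule g.nu.finite_measure_distr) simp
  then show "finite_borel_measure ?L"
    unfolding finite_borel_measure_def finite_borel_measure_axioms_def by simp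
  have "finite_measure ?R"
  proof (rule finite_measureI)
    have "emeasure ?R (space ?R) = emeasure lborel {F a<..F b}"
      by (simp add: emeasure_density)
    also have "\<dots> = ennreal (F b - F a)" by (rule emeasure_lborel_Ioc[OF F_mono[OF ab]])
    finally show "emeasure ?R (space ?R) \<noteq> \<infinity>" by (simp only: infinity_ennreal_def ennreal_neq_top not_False_eq_True)
  qed
  then show "finite_borel_measure ?R"
    unfolding finite_borel_measure_def finite_borel_measure_axioms_def by simp
  have Fab: "F a \<le> F b" using ab by (rule F_mono)
  show "cdf ?L = cdf ?R"
  proof
    fix x
    define y where "y = max (F a) (min x (F b))"
    have y: "F a \<le> y" "y \<le> F b" using Fab by (auto simp: y_def)
    \<comment> \<open>The sublevel set of the monotone continuous \<open>F\<close> is an interval \<open>{a..c}\<close> with \<open>F c = y\<close>.\<close>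
    define T where "T = {u\<in>{a..b}. F u \<le> y}"
    have "compact T"
    proof -
      have "T = {a..b} \<inter> F -` {..y}" by (auto simp: T_def)
      moreover have "closed ({a..b} \<inter> F -` {..y})"
        by (intro continuous_closed_preimage F_cont) auto
      then have "compact ({a..b} \<inter> ({a..b} \<inter> F -` {..y}))"
        by (rule compact_Int_closed[OF compact_Icc])
      ultimately show ?thesis by simp
    qed
    moreover have "a \<in> T" using y ab by (auto simp: T_def)
    ultimately obtain c where c: "c \<in> T" "\<And>u. u \<in> T \<Longrightarrow> u \<le> c"
      using compact_attains_sup[of T] by auto
    have Teq: "T = {a..c}"
      using c F_mono by (fastforce simp: T_def)
    obtain v where v: "a \<le> v" "v \<le> b" "F v = y"
      using IVT'[of F a y b] y ab F_cont by auto
    then have "v \<in> T" by (auto simp: T_def)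
    then have Fc: "F c = y" using c v F_mono[of v c] by (auto simp: T_def)
    have "cdf ?L x = measure ?d {u. F u \<le> x}"
      by (simp add: cdf_def2 measure_distr vimage_def)
    also have "\<dots> = (LBINT u:{u. F u \<le> x}. f u * indicator {a<..b} u)"
      by (subst g.measure_eq) auto
    also have "\<dots> = (LBINT u:{u. F u \<le> x} \<inter> {a<..b}. f u)"
      unfolding set_lebesgue_integral_def by (intro Bochner_Integration.integral_cong) (auto split: split_indicator)
    also have "\<dots> = y - F a"
    proof (cases "x < F a")
      case True
      then have e: "{u. F u \<le> x} \<inter> {a<..b} = {}"
      proof (intro equals0I, elim IntE)
        fix u assume "u \<in> {u. F u \<le> x}" "u \<in> {a<..b}"
        then show False using F_mono[of a u] True by auto
      qed
      show ?thesis unfolding e using True by (simp add: y_def set_lebesgue_integral_def)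
    next
      case False
      have "{u. F u \<le> x} \<inter> {a<..b} = {a<..c}"
      proof (intro set_eqI)
        fix u
        have "F u \<le> x \<longleftrightarrow> F u \<le> y" if "a < u" "u \<le> b"
          using F_mono[of u b] that False by (auto simp: y_def)
        moreover have "u \<in> T \<longleftrightarrow> u \<in> {a..c}" using Teq by simp
        moreover have "c \<le> b" using c(1) by (simp add: T_def)
        ultimately show "u \<in> {u. F u \<le> x} \<inter> {a<..b} \<longleftrightarrow> u \<in> {a<..c}"
          by (auto simp: T_def)
      qed
      then show ?thesis using integral_Ioc[of a c] Fc c(1) by (auto simp: T_def)
    qed
    also have "y - F a = cdf ?R x"
    proof -
      have "emeasure ?R {..x} = emeasure lborel ({F a<..F b} \<inter> {..x})"
        by (subst emeasure_density)
          (auto simp flip: nn_integral_indicator intro!: nn_integral_cong split: split_indicator)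
      also have "{F a<..F b} \<inter> {..x} = {F a<..y} "
        using Fab by (auto simp: y_def)
      finally show ?thesis using y by (simp add: cdf_def2 measure_def)
    qed
    finally show "cdf ?L x = cdf ?R x" .
  qed
qed

text \<open>The left-hand side is the density of the last point in \<open>(a, b]\<close> of a Poisson process with
  intensity \<open>f\<close>, integrated over its position; the right-hand side is the probability that there
  is a point.\<close>

lemma nn_integral_exp_Ioc:
  assumes ab: "a \<le> b"
  shows "(\<integral>\<^sup>+u\<in>{a<..b}. ennreal (survival f u b) \<partial>lborel) = ennreal (1 - exp (- (F b - F a)))"
proof -
  have "(\<integral>\<^sup>+u\<in>{a<..b}. ennreal (survival f u b) \<partial>lborel)
     = (\<integral>\<^sup>+u. ennreal (f u * indicator {a<..b} u) * ennreal (exp (F u - F b)) \<partial>lborel)"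
    by (intro nn_integral_cong) (auto simp: ennreal_mult'' nonneg split: split_indicator)
  also have "\<dots> = (\<integral>\<^sup>+u. ennreal (exp (F u - F b)) \<partial>density lborel (\<lambda>u. f u * indicator {a<..b} u))"
    by (subst nn_integral_density) auto
  also have "\<dots> = (\<integral>\<^sup>+y. ennreal (exp (y - F b)) \<partial>distr (density lborel (\<lambda>u. f u * indicator {a<..b} u)) borel F)"
    by (subst nn_integral_distr) auto
  also have "\<dots> = (\<integral>\<^sup>+y. indicator {F a<..F b} y * ennreal (exp (y - F b)) \<partial>lborel)"
    by (subst distr_F[OF ab], subst nn_integral_density) auto
  also have "\<dots> = (\<integral>\<^sup>+y. ennreal (exp (y - F b)) * indicator {F a..F b} y \<partial>lborel)"
    by (intro nn_integral_cong_AE, use AE_lborel_singleton[of "F a"] in eventually_elim)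
      (auto split: split_indicator)
  also have "\<dots> = ennreal (exp (F b - F b) - exp (F a - F b))"
    by (rule nn_integral_FTC_Icc) (auto intro!: derivative_eq_intros F_mono ab)
  finally show ?thesis by simp
qed

lemma F_eq_0:
  assumes neg: "\<And>u. u < 0 \<Longrightarrow> f u = 0" and x: "x \<le> 0"
  shows "F x = 0"
proof -
  have "(LBINT u:{..x}. f u) = (LBINT u:{..x}. 0)"
    unfolding set_lebesgue_integral_def
    by (intro integral_cong_AE, measurable, use AE_lborel_singleton[of 0] in eventually_elim)
      (use x neg in \<open>auto split: split_indicator\<close>)
  then show ?thesis by (simp add: primitive_def)
qed

text \<open>The case of an infinite window, which evaluates the limit of \<open>m\<close>.\<close>

lemma nn_integral_exp_total:
  assumes neg: "\<And>u. u < 0 \<Longrightarrow> f u = 0"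
  shows "(\<integral>\<^sup>+u. ennreal (f u * exp (- ((LBINT v. f v) - F u))) \<partial>lborel)
    = ennreal (1 - exp (- (LBINT v. f v)))"
proof -
  note F0 = F_eq_0[OF neg]
  let ?I = "LBINT v. f v"
  have "(\<lambda>n. \<integral>\<^sup>+u\<in>{0<..real n}. ennreal (survival f u n) \<partial>lborel)
     \<longlonglongrightarrow> (\<integral>\<^sup>+u. ennreal (f u * exp (- (?I - F u))) \<partial>lborel)"
  proof (rule nn_integral_dominated_convergence[where w="\<lambda>u. ennreal (f u)"])
    show "(\<integral>\<^sup>+u. ennreal (f u) \<partial>lborel) < \<infinity>"
      using nn_integral_eq_integral[OF integrable] nonneg by simp
    show "AE u in lborel. ennreal (survival f u n) * indicator {0<..real n} u \<le> ennreal (f u)" for n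
      using nonneg F_mono by (intro AE_I2) (auto split: split_indicator intro!: ennreal_leI mult_left_le)
    show "AE u in lborel. (\<lambda>n. ennreal (survival f u n) * indicator {0<..real n} u)
        \<longlonglongrightarrow> ennreal (f u * exp (- (?I - F u)))"
      using AE_lborel_singleton[of 0]
    proof eventually_elim
      case (elim u)
      show ?case
      proof (cases "u < 0")
        case False
        then have u: "u > 0" using elim by simp
        have "(\<lambda>n. F (real n)) \<longlonglongrightarrow> ?I"
          using F_lim filterlim_real_sequentially by (rule filterlim_compose)
        then have "(\<lambda>n. ennreal (survival f u n)) \<longlonglongrightarrow> ennreal (f u * exp (- (?I - F u)))"
          by (intro tendsto_intros tendsto_ennrealI)
        moreover have "eventually (\<lambda>n. u \<le> real n) sequentially"
          using filterlim_real_sequentially by (auto simp: filterlim_at_top)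
        then have "eventually (\<lambda>n. ennreal (survival f u n) =
           ennreal (survival f u n) * indicator {0<..real n} u) sequentially"
          by eventually_elim (use u in auto)
        ultimately show ?thesis by (rule Lim_transform_eventually)
      qed (simp add: neg)
    qed
  qed auto
  moreover have "(\<lambda>n. \<integral>\<^sup>+u\<in>{0<..real n}. ennreal (survival f u n) \<partial>lborel)
     \<longlonglongrightarrow> ennreal (1 - exp (- ?I))"
  proof -
    have "(\<lambda>n. F (real n)) \<longlonglongrightarrow> ?I"
      using F_lim filterlim_real_sequentially by (rule filterlim_compose)
    then have "(\<lambda>n. ennreal (1 - exp (- F (real n)))) \<longlonglongrightarrow> ennreal (1 - exp (- ?I))"
      by (intro tendsto_intros tendsto_ennrealI)
    moreover have "(\<integral>\<^sup>+u\<in>{0<..real n}. ennreal (survival f u n) \<partial>lborel)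
        = ennreal (1 - exp (- F (real n)))" for n
      using nn_integral_exp_Ioc[of 0 "real n"] by (simp only: F0 of_nat_0_le_iff order_refl diff_zero)
    ultimately show ?thesis by (simp only:)
  qed
  ultimately show ?thesis by (rule LIMSEQ_unique)
qed

text \<open>Write the integrand on the right as an integral over the position \<open>u\<close> of the last point in
  \<open>(v - h, v]\<close> and exchange the integrals. For fixed \<open>u\<close> the variable \<open>v\<close> runs over \<open>[u, u + h)\<close>,
  an interval of length \<open>h\<close> on which the exponential is smallest at the right end.\<close>

lemma gap_bound:
  assumes h: "h > 0"
  shows "ennreal h * (\<integral>\<^sup>+u. ennreal (survival f u (u + h)) \<partial>lborel)
    \<le> (\<integral>\<^sup>+v. ennreal (1 - exp (- (F v - F (v - h)))) \<partial>lborel)"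
proof -
  have "ennreal h * (\<integral>\<^sup>+u. ennreal (survival f u (u + h)) \<partial>lborel)
     = (\<integral>\<^sup>+u. (\<integral>\<^sup>+v. ennreal (survival f u (u + h)) * indicator {u..<u+h} v \<partial>lborel) \<partial>lborel)"
    using h by (subst nn_integral_cmult) (auto simp: nn_integral_cmult mult.commute nn_integral_multc)
  also have "\<dots> \<le> (\<integral>\<^sup>+u. (\<integral>\<^sup>+v. ennreal (survival f u v) * indicator {u..<u+h} v \<partial>lborel) \<partial>lborel)"
    using F_mono nonneg
    by (intro nn_integral_mono) (auto split: split_indicator intro!: ennreal_leI mult_left_mono)
  also have "\<dots> = (\<integral>\<^sup>+u. (\<integral>\<^sup>+v. ennreal (survival f u v) * indicator {(u,v). u \<le> v \<and> v < u + h} (u,v) \<partial>lborel) \<partial>lborel)"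
    by (intro nn_integral_cong) (auto split: split_indicator)
  also have "\<dots> = (\<integral>\<^sup>+v. (\<integral>\<^sup>+u. ennreal (survival f u v) * indicator {(u,v). u \<le> v \<and> v < u + h} (u,v) \<partial>lborel) \<partial>lborel)"
    by (rule lborel_pair.Fubini'[symmetric]) measurable
  also have "\<dots> = (\<integral>\<^sup>+v. (\<integral>\<^sup>+u\<in>{v-h<..v}. ennreal (survival f u v) \<partial>lborel) \<partial>lborel)"
    by (intro nn_integral_cong) (auto split: split_indicator)
  also have "\<dots> = (\<integral>\<^sup>+v. ennreal (1 - exp (- (F v - F (v - h)))) \<partial>lborel)"
    by (rule nn_integral_cong, rule nn_integral_exp_Ioc) (use h in simp)
  finally show ?thesis .
qed

end

section \<open>The function m\<close>

lemma borel_measurable_primitive: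
  assumes [measurable]: "(\<lambda>(w, u). g w u) \<in> borel_measurable (M \<Otimes>\<^sub>M borel)"
  shows "(\<lambda>(w, x). primitive (g w) x) \<in> borel_measurable (M \<Otimes>\<^sub>M borel)"
proof -
  have "(\<lambda>p. LINT u|lborel. indicator {(x, u). u \<le> x} (snd p, u) *\<^sub>R g (fst p) u)
      \<in> borel_measurable (M \<Otimes>\<^sub>M borel)"
    by measurable
  moreover have "(\<lambda>(w, x). primitive (g w) x)
      = (\<lambda>p. LINT u|lborel. indicator {(x, u). u \<le> x} (snd p, u) *\<^sub>R g (fst p) u)"
    unfolding primitive_def set_lebesgue_integral_def
    by (auto simp: fun_eq_iff indicator_def intro!: Bochner_Integration.integral_cong)
  ultimately show ?thesis by simp
qed

lemma cumulative_0_eq_primitive: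
  assumes "\<And>u. u < 0 \<Longrightarrow> f u = 0"
  shows "cumulative f 0 x = primitive f x"
  unfolding cumulative_def primitive_def set_lebesgue_integral_def
  by (intro Bochner_Integration.integral_cong) (use assms in \<open>auto split: split_indicator\<close>)

locale tagged_intensity = prob_space M
  for M :: "'w measure" and l :: "'w \<Rightarrow> real \<Rightarrow> real" +
  assumes random_intensity: "random_intensity M l"
    and zero_before_arrival: "w \<in> space M \<Longrightarrow> u < 0 \<Longrightarrow> l w u = 0"
    and integrable_AE: "AE w in M. integrable lborel (l w)"
begin

abbreviation \<Lambda> :: "'w \<Rightarrow> real \<Rightarrow> real" where "\<Lambda> w \<equiv> primitive (l w)"

lemma l_measurable [measurable]: "(\<lambda>(w, u). l w u) \<in> borel_measurable (M \<Otimes>\<^sub>M borel)"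
  using random_intensity by (simp add: random_intensity_def)

lemma l_nonneg: "w \<in> space M \<Longrightarrow> 0 \<le> l w u"
  using random_intensity by (auto simp: random_intensity_def)

lemma l_section [measurable (raw)]: "w \<in> space M \<Longrightarrow> l w \<in> borel_measurable borel"
  using measurable_Pair2[OF l_measurable] by simp

lemma prim_measurable [measurable]:
  "(\<lambda>(w, x). \<Lambda> w x) \<in> borel_measurable (M \<Otimes>\<^sub>M borel)"
  by (rule borel_measurable_primitive) simp

lemma AE_intensity: "AE w in M. w \<in> space M \<and> integrable_intensity (l w)"
  using integrable_AE AE_space
  by eventually_elim (simp add: integrable_intensity_def l_nonneg)

text \<open>The function \<open>m\<close> before averaging over the intensity.\<close>

definition surviving_mass :: "real \<Rightarrow> 'w \<Rightarrow> ennreal" where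
  "surviving_mass t w =
     (\<integral>\<^sup>+u. ennreal (survival (l w) u (u + t)) \<partial>lborel)"

lemma surviving_mass_measurable [measurable]: "surviving_mass t \<in> borel_measurable M"
  unfolding surviving_mass_def by measurable

lemma mean_misses_eq: "mean_misses M l t = (\<integral>\<^sup>+w. surviving_mass t w \<partial>M)"
  unfolding mean_misses_def surviving_mass_def
proof (intro nn_integral_cong)
  fix w u assume "w \<in> space M"
  note z = zero_before_arrival[OF this]
  show "ennreal (l w u * exp (- (cumulative (l w) 0 (u + t) - cumulative (l w) 0 u))) * indicator {0..} u
    = ennreal (survival (l w) u (u + t))"
    using z by (auto simp: cumulative_0_eq_primitive split: split_indicator)
qed

lemma surviving_mass_antimono:
  assumes "integrable_intensity (l w)" "s \<le> t"
  shows "surviving_mass t w \<le> surviving_mass s w"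
proof -
  interpret integrable_intensity "l w" by fact
  show ?thesis unfolding surviving_mass_def using assms(2)
    by (intro nn_integral_mono ennreal_leI mult_left_mono nonneg) (auto intro: F_mono)
qed

lemma mean_misses_antimono: "s \<le> t \<Longrightarrow> mean_misses M l t \<le> mean_misses M l s"
  unfolding mean_misses_eq
  by (intro nn_integral_mono_AE, use AE_intensity in eventually_elim)
    (simp add: surviving_mass_antimono)

end

locale catalog_intensity = tagged_intensity M l
  for M :: "'w measure" and l :: "'w \<Rightarrow> real \<Rightarrow> real" +
  assumes finite_rate: "s \<le> t \<Longrightarrow>
      (\<integral>\<^sup>+a\<in>{..t}. (\<integral>\<^sup>+w. ennreal (1 - exp (- (cumulative (shift_intensity a l w) a t
                                         - cumulative (shift_intensity a l w) a s))) \<partial>M)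
        \<partial>lborel) < \<infinity>"
begin

lemma cumulative_shift:
  assumes "w \<in> space M"
  shows "cumulative (shift_intensity a l w) a x = \<Lambda> w (x - a)"
proof -
  have "cumulative (shift_intensity a l w) a x = (LINT u|lborel. indicator {a..x} u *\<^sub>R l w (u - a))"
    by (simp add: cumulative_def shift_intensity_def set_lebesgue_integral_def)
  also have "\<dots> = (LINT u|lborel. indicator {a..x} (a + u) *\<^sub>R l w u)"
    by (subst lborel_integral_real_affine[of 1 _ a]) (auto simp: add.commute)
  also have "\<dots> = (LINT u|lborel. indicator {..x - a} u *\<^sub>R l w u)"
    using zero_before_arrival[OF assms]
    by (intro Bochner_Integration.integral_cong) (auto split: split_indicator)
  finally show ?thesis by (simp add: primitive_def set_lebesgue_integral_def)
qed

text \<open>Substituting the age \<open>v = h - a\<close> for the arrival time turns the assumption for the window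
  \<open>[0, h]\<close> into a statement about the canonical intensity alone.\<close>

lemma finite_window_rate:
  assumes "h \<ge> 0"
  shows "(\<integral>\<^sup>+w. \<integral>\<^sup>+v. ennreal (1 - exp (- (\<Lambda> w v - \<Lambda> w (v - h)))) \<partial>lborel \<partial>M) < \<infinity>"
proof -
  let ?g = "\<lambda>w v. ennreal (1 - exp (- (\<Lambda> w v - \<Lambda> w (v - h))))"
  interpret P: pair_sigma_finite M lborel ..
  have zero: "?g w v = 0" if "w \<in> space M" "v < 0" for w v
  proof -
    have "\<Lambda> w x = 0" if "x < 0" for x
      unfolding primitive_def set_lebesgue_integral_def using zero_before_arrival[OF \<open>w \<in> space M\<close>] that
      by (intro integral_eq_zero_AE AE_I2) (auto split: split_indicator)
    then show ?thesis using that assms by simp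
  qed
  have "(\<integral>\<^sup>+w. \<integral>\<^sup>+v. ?g w v \<partial>lborel \<partial>M) = (\<integral>\<^sup>+v. \<integral>\<^sup>+w. ?g w v \<partial>M \<partial>lborel)"
    by (rule P.Fubini'[symmetric]) measurable
  also have "\<dots> = (\<integral>\<^sup>+a. \<integral>\<^sup>+w. ?g w (h - a) \<partial>M \<partial>lborel)"
    by (subst nn_integral_real_affine[of _ "-1" h]) (simp_all)
  also have "\<dots> = (\<integral>\<^sup>+a\<in>{..h}. (\<integral>\<^sup>+w. ennreal (1 - exp (- (cumulative (shift_intensity a l w) a h
                                         - cumulative (shift_intensity a l w) a 0))) \<partial>M) \<partial>lborel)"
  proof (intro nn_integral_cong)
    fix a :: real
    show "(\<integral>\<^sup>+w. ?g w (h - a) \<partial>M) = (\<integral>\<^sup>+w. ennreal (1 - exp (- (cumulative (shift_intensity a l w) a h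
        - cumulative (shift_intensity a l w) a 0))) \<partial>M) * indicator {..h} a"
    proof (cases "a \<le> h")
      case True
      have "(\<integral>\<^sup>+w. ?g w (h - a) \<partial>M) = (\<integral>\<^sup>+w. ennreal (1 - exp (- (cumulative (shift_intensity a l w) a h
        - cumulative (shift_intensity a l w) a 0))) \<partial>M)"
      proof (rule nn_integral_cong)
        fix w assume "w \<in> space M"
        moreover have "0 - a = h - a - h" by simp
        ultimately show "?g w (h - a) = ennreal (1 - exp (- (cumulative (shift_intensity a l w) a h
          - cumulative (shift_intensity a l w) a 0)))"
          by (simp only: cumulative_shift)
      qed
      with True show ?thesis by simp
    next
      case False
      then have "(\<integral>\<^sup>+w. ?g w (h - a) \<partial>M) = (\<integral>\<^sup>+w. 0 \<partial>M)"
        by (intro nn_integral_cong) (rule zero, auto)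
      also have "\<dots> = 0" by simp
      finally show ?thesis using False by (simp only: indicator_simps atMost_iff mult_zero_right not_False_eq_True)
    qed
  qed
  finally show ?thesis using finite_rate[of 0 h] assms by simp
qed

text \<open>Provides the integrable bound for the limit of \<open>m\<close> at infinity.\<close>

lemma mean_misses_finite:
  assumes h: "h > 0"
  shows "mean_misses M l h < \<infinity>"
proof -
  have "ennreal h * mean_misses M l h = (\<integral>\<^sup>+w. ennreal h * surviving_mass h w \<partial>M)"
    by (simp add: mean_misses_eq nn_integral_cmult)
  also have "\<dots> \<le> (\<integral>\<^sup>+w. \<integral>\<^sup>+v. ennreal (1 - exp (- (\<Lambda> w v - \<Lambda> w (v - h)))) \<partial>lborel \<partial>M)"
  proof (intro nn_integral_mono_AE, use AE_intensity in eventually_elim)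
    case (elim w)
    then interpret integrable_intensity "l w" by simp
    show ?case unfolding surviving_mass_def by (rule gap_bound[OF h])
  qed
  also have "\<dots> < \<infinity>" using finite_window_rate[of h] h by simp
  finally show ?thesis using h by (auto simp: ennreal_mult_less_top)
qed

lemma surviving_mass_tendsto:
  assumes "integrable_intensity (l w)" "w \<in> space M" "filterlim X at_top sequentially"
  shows "(\<lambda>n. surviving_mass (X n) w) \<longlonglongrightarrow> ennreal (1 - exp (- (LBINT u. l w u)))"
proof -
  interpret integrable_intensity "l w" by fact
  let ?I = "LBINT u. l w u"
  have "(\<lambda>n. surviving_mass (X n) w) \<longlonglongrightarrow> (\<integral>\<^sup>+u. ennreal (l w u * exp (- (?I - F u))) \<partial>lborel)"
    unfolding surviving_mass_def
  proof (rule nn_integral_dominated_convergence[where w="\<lambda>u. ennreal (exp ?I * l w u)"])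
    show "(\<integral>\<^sup>+u. ennreal (exp ?I * l w u) \<partial>lborel) < \<infinity>"
      using nn_integral_eq_integral[OF integrable] nonneg integrable
      by (simp add: ennreal_mult nn_integral_cmult ennreal_mult_less_top)
    show "AE u in lborel. ennreal (survival (l w) u (u + X n)) \<le> ennreal (exp ?I * l w u)" for n
    proof (intro AE_I2 ennreal_leI)
      fix u
      have "F u - F (u + X n) \<le> ?I" using F_bounded[of u] F_nonneg[of "u + X n"] by simp
      then show "survival (l w) u (u + X n) \<le> exp ?I * l w u"
        using mult_left_mono[OF _ nonneg, of "exp (- (F (u + X n) - F u))" "exp ?I" u] by (simp add: mult.commute)
    qed
    show "AE u in lborel. (\<lambda>n. ennreal (survival (l w) u (u + X n)))
       \<longlonglongrightarrow> ennreal (l w u * exp (- (?I - F u)))"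
    proof (intro AE_I2 tendsto_ennrealI tendsto_intros)
      fix u
      have "filterlim (\<lambda>n. u + X n) at_top sequentially"
        using assms(3) by (intro filterlim_tendsto_add_at_top[OF tendsto_const])
      then show "(\<lambda>n. F (u + X n)) \<longlonglongrightarrow> ?I" by (rule filterlim_compose[OF F_lim])
    qed
  qed auto
  also have "(\<integral>\<^sup>+u. ennreal (l w u * exp (- (?I - F u))) \<partial>lborel) = ennreal (1 - exp (- ?I))"
    using zero_before_arrival[OF assms(2)] by (rule nn_integral_exp_total)
  finally show ?thesis .
qed

lemma mean_misses_tendsto:
  "(mean_misses M l \<longlongrightarrow> (\<integral>\<^sup>+w. ennreal (1 - exp (- (LBINT u. l w u))) \<partial>M)) at_top"
proof (rule tendsto_at_topI_sequentially)
  fix X :: "nat \<Rightarrow> real" assume X: "filterlim X at_top sequentially"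
  \<comment> \<open>\<open>m\<close> may be infinite at \<open>0\<close>, so the domination starts at time \<open>1\<close>.\<close>
  let ?Y = "\<lambda>n. max 1 (X n)"
  have ev: "eventually (\<lambda>n. 1 \<le> X n) sequentially" using X by (auto simp: filterlim_at_top)
  have Y: "filterlim ?Y at_top sequentially"
    by (rule filterlim_at_top_mono[OF X]) simp
  have "(\<lambda>n. \<integral>\<^sup>+w. surviving_mass (?Y n) w \<partial>M) \<longlonglongrightarrow> (\<integral>\<^sup>+w. ennreal (1 - exp (- (LBINT u. l w u))) \<partial>M)"
  proof (rule nn_integral_dominated_convergence[where w="surviving_mass 1"])
    show "(\<integral>\<^sup>+w. surviving_mass 1 w \<partial>M) < \<infinity>"
      using mean_misses_finite[of 1] by (simp add: mean_misses_eq)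
    show "AE w in M. surviving_mass (?Y n) w \<le> surviving_mass 1 w" for n
      using AE_intensity by eventually_elim (auto intro: surviving_mass_antimono)
    show "AE w in M. (\<lambda>n. surviving_mass (?Y n) w) \<longlonglongrightarrow> ennreal (1 - exp (- (LBINT u. l w u)))"
      using AE_intensity by eventually_elim (use Y in \<open>auto intro: surviving_mass_tendsto\<close>)
  qed (auto simp: mean_misses_eq)
  then have "(\<lambda>n. mean_misses M l (?Y n)) \<longlonglongrightarrow> (\<integral>\<^sup>+w. ennreal (1 - exp (- (LBINT u. l w u))) \<partial>M)"
    by (simp only: mean_misses_eq)
  moreover have "eventually (\<lambda>n. mean_misses M l (?Y n) = mean_misses M l (X n)) sequentially"
    using ev by eventually_elim (simp add: max_def)
  ultimately show "(\<lambda>n. mean_misses M l (X n)) \<longlonglongrightarrow> (\<integral>\<^sup>+w. ennreal (1 - exp (- (LBINT u. l w u))) \<partial>M)"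
    by (rule Lim_transform_eventually)
qed

end

section \<open>Configurations and exit times\<close>

lemma space_config: "space config = {S. locally_finite_set S}"
  unfolding config_def by (subst space_measure_of) auto

lemma locally_finite_finite: "locally_finite_set S \<Longrightarrow> bounded B \<Longrightarrow> finite (S \<inter> B)"
  by (simp add: locally_finite_set_def)

text \<open>Points do not accumulate; this lets real end points of windows be replaced by rational ones.\<close>

lemma locally_finite_gap:
  assumes "locally_finite_set S"
  obtains e where "e > 0" "S \<inter> {a - e..<a} = {}" "S \<inter> {a<..a + e} = {}"
proof -
  have "finite (S \<inter> {a-1..a+1})" using assms by (intro locally_finite_finite) auto
  from finite_set_avoid[OF this, of a]
  obtain d where d: "d > 0" "\<And>x. x \<in> S \<inter> {a-1..a+1} \<Longrightarrow> x \<noteq> a \<Longrightarrow> d \<le> dist a x" by auto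
  have d': "x = a" if "x \<in> S" "\<bar>x - a\<bar> \<le> 1" "\<bar>x - a\<bar> < d" for x
    using d(2)[of x] that by (cases "x = a") (auto simp: dist_real_def abs_le_iff abs_minus_commute)
  show ?thesis
    by (rule that[of "min 1 (d/2)"]) (use d(1) in \<open>auto dest!: d'\<close>)
qed

lemma count_measurable [measurable]:
  assumes "B \<in> sets borel" "bounded B"
  shows "(\<lambda>S. card (S \<inter> B)) \<in> config \<rightarrow>\<^sub>M count_space UNIV"
proof (subst measurable_count_space_eq2_countable, safe)
  fix k
  have "(\<lambda>S. card (S \<inter> B)) -` {k} \<inter> space config = {S. locally_finite_set S \<and> card (S \<inter> B) = k}"
    by (auto simp: space_config)
  also have "\<dots> \<in> sets config"
    unfolding config_def using assms by (intro in_measure_of) (auto intro!: exI[of _ B] exI[of _ k])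
  finally show "(\<lambda>S. card (S \<inter> B)) -` {k} \<inter> space config \<in> sets config" .
qed auto

lemma avoids_measurable:
  assumes "B \<in> sets borel" "bounded B"
  shows "{S \<in> space config. S \<inter> B = {}} \<in> sets config"
proof -
  have "{S \<in> space config. S \<inter> B = {}} = {S \<in> space config. card (S \<inter> B) = 0}"
    using locally_finite_finite assms by (auto simp: space_config)
  also have "\<dots> \<in> sets config" using count_measurable[OF assms] by measurable
  finally show ?thesis .
qed

lemma avoids_event:
  assumes S: "S \<in> M \<rightarrow>\<^sub>M config" and B: "B \<in> sets borel" "bounded B"
  shows "{w \<in> space M. S w \<inter> B = {}} \<in> sets M"
proof -
  have "{w \<in> space M. S w \<inter> B = {}} = S -` {R \<in> space config. R \<inter> B = {}} \<inter> space M"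
    using measurable_space[OF S] by auto
  then show ?thesis using measurable_sets[OF S avoids_measurable[OF B]] by simp
qed

text \<open>Joint measurability in the configuration and the position of the window. A window that
  misses a locally finite set lies in the interior of a window with rational end points that also
  misses it, so the complement is a countable union of rectangles.\<close>

lemma hits_window_measurable:
  "{p \<in> space (config \<Otimes>\<^sub>M borel). fst p \<inter> {snd p..snd p + q} \<noteq> {}} \<in> sets (config \<Otimes>\<^sub>M borel)"
  (is "{p \<in> ?\<Omega>. ?P p} \<in> sets ?M")
proof -
  define U where "U = (\<Union>a\<in>\<rat>. \<Union>b\<in>\<rat>. {S \<in> space config. S \<inter> {a..b} = {}} \<times> {s. a < s \<and> s + q < b})"
  have "U \<in> sets ?M" unfolding U_def
    by (intro sets.countable_UN'' countable_rat pair_measureI avoids_measurable) auto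
  moreover have "{p \<in> ?\<Omega>. ?P p} = ?\<Omega> - U"
  proof (intro set_eqI iffI)
    fix p assume "p \<in> {p \<in> ?\<Omega>. ?P p}"
    then show "p \<in> ?\<Omega> - U" by (fastforce simp: U_def)
  next
    fix p assume p: "p \<in> ?\<Omega> - U"
    obtain S s where ps: "p = (S, s)" by (cases p)
    then have lf: "locally_finite_set S" using p by (auto simp: space_pair_measure space_config)
    have "S \<inter> {s..s+q} \<noteq> {}"
    proof
      assume e: "S \<inter> {s..s+q} = {}"
      obtain d where d: "d > 0" "S \<inter> {s - d..<s} = {}" using locally_finite_gap[OF lf, of s] by metis
      obtain c where c: "c > 0" "S \<inter> {s+q<..s + q + c} = {}" using locally_finite_gap[OF lf, of "s+q"] by metis
      obtain a where a: "a \<in> \<rat>" "s - d < a" "a < s" using Rats_dense_in_real[of "s - d" s] d by auto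
      obtain b where b: "b \<in> \<rat>" "s + q < b" "b < s + q + c" using Rats_dense_in_real[of "s + q" "s+q+c"] c by auto
      have "S \<inter> {a..b} = {}"
      proof (rule ccontr)
        assume "S \<inter> {a..b} \<noteq> {}"
        then obtain x where x: "x \<in> S" "a \<le> x" "x \<le> b" by auto
        then have "x \<in> S \<inter> {s - d..<s} \<or> x \<in> S \<inter> {s..s+q} \<or> x \<in> S \<inter> {s+q<..s + q + c}"
          using a b by auto
        then show False using c d e by auto
      qed
      then have "p \<in> U" using a b ps lf by (fastforce simp: U_def space_config)
      with p show False by simp
    qed
    with p ps show "p \<in> {p \<in> ?\<Omega>. ?P p}" by simp
  qed
  ultimately show ?thesis by (simp add: sets.compl_sets)
qed

lemma distinct_requested_measurable [measurable]:
  "(\<lambda>(S, s). distinct_requested S s (s + q)) \<in> (PiM UNIV (\<lambda>_. config) \<Otimes>\<^sub>M borel) \<rightarrow>\<^sub>M count_space UNIV"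
  unfolding distinct_requested_def split_beta
proof (rule measurable_card)
  fix i :: nat
  have "(\<lambda>p. (fst p i, snd p)) \<in> (PiM UNIV (\<lambda>_. config) \<Otimes>\<^sub>M borel) \<rightarrow>\<^sub>M config \<Otimes>\<^sub>M borel"
    by measurable
  from measurable_sets_Collect[OF this hits_window_measurable[of q]]
  show "{x \<in> space (PiM UNIV (\<lambda>_. config) \<Otimes>\<^sub>M borel). i \<in> {n. fst x n \<inter> {snd x..snd x + q} \<noteq> {}}}
      \<in> sets (PiM UNIV (\<lambda>_. config) \<Otimes>\<^sub>M borel)"
    by (simp add: measurable_def)
qed

text \<open>A version of \<open>exit_time C S s < y\<close> that involves countably many times only and is therefore
  measurable jointly in \<open>S\<close>, \<open>s\<close> and \<open>y\<close>.\<close>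

definition filled_before :: "nat \<Rightarrow> (nat \<Rightarrow> real set) \<Rightarrow> real \<Rightarrow> real \<Rightarrow> bool" where
  "filled_before C S s y \<longleftrightarrow> (\<exists>q\<in>\<rat>. 0 \<le> q \<and> s + q < y \<and> distinct_requested S s (s + q) = C)"

lemma measurable_bex_rat:
  fixes P :: "'a \<Rightarrow> real \<Rightarrow> bool"
  assumes "\<And>q. Measurable.pred M (\<lambda>x. P x q)"
  shows "Measurable.pred M (\<lambda>x. \<exists>q\<in>\<rat>. P x q)"
proof -
  have "{x \<in> space M. \<exists>q\<in>\<rat>. P x q} = (\<Union>q\<in>\<rat>. {x \<in> space M. P x q})" by auto
  also have "\<dots> \<in> sets M"
    using assms by (intro sets.countable_UN'' countable_rat) (simp add: pred_def)
  finally show ?thesis by (simp add: pred_def)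
qed

lemma filled_before_measurable [measurable]:
  "Measurable.pred (PiM UNIV (\<lambda>_. config) \<Otimes>\<^sub>M (borel \<Otimes>\<^sub>M borel)) (\<lambda>(S, s, y). filled_before C S s y)"
proof -
  have [measurable]: "(\<lambda>p. distinct_requested (fst p) (fst (snd p)) (fst (snd p) + q)) \<in>
     (PiM UNIV (\<lambda>_. config) \<Otimes>\<^sub>M (borel \<Otimes>\<^sub>M borel)) \<rightarrow>\<^sub>M count_space UNIV" for q
    using measurable_compose[OF _ distinct_requested_measurable,
      of "\<lambda>p. (fst p, fst (snd p))" "PiM UNIV (\<lambda>_. config) \<Otimes>\<^sub>M (borel \<Otimes>\<^sub>M borel)" q] by simp
  show ?thesis unfolding filled_before_def split_beta
    by (rule measurable_bex_rat) measurable
qed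

definition finitely_requested :: "(nat \<Rightarrow> real set) \<Rightarrow> bool" where
  "finitely_requested S \<longleftrightarrow> (\<forall>k::nat. finite {n. S n \<inter> {- real k..real k} \<noteq> {}})"

lemma finitely_requested_window:
  assumes "finitely_requested S"
  shows "finite {n. S n \<inter> {a..b} \<noteq> {}}"
proof -
  obtain k :: nat where k: "max \<bar>a\<bar> \<bar>b\<bar> \<le> real k" using real_arch_simple by blast
  show ?thesis
    by (rule finite_subset[of _ "{n. S n \<inter> {- real k..real k} \<noteq> {}}"])
      (use k assms in \<open>force simp: finitely_requested_def\<close>)+
qed

lemma exit_time_ge: "ereal s \<le> exit_time C S s"
  unfolding exit_time_def by (intro Inf_greatest) auto

text \<open>The set of documents requested in \<open>[s, t]\<close> is right continuous in \<open>t\<close>: finitely many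
  documents are requested shortly after \<open>t\<close>, and their requests do not accumulate at \<open>t\<close>. Hence
  a level attained at a real time is also attained at a rational distance from \<open>s\<close>.\<close>

lemma exit_time_less_iff:
  assumes fr: "finitely_requested S" and lf: "\<And>n. locally_finite_set (S n)"
  shows "exit_time C S s < ereal y \<longleftrightarrow> filled_before C S s y"
proof
  assume "filled_before C S s y"
  then obtain q where q: "0 \<le> q" "s + q < y" "distinct_requested S s (s + q) = C"
    by (auto simp: filled_before_def)
  then have "exit_time C S s \<le> ereal (s + q)"
    unfolding exit_time_def by (intro Inf_lower) auto
  also have "\<dots> < ereal y" using q by simp
  finally show "exit_time C S s < ereal y" .
next
  assume "exit_time C S s < ereal y"
  then obtain t where t: "s \<le> t" "t < y" "distinct_requested S s t = C"
    unfolding exit_time_def Inf_less_iff by auto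
  define N where "N = {n. S n \<inter> {s..t+1} \<noteq> {}}"
  have fN: "finite N" unfolding N_def by (rule finitely_requested_window[OF fr])
  \<comment> \<open>The requests that could change the count shortly after \<open>t\<close>.\<close>
  define U where "U = (\<Union>n\<in>N. S n \<inter> {t..t+1})"
  have "finite U" unfolding U_def using fN lf by (intro finite_UN_I locally_finite_finite) auto
  then have "locally_finite_set U" by (simp add: locally_finite_set_def)
  then obtain e where e: "e > 0" "U \<inter> {t<..t + e} = {}" using locally_finite_gap[of U t] by metis
  obtain q where q: "q \<in> \<rat>" "t - s < q" "q < min (t - s + e) (min (t - s + 1) (y - s))"
    using Rats_dense_in_real[of "t - s" "min (t - s + e) (min (t - s + 1) (y - s))"] e t by auto
  have "{n. S n \<inter> {s..s+q} \<noteq> {}} = {n. S n \<inter> {s..t} \<noteq> {}}"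
  proof (intro set_eqI iffI)
    fix n assume "n \<in> {n. S n \<inter> {s..s+q} \<noteq> {}}"
    then obtain x where x: "x \<in> S n" "s \<le> x" "x \<le> s + q" by auto
    then have "n \<in> N" using q by (auto simp: N_def)
    have "x \<le> t"
    proof (rule ccontr)
      assume "\<not> x \<le> t"
      then have "x \<in> U \<inter> {t<..t+e}" using x q \<open>n \<in> N\<close> by (auto simp: U_def)
      with e show False by simp
    qed
    with x show "n \<in> {n. S n \<inter> {s..t} \<noteq> {}}" by auto
  next
    fix n assume "n \<in> {n. S n \<inter> {s..t} \<noteq> {}}"
    then show "n \<in> {n. S n \<inter> {s..s+q} \<noteq> {}}" using q by fastforce
  qed
  then have "distinct_requested S s (s + q) = C" using t by (simp add: distinct_requested_def)
  then show "filled_before C S s y"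
    unfolding filled_before_def using q t by (intro bexI[of _ q]) auto
qed

section \<open>Request times and gaps\<close>

lemma request_time_le_iff:
  assumes R: "finite R" and r: "1 \<le> r" "r \<le> card R"
  shows "request_time R r \<le> t \<longleftrightarrow> r \<le> card (R \<inter> {..t})"
proof -
  define xs where "xs = sorted_list_of_set R"
  have xs: "sorted xs" "distinct xs" "set xs = R" "length xs = card R"
    using R by (auto simp: xs_def)
  have rt: "request_time R r = xs ! (r - 1)" by (simp add: request_time_def xs_def)
  show ?thesis
  proof
    assume le: "request_time R r \<le> t"
    have "(!) xs ` {..<r} \<subseteq> R \<inter> {..t}"
    proof safe
      fix i assume "i < r"
      then show "xs ! i \<in> R" using r xs by (metis nth_mem order_less_le_trans)
      have "xs ! i \<le> xs ! (r - 1)" using \<open>i < r\<close> r xs by (intro sorted_nth_mono) auto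
      then show "xs ! i \<le> t" using le rt by simp
    qed
    then have "card ((!) xs ` {..<r}) \<le> card (R \<inter> {..t})" using R by (intro card_mono) auto
    moreover have "card ((!) xs ` {..<r}) = r"
      using xs r by (subst card_image) (auto simp: inj_on_def nth_eq_iff_index_eq)
    ultimately show "r \<le> card (R \<inter> {..t})" by simp
  next
    assume le: "r \<le> card (R \<inter> {..t})"
    show "request_time R r \<le> t"
    proof (rule ccontr)
      assume n: "\<not> request_time R r \<le> t"
      have "R \<inter> {..t} \<subseteq> (!) xs ` {..<r - 1}"
      proof
        fix x assume x: "x \<in> R \<inter> {..t}"
        then obtain i where i: "i < length xs" "x = xs ! i" using xs by (metis IntD1 in_set_conv_nth)
        have "i < r - 1"
        proof (rule ccontr)
          assume "\<not> i < r - 1"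
          then have "xs ! (r - 1) \<le> xs ! i" using i xs by (intro sorted_nth_mono) auto
          then show False using n x i rt by simp
        qed
        then show "x \<in> (!) xs ` {..<r - 1}" using i by auto
      qed
      then have "card (R \<inter> {..t}) \<le> card {..<r - 1}"
        by (meson card_image_le card_mono finite_imageI finite_lessThan le_trans)
      then show False using le r by simp
    qed
  qed
qed

lemma card_le_window_iff:
  fixes R :: "real set"
  assumes "finite R"
  shows "r \<le> card (R \<inter> B) \<longleftrightarrow> (\<exists>j::nat. r \<le> card (R \<inter> (B \<inter> {- real j..real j})))"
proof
  assume r: "r \<le> card (R \<inter> B)"
  have "bounded R" using assms by (rule finite_imp_bounded)
  then obtain b where b: "\<And>x. x \<in> R \<Longrightarrow> \<bar>x\<bar> \<le> b" by (auto simp: bounded_iff)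
  obtain j :: nat where "b \<le> real j" using real_arch_simple by blast
  then have "R \<inter> (B \<inter> {- real j..real j}) = R \<inter> B" using b by force
  then show "\<exists>j::nat. r \<le> card (R \<inter> (B \<inter> {- real j..real j}))" using r by metis
next
  assume "\<exists>j::nat. r \<le> card (R \<inter> (B \<inter> {- real j..real j}))"
  then obtain j :: nat where "r \<le> card (R \<inter> (B \<inter> {- real j..real j}))" by blast
  also have "\<dots> \<le> card (R \<inter> B)" using assms by (intro card_mono) auto
  finally show "r \<le> card (R \<inter> B)" .
qed

text \<open>Reduces finiteness to the counts of bounded sets
  that generate the \<open>\<sigma>\<close>-algebra of configurations.\<close>

lemma finite_iff_card_windows:
  assumes "locally_finite_set R"
  shows "finite R \<longleftrightarrow> (\<exists>k. \<forall>j::nat. card (R \<inter> {- real j..real j}) \<le> k)"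
proof
  assume "finite R"
  then show "\<exists>k. \<forall>j::nat. card (R \<inter> {- real j..real j}) \<le> k"
    by (intro exI[of _ "card R"]) (auto intro: card_mono)
next
  assume "\<exists>k. \<forall>j::nat. card (R \<inter> {- real j..real j}) \<le> k"
  then obtain k where k: "\<And>j::nat. card (R \<inter> {- real j..real j}) \<le> k" by auto
  show "finite R"
  proof (rule finite_if_finite_subsets_card_bdd[of _ k, THEN conjunct1])
    fix G assume G: "G \<subseteq> R" "finite G"
    have "bounded G" using G by (intro finite_imp_bounded)
    then obtain b where b: "\<And>x. x \<in> G \<Longrightarrow> \<bar>x\<bar> \<le> b" by (auto simp: bounded_iff)
    obtain j :: nat where "b \<le> real j" using real_arch_simple by blast
    then have "G \<subseteq> R \<inter> {- real j..real j}" using b G by force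
    then have "card G \<le> card (R \<inter> {- real j..real j})"
      using assms by (intro card_mono locally_finite_finite) auto
    then show "card G \<le> k" using k[of j] by simp
  qed
qed

lemma finite_measurable [measurable]: "Measurable.pred config finite"
proof -
  have [measurable]: "(\<lambda>S. card (S \<inter> {- real j..real j})) \<in> config \<rightarrow>\<^sub>M count_space UNIV" for j
    by (rule count_measurable) auto
  have "Measurable.pred config (\<lambda>R. \<exists>k. \<forall>j::nat. card (R \<inter> {- real j..real j}) \<le> k)"
    by measurable
  then show ?thesis
    by (subst measurable_cong[where g="\<lambda>R. \<exists>k. \<forall>j::nat. card (R \<inter> {- real j..real j}) \<le> k"])
      (auto simp: space_config finite_iff_card_windows)
qed

lemma finite_card_ge_measurable:
  assumes [measurable]: "B \<in> sets borel"
  shows "Measurable.pred config (\<lambda>R. finite R \<and> r \<le> card (R \<inter> B))"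
proof -
  have [measurable]: "(\<lambda>S. card (S \<inter> (B \<inter> {- real j..real j}))) \<in> config \<rightarrow>\<^sub>M count_space UNIV" for j
    by (rule count_measurable) auto
  have "Measurable.pred config (\<lambda>R. finite R \<and> (\<exists>j::nat. r \<le> card (R \<inter> (B \<inter> {- real j..real j}))))"
    by measurable
  then show ?thesis by (simp add: card_le_window_iff[of _ r B] cong: conj_cong)
qed

lemma has_request_measurable [measurable]: "Measurable.pred config (\<lambda>R. finite R \<and> r \<le> card R)"
  using finite_card_ge_measurable[of UNIV r] by simp

text \<open>Equals \<open>request_time\<close> where the latter is meaningful; the default value makes it measurable
  on all configurations.\<close>

definition nth_request :: "nat \<Rightarrow> real set \<Rightarrow> real" where
  "nth_request r R = (if finite R \<and> r \<le> card R then request_time R r else 0)"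

lemma nth_request_measurable [measurable]:
  assumes "1 \<le> r"
  shows "nth_request r \<in> borel_measurable config"
proof (rule borel_measurable_iff_le[THEN iffD2], intro allI)
  fix t
  have [measurable]: "Measurable.pred config (\<lambda>R. finite R \<and> r \<le> card (R \<inter> {..t}))"
    by (rule finite_card_ge_measurable) auto
  have "{R \<in> space config. nth_request r R \<le> t} = {R \<in> space config.
     if finite R \<and> r \<le> card R then finite R \<and> r \<le> card (R \<inter> {..t}) else 0 \<le> t}"
    using assms by (auto simp: nth_request_def request_time_le_iff)
  also have "\<dots> \<in> sets config" by measurable
  finally show "{R \<in> space config. nth_request r R \<le> t} \<in> sets config" .
qed

lemma card_eq_sum_of_bool: "finite I \<Longrightarrow> card {i \<in> I. P i} = (\<Sum>i\<in>I. of_bool (P i))"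
  by (simp add: of_bool_def sum.If_cases Int_def)

text \<open>Consecutive requests at a distance above \<open>\<tau>\<close> correspond to requests with no successor
  within \<open>\<tau>\<close>, except for the last request, which the first summand accounts for.\<close>

lemma card_last_before_gap:
  assumes R: "finite R" and \<tau>: "\<tau> \<ge> 0"
  shows "of_bool (card R \<ge> 1) + (\<Sum>r = 2..card R. of_bool (request_time R r - request_time R (r - 1) > \<tau>))
     = card {x \<in> R. R \<inter> {x<..x + \<tau>} = {}}"
proof (cases "card R")
  case 0
  with R show ?thesis by simp
next
  case (Suc m)
  define xs where "xs = sorted_list_of_set R"
  have xs: "sorted xs" "distinct xs" "set xs = R" "length xs = Suc m"
    using R Suc by (auto simp: xs_def)
  have less: "xs ! i < xs ! j \<longleftrightarrow> i < j" if "i < Suc m" "j < Suc m" for i j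
    using that xs sorted_nth_mono[of xs i j] sorted_nth_mono[of xs j i]
    by (cases i j rule: linorder_cases) (auto simp: nth_eq_iff_index_eq order_less_le)
  let ?P = "\<lambda>i. i = m \<or> xs ! Suc i > xs ! i + \<tau>"
  have "{x \<in> R. R \<inter> {x<..x + \<tau>} = {}} = (!) xs ` {i \<in> {..<Suc m}. ?P i}"
  proof (intro set_eqI iffI)
    fix x assume x: "x \<in> {x \<in> R. R \<inter> {x<..x + \<tau>} = {}}"
    then obtain i where i: "i < Suc m" "x = xs ! i" using xs by (metis (no_types, lifting) mem_Collect_eq in_set_conv_nth)
    have "?P i"
    proof (rule ccontr)
      assume n: "\<not> ?P i"
      then have "i < m" using i by simp
      then have "xs ! Suc i \<in> R \<inter> {x<..x+\<tau>}"
        using n less[of i "Suc i"] i xs nth_mem[of "Suc i" xs] by auto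
      with x show False by auto
    qed
    with i show "x \<in> (!) xs ` {i \<in> {..<Suc m}. ?P i}" by auto
  next
    fix x assume "x \<in> (!) xs ` {i \<in> {..<Suc m}. ?P i}"
    then obtain i where i: "i < Suc m" "?P i" "x = xs ! i" by auto
    have "R \<inter> {x<..x + \<tau>} = {}"
    proof (rule ccontr)
      assume "R \<inter> {x<..x + \<tau>} \<noteq> {}"
      then obtain j where j: "j < Suc m" "x < xs ! j" "xs ! j \<le> x + \<tau>"
        using xs by (metis (no_types, lifting) disjoint_iff greaterThanAtMost_iff in_set_conv_nth)
      then have ij: "i < j" using less i by simp
      then have "xs ! Suc i \<le> xs ! j" using j xs by (intro sorted_nth_mono) auto
      then show False using i j ij by auto
    qed
    then show "x \<in> {x \<in> R. R \<inter> {x<..x + \<tau>} = {}}" using i xs by auto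
  qed
  then have "card {x \<in> R. R \<inter> {x<..x + \<tau>} = {}} = card {i \<in> {..<Suc m}. ?P i}"
    using xs by (simp add: card_image inj_on_def nth_eq_iff_index_eq)
  also have "\<dots> = (\<Sum>i<Suc m. of_bool (?P i))"
    by (rule card_eq_sum_of_bool) simp
  also have "\<dots> = (\<Sum>i<m. of_bool (?P i)) + 1" by (simp only: sum.lessThan_Suc simp_thms of_bool_eq)
  also have "(\<Sum>i<m. of_bool (?P i)) = (\<Sum>i<m. of_bool (xs ! Suc i - xs ! i > \<tau>))"
    by (intro sum.cong refl arg_cong[where f=of_bool]) auto
  also have "(\<Sum>i<m. of_bool (xs ! Suc i - xs ! i > \<tau>)) =
      (\<Sum>r = 2..card R. of_bool (request_time R r - request_time R (r - 1) > \<tau>))"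
    by (rule sum.reindex_bij_witness[of _ "\<lambda>r. r - 2" "\<lambda>i. i + 2"])
      (auto simp: Suc request_time_def xs_def numeral_2_eq_2 Suc_diff_Suc)
  finally show ?thesis using Suc by simp
qed

section \<open>Poisson arrivals\<close>

lemma poisson_mean_sums:
  fixes x :: real
  shows "(\<lambda>k. real k * (exp (- x) * x ^ k / fact k)) sums x"
proof -
  let ?f = "\<lambda>k. real k * (exp (- x) * x ^ k / fact k)"
  have "(\<lambda>k. x ^ k /\<^sub>R fact k) sums exp x" by (rule exp_converges)
  then have "(\<lambda>k. (exp (- x) * x) * (x ^ k /\<^sub>R fact k)) sums ((exp (- x) * x) * exp x)"
    by (rule sums_mult)
  moreover have "(exp (- x) * x) * exp x = x" by (simp add: exp_minus)
  moreover have "(exp (- x) * x) * (x ^ k /\<^sub>R fact k) = ?f (Suc k)" for k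
  proof -
    have "?f (Suc k) = real (Suc k) * (exp (- x) * (x * x ^ k) / (real (Suc k) * fact k))"
      by (simp only: power_Suc fact_Suc of_nat_mult of_nat_fact)
    also have "\<dots> = exp (- x) * (x * x ^ k) / fact k"
      by (simp del: of_nat_Suc)
    finally show ?thesis by (simp only: real_scaleR_def divide_inverse mult_ac)
  qed
  ultimately have "(\<lambda>k. ?f (Suc k)) sums x" by simp
  from sums_Suc[OF this] show ?thesis by simp
qed

lemma suminf_indicator_card:
  fixes T :: "nat set"
  assumes "finite T"
  shows "(\<Sum>n. indicator T n :: ennreal) = of_nat (card T)"
  using assms by (simp flip: nn_integral_count_space_nat)

text \<open>The mean of a mixed Poisson variable is the mean of its parameter. The set \<open>G\<close> stands for
  an event of the conditioning \<open>\<sigma>\<close>-algebra.\<close>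

lemma nn_integral_of_nat_poisson:
  fixes N :: "'w \<Rightarrow> nat"
  assumes N[measurable]: "N \<in> M \<rightarrow>\<^sub>M count_space UNIV"
    and L[measurable]: "L \<in> borel_measurable M" and L0: "\<And>w. w \<in> space M \<Longrightarrow> 0 \<le> L w"
    and G[measurable]: "G \<in> sets M"
    and law: "\<And>k. emeasure M (G \<inter> {w \<in> space M. N w = k})
      = (\<integral>\<^sup>+w\<in>G. ennreal (exp (- L w) * L w ^ k / fact k) \<partial>M)"
  shows "(\<integral>\<^sup>+w\<in>G. of_nat (N w) \<partial>M) = (\<integral>\<^sup>+w\<in>G. ennreal (L w) \<partial>M)"
proof -
  have "(\<integral>\<^sup>+w\<in>G. of_nat (N w) \<partial>M)
      = (\<integral>\<^sup>+w. (\<Sum>k. of_nat k * indicator (G \<inter> {w \<in> space M. N w = k}) w) \<partial>M)"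
  proof (intro nn_integral_cong)
    fix w assume "w \<in> space M"
    have "(\<Sum>k. of_nat k * indicator (G \<inter> {w \<in> space M. N w = k}) w :: ennreal)
        = (\<Sum>k\<in>{N w}. of_nat k * indicator (G \<inter> {w \<in> space M. N w = k}) w)"
      by (rule suminf_finite) auto
    also have "\<dots> = of_nat (N w) * indicator (G \<inter> {w' \<in> space M. N w' = N w}) w"
      by (simp only: sum.insert finite.emptyI sum.empty empty_iff not_False_eq_True add_0_right)
    also have "indicator (G \<inter> {w' \<in> space M. N w' = N w}) w = (indicator G w :: ennreal)"
      using \<open>w \<in> space M\<close> by (cases "w \<in> G") auto
    finally show "of_nat (N w) * indicator G w
        = (\<Sum>k. of_nat k * indicator (G \<inter> {w \<in> space M. N w = k}) w :: ennreal)" ..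
  qed
  also have "\<dots> = (\<Sum>k. of_nat k * (\<integral>\<^sup>+w\<in>G. ennreal (exp (- L w) * L w ^ k / fact k) \<partial>M))"
  proof (subst nn_integral_suminf)
    show "(\<Sum>k. \<integral>\<^sup>+w. of_nat k * indicator (G \<inter> {w \<in> space M. N w = k}) w \<partial>M)
      = (\<Sum>k. of_nat k * (\<integral>\<^sup>+w\<in>G. ennreal (exp (- L w) * L w ^ k / fact k) \<partial>M))"
      by (intro suminf_cong, subst nn_integral_cmult_indicator, measurable) (simp only: law)
  qed measurable
  also have "\<dots> = (\<integral>\<^sup>+w. (\<Sum>k. of_nat k * (ennreal (exp (- L w) * L w ^ k / fact k) * indicator G w)) \<partial>M)"
  proof (subst nn_integral_suminf)
    show "(\<Sum>k. of_nat k * (\<integral>\<^sup>+w\<in>G. ennreal (exp (- L w) * L w ^ k / fact k) \<partial>M))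
      = (\<Sum>k. \<integral>\<^sup>+w. of_nat k * (ennreal (exp (- L w) * L w ^ k / fact k) * indicator G w) \<partial>M)"
      by (intro suminf_cong nn_integral_cmult[symmetric]) measurable
  qed measurable
  also have "\<dots> = (\<integral>\<^sup>+w\<in>G. ennreal (L w) \<partial>M)"
  proof (intro nn_integral_cong)
    fix w assume w: "w \<in> space M"
    have "(\<Sum>k. of_nat k * (ennreal (exp (- L w) * L w ^ k / fact k) * indicator G w))
        = (\<Sum>k. ennreal (real k * (exp (- L w) * L w ^ k / fact k)) * indicator G w)"
    proof (rule suminf_cong)
      fix k
      have "ennreal (real k * (exp (- L w) * L w ^ k / fact k)) = of_nat k * ennreal (exp (- L w) * L w ^ k / fact k)"
        using L0[OF w] by (subst ennreal_mult) (auto simp: ennreal_of_nat_eq_real_of_nat)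
      then show "of_nat k * (ennreal (exp (- L w) * L w ^ k / fact k) * indicator G w)
        = ennreal (real k * (exp (- L w) * L w ^ k / fact k)) * indicator G w"
        by (simp only: mult.assoc)
    qed
    also have "\<dots> = (\<Sum>k. ennreal (real k * (exp (- L w) * L w ^ k / fact k))) * indicator G w"
      by (rule ennreal_suminf_multc)
    also have "(\<Sum>k. ennreal (real k * (exp (- L w) * L w ^ k / fact k))) = ennreal (L w)"
      using L0[OF w] by (intro suminf_ennreal_eq poisson_mean_sums) auto
    finally show "(\<Sum>k. of_nat k * (ennreal (exp (- L w) * L w ^ k / fact k) * indicator G w))
        = ennreal (L w) * indicator G w" .
  qed
  finally show ?thesis .
qed

locale poisson_arrivals = prob_space M
  for M :: "'w measure" and \<gamma> :: real and A :: "nat \<Rightarrow> 'w \<Rightarrow> real" +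
  assumes \<gamma>_pos: "\<gamma> > 0"
    and A_measurable [measurable]: "\<And>n. A n \<in> borel_measurable M"
    and A_inj: "AE w in M. inj (\<lambda>n. A n w)"
    and A_poisson: "poisson_process M (\<lambda>_. \<gamma>) (\<lambda>w. range (\<lambda>n. A n w))"
begin

definition arrivals_in :: "real set \<Rightarrow> 'w \<Rightarrow> nat" where
  "arrivals_in B w = card (range (\<lambda>n. A n w) \<inter> B)"

lemma arrivals_config: "(\<lambda>w. range (\<lambda>n. A n w)) \<in> M \<rightarrow>\<^sub>M config"
  using A_poisson by (simp add: poisson_process_def)

lemma arrivals_in_measurable [measurable]:
  "B \<in> sets borel \<Longrightarrow> bounded B \<Longrightarrow> arrivals_in B \<in> M \<rightarrow>\<^sub>M count_space UNIV"
  unfolding arrivals_in_def using measurable_compose[OF arrivals_config count_measurable] .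

lemma arrivals_law:
  assumes "test_sets m B"
  shows "measure M {w \<in> space M. \<forall>j<m. arrivals_in (B j) w = k j} = poisson_prob (\<lambda>_. \<gamma>) m B k"
  using A_poisson assms by (simp add: poisson_process_def counts_def arrivals_in_def)

lemma finite_arrivals:
  assumes "w \<in> space M" "bounded B" "inj (\<lambda>n. A n w)"
  shows "finite {n. A n w \<in> B}" "card {n. A n w \<in> B} = arrivals_in B w"
proof -
  have "locally_finite_set (range (\<lambda>n. A n w))"
    using measurable_space[OF arrivals_config assms(1)] by (simp add: space_config)
  then have fin: "finite (range (\<lambda>n. A n w) \<inter> B)" using assms by (intro locally_finite_finite)
  have im: "(\<lambda>n. A n w) ` {n. A n w \<in> B} = range (\<lambda>n. A n w) \<inter> B" by auto
  show "finite {n. A n w \<in> B}"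
    using fin finite_imageD[of "\<lambda>n. A n w" "{n. A n w \<in> B}"] assms(3)
    by (simp add: im inj_on_subset)
  show "card {n. A n w \<in> B} = arrivals_in B w"
    unfolding arrivals_in_def im[symmetric] using assms(3) by (simp add: card_image inj_on_subset)
qed

lemma nn_integral_arrival_indicator:
  assumes [measurable]: "B \<in> sets borel"
  shows "(\<integral>\<^sup>+w. indicator B (A n w) \<partial>M) = emeasure M {w \<in> space M. A n w \<in> B}"
proof -
  have "(\<integral>\<^sup>+w. indicator B (A n w) \<partial>M) = (\<integral>\<^sup>+w. indicator {w \<in> space M. A n w \<in> B} w \<partial>M)"
    by (rule nn_integral_cong) (simp add: indicator_def)
  then show ?thesis by simp
qed

text \<open>Both sides are the mean number of arrivals in \<open>B\<close>.\<close>

lemma campbell_bounded: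
  assumes B[measurable]: "B \<in> sets borel" and bB: "bounded B"
  shows "(\<Sum>n. emeasure M {w \<in> space M. A n w \<in> B}) = ennreal \<gamma> * emeasure lborel B"
proof -
  define L where "L = (LBINT u:B. \<gamma>)"
  have finB: "emeasure lborel B < \<infinity>" using bB by (rule emeasure_bounded_finite)
  have L: "L = \<gamma> * measure lborel B" using finB
    by (simp add: L_def set_lebesgue_integral_def)
  then have L0: "L \<ge> 0" using \<gamma>_pos by simp
  have [measurable]: "arrivals_in B \<in> M \<rightarrow>\<^sub>M count_space UNIV"
    using B bB by (rule arrivals_in_measurable)
  have law: "measure M {w \<in> space M. arrivals_in B w = k} = exp (- L) * L ^ k / fact k" for k
    using arrivals_law[of 1 "\<lambda>_. B" "\<lambda>_. k"] B bB
    by (simp add: test_sets_def poisson_prob_def L_def disjoint_family_on_def)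
  have "(\<Sum>n. emeasure M {w \<in> space M. A n w \<in> B})
      = (\<Sum>n. \<integral>\<^sup>+w. indicator {n. A n w \<in> B} n \<partial>M)"
    by (rule suminf_cong) (simp add: nn_integral_arrival_indicator[symmetric] indicator_def)
  also have "\<dots> = (\<integral>\<^sup>+w. (\<Sum>n. indicator {n. A n w \<in> B} n) \<partial>M)"
    by (rule nn_integral_suminf[symmetric]) (simp add: indicator_def)
  also have "\<dots> = (\<integral>\<^sup>+w\<in>space M. of_nat (arrivals_in B w) \<partial>M)"
    by (intro nn_integral_cong_AE, use A_inj AE_space in eventually_elim)
      (simp add: suminf_indicator_card finite_arrivals bB)
  also have "\<dots> = (\<integral>\<^sup>+w\<in>space M. ennreal L \<partial>M)"
    by (rule nn_integral_of_nat_poisson)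
      (auto simp: L0 emeasure_eq_measure law Int_def nn_integral_cmult_indicator prob_space)
  also have "\<dots> = ennreal L" by (simp add: emeasure_space_1)
  also have "\<dots> = ennreal \<gamma> * emeasure lborel B"
    using finB \<gamma>_pos by (simp add: L ennreal_mult emeasure_eq_ennreal_measure)
  finally show ?thesis .
qed

text \<open>The mean measure of the arrivals is \<open>\<gamma>\<close> times Lebesgue measure. Every
  arrival occurs once in the sum on the left, whatever the enumeration.\<close>

lemma campbell:
  assumes "g \<in> borel_measurable borel"
  shows "(\<Sum>n. \<integral>\<^sup>+w. g (A n w) \<partial>M) = ennreal \<gamma> * (\<integral>\<^sup>+x. g x \<partial>lborel)"
  using assms
proof (induction rule: borel_measurable_induct)
  case (cong f g)
  then show ?case by (simp cong: nn_integral_cong)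
next
  case (set B)
  define D where "D k = B \<inter> {- real k..real k}" for k :: nat
  have [measurable]: "D k \<in> sets borel" for k using set by (simp add: D_def)
  have inc: "incseq D" by (auto simp: D_def incseq_def)
  have U: "(\<Union>k. D k) = B"
  proof -
    have "\<exists>k. x \<in> {- real k..real k}" for x :: real
    proof -
      obtain k :: nat where "\<bar>x\<bar> \<le> real k" using real_arch_simple by blast
      then show ?thesis by (intro exI[of _ k]) auto
    qed
    then show ?thesis by (auto simp: D_def)
  qed
  have "(\<Sum>n. \<integral>\<^sup>+w. indicator B (A n w) \<partial>M) = (\<Sum>n. emeasure M {w \<in> space M. A n w \<in> B})"
    using set by (simp add: nn_integral_arrival_indicator)
  also have "\<dots> = (\<Sum>n. SUP k. emeasure M {w \<in> space M. A n w \<in> D k})"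
  proof (intro suminf_cong)
    fix n
    have "emeasure M (\<Union>k. {w \<in> space M. A n w \<in> D k}) = (SUP k. emeasure M {w \<in> space M. A n w \<in> D k})"
      using inc by (intro SUP_emeasure_incseq[symmetric]) (auto simp: incseq_def)
    moreover have "(\<Union>k. {w \<in> space M. A n w \<in> D k}) = {w \<in> space M. A n w \<in> B}"
      unfolding U[symmetric] by auto
    ultimately show "emeasure M {w \<in> space M. A n w \<in> B} = (SUP k. emeasure M {w \<in> space M. A n w \<in> D k})"
      by simp
  qed
  also have "\<dots> = (SUP k. \<Sum>n. emeasure M {w \<in> space M. A n w \<in> D k})"
    using inc by (intro ennreal_suminf_SUP_eq) (auto simp: incseq_def intro!: emeasure_mono)
  also have "\<dots> = (SUP k. ennreal \<gamma> * emeasure lborel (D k))"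
    by (intro SUP_cong refl campbell_bounded) (use set in \<open>auto simp: D_def intro: bounded_subset[of "{- real _..real _}"]\<close>)
  also have "\<dots> = ennreal \<gamma> * emeasure lborel B"
    using SUP_emeasure_incseq[of D lborel] inc U by (simp add: SUP_mult_left_ennreal[symmetric] image_subset_iff)
  finally show ?case using set by simp
next
  case (mult u c)
  then show ?case by (simp add: nn_integral_cmult algebra_simps)
next
  case (add u v)
  then show ?case by (simp add: nn_integral_add suminf_add[symmetric] distrib_left)
next
  case (seq U)
  have [measurable]: "U i \<in> borel_measurable borel" for i using seq by simp
  have SUP_U: "(SUP i. U i) = (\<lambda>x. SUP i. U i x)" by (simp add: fun_eq_iff image_comp)
  have "(\<Sum>n. \<integral>\<^sup>+w. (SUP i. U i) (A n w) \<partial>M) = (\<Sum>n. SUP i. \<integral>\<^sup>+w. U i (A n w) \<partial>M)"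
    using seq by (intro suminf_cong, subst nn_integral_monotone_convergence_SUP[symmetric])
      (auto simp: incseq_def le_fun_def image_comp)
  also have "\<dots> = (SUP i. \<Sum>n. \<integral>\<^sup>+w. U i (A n w) \<partial>M)"
    using seq by (intro ennreal_suminf_SUP_eq) (auto simp: incseq_def le_fun_def intro!: nn_integral_mono)
  also have "\<dots> = (SUP i. ennreal \<gamma> * (\<integral>\<^sup>+x. U i x \<partial>lborel))"
    using seq by simp
  also have "\<dots> = ennreal \<gamma> * (\<integral>\<^sup>+x. (SUP i. U i) x \<partial>lborel)"
    unfolding SUP_U using seq(3)
    by (simp add: SUP_mult_left_ennreal nn_integral_monotone_convergence_SUP)
  finally show ?case .
qed

end

section \<open>Shift invariance of products over the arrivals\<close>

context poisson_arrivals
begin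

text \<open>The infinite product \<open>\<Prod>n. h (A n w)\<close> for \<open>0 \<le> h \<le> 1\<close>, a limit of decreasing partial
  products. It is a symmetric function of the arrivals.\<close>

definition arrival_product :: "(real \<Rightarrow> real) \<Rightarrow> 'w \<Rightarrow> ennreal" where
  "arrival_product h w = (INF K. \<Prod>n<K. ennreal (h (A n w)))"

lemma prod_ennreal_antimono:
  fixes c :: "nat \<Rightarrow> ennreal"
  assumes "\<And>n. c n \<le> 1" "J \<le> K"
  shows "(\<Prod>n<K. c n) \<le> (\<Prod>n<J. c n)"
proof -
  have "(\<Prod>n<K. c n) = (\<Prod>n<J. c n) * (\<Prod>n\<in>{J..<K}. c n)"
    using assms(2) by (simp add: prod.atLeastLessThan_concat lessThan_atLeast0)
  also have "\<dots> \<le> (\<Prod>n<J. c n) * 1"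
    using assms(1) by (intro mult_left_mono prod_le_1) auto
  finally show ?thesis by simp
qed

lemma prod_ennreal_mono:
  fixes c d :: "nat \<Rightarrow> ennreal"
  assumes "\<And>n. c n \<le> d n"
  shows "(\<Prod>n<K. c n) \<le> (\<Prod>n<K. d n)"
  by (induction K) (auto intro: mult_mono assms)

lemma arrival_product_measurable [measurable]:
  assumes [measurable]: "h \<in> borel_measurable borel"
  shows "arrival_product h \<in> borel_measurable M"
  unfolding arrival_product_def by measurable

lemma nn_integral_arrival_product_tendsto:
  assumes h[measurable]: "h \<in> borel_measurable borel" and h01: "\<And>x. 0 \<le> h x" "\<And>x. h x \<le> 1"
  shows "(\<lambda>K. \<integral>\<^sup>+w. (\<Prod>n<K. ennreal (h (A n w))) \<partial>M) \<longlonglongrightarrow> (\<integral>\<^sup>+w. arrival_product h w \<partial>M)"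
proof -
  have dec: "decseq (\<lambda>K w. \<Prod>n<K. ennreal (h (A n w)))"
    unfolding decseq_def using h01 by (intro allI impI le_funI prod_ennreal_antimono) auto
  have "(\<integral>\<^sup>+w. arrival_product h w \<partial>M) = (INF K. \<integral>\<^sup>+w. (\<Prod>n<K. ennreal (h (A n w))) \<partial>M)"
    unfolding arrival_product_def
  proof (rule nn_integral_monotone_convergence_INF_decseq[OF dec])
    show "(\<integral>\<^sup>+w. (\<Prod>n<0. ennreal (h (A n w))) \<partial>M) < \<infinity>" by (simp add: emeasure_space_1)
  qed measurable
  moreover have "decseq (\<lambda>K. \<integral>\<^sup>+w. (\<Prod>n<K. ennreal (h (A n w))) \<partial>M)"
    unfolding decseq_def using h01 by (intro allI impI nn_integral_mono prod_ennreal_antimono) auto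
  ultimately show ?thesis by (simp add: LIMSEQ_INF)
qed

text \<open>The step function with value \<open>c j\<close> on \<open>B j\<close> and value \<open>1\<close> outside, for disjoint \<open>B j\<close>.\<close>

definition step :: "nat \<Rightarrow> (nat \<Rightarrow> real set) \<Rightarrow> (nat \<Rightarrow> real) \<Rightarrow> real \<Rightarrow> real" where
  "step m B c x = (\<Prod>j<m. if x \<in> B j then c j else 1)"

text \<open>For a step function the product depends on the arrivals only through their counts in the
  bounded sets \<open>B j\<close>, and its partial products are eventually constant.\<close>

lemma arrival_product_step:
  assumes B: "test_sets m B" and c: "\<And>j. j < m \<Longrightarrow> 0 \<le> c j \<and> c j \<le> 1"
    and w: "w \<in> space M" "inj (\<lambda>n. A n w)"
  shows "arrival_product (step m B c) w = ennreal (\<Prod>j<m. c j ^ arrivals_in (B j) w)"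
proof -
  have s01: "0 \<le> step m B c x" "step m B c x \<le> 1" for x
    using c by (auto simp: step_def intro!: prod_nonneg prod_le_1)
  let ?P = "\<lambda>K. \<Prod>n<K. ennreal (step m B c (A n w))"
  have dec: "decseq ?P" unfolding decseq_def using s01 by (auto intro!: prod_ennreal_antimono)
  have "finite (\<Union>j<m. {n. A n w \<in> B j})"
    using B w by (auto simp: test_sets_def intro: finite_arrivals(1))
  then obtain K0 where K0: "\<And>n j. j < m \<Longrightarrow> A n w \<in> B j \<Longrightarrow> n < K0"
    unfolding finite_nat_set_iff_bounded by blast
  have "?P K = ennreal (\<Prod>j<m. c j ^ arrivals_in (B j) w)" if "K0 \<le> K" for K
  proof -
    have "?P K = ennreal (\<Prod>n<K. \<Prod>j<m. if A n w \<in> B j then c j else 1)"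
      using s01 by (simp add: prod_ennreal step_def)
    also have "(\<Prod>n<K. \<Prod>j<m. if A n w \<in> B j then c j else 1)
        = (\<Prod>j<m. \<Prod>n<K. if A n w \<in> B j then c j else 1)" by (rule prod.swap)
    also have "\<dots> = (\<Prod>j<m. c j ^ arrivals_in (B j) w)"
    proof (intro prod.cong refl)
      fix j assume j: "j \<in> {..<m}"
      have "{..<K} \<inter> {n. A n w \<in> B j} = {n. A n w \<in> B j}" using K0 that j by force
      moreover have "card {n. A n w \<in> B j} = arrivals_in (B j) w"
        using j B w by (intro finite_arrivals(2)) (auto simp: test_sets_def)
      ultimately show "(\<Prod>n<K. if A n w \<in> B j then c j else 1) = c j ^ arrivals_in (B j) w"
        by (simp add: prod.If_cases)
    qed
    finally show ?thesis .
  qed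
  then have "?P \<longlonglongrightarrow> ennreal (\<Prod>j<m. c j ^ arrivals_in (B j) w)"
    by (intro tendsto_eventually) (auto simp: eventually_sequentially)
  with LIMSEQ_INF[OF dec] show ?thesis unfolding arrival_product_def by (rule LIMSEQ_unique)
qed

definition arrival_vector :: "nat \<Rightarrow> (nat \<Rightarrow> real set) \<Rightarrow> 'w \<Rightarrow> nat \<Rightarrow> nat" where
  "arrival_vector m B w = (\<lambda>j\<in>{..<m}. arrivals_in (B j) w)"

lemma arrival_vector_measurable:
  assumes B: "test_sets m B"
  shows "arrival_vector m B \<in> M \<rightarrow>\<^sub>M count_space (PiE {..<m} (\<lambda>_. UNIV))"
proof (subst measurable_count_space_eq_countable)
  have [measurable]: "arrivals_in (B j) \<in> M \<rightarrow>\<^sub>M count_space UNIV" if "j < m" for j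
    using that B by (intro arrivals_in_measurable) (auto simp: test_sets_def)
  have "arrival_vector m B -` {k} \<inter> space M \<in> sets M" if "k \<in> PiE {..<m} (\<lambda>_. UNIV)" for k
  proof -
    have "arrival_vector m B -` {k} \<inter> space M = {w \<in> space M. \<forall>j\<in>{..<m}. arrivals_in (B j) w = k j}"
      using that by (auto simp: arrival_vector_def PiE_def extensional_def fun_eq_iff)
    also have "\<dots> \<in> sets M" by (intro sets.sets_Collect_finite_All) auto
    finally show ?thesis .
  qed
  then show "arrival_vector m B \<in> space M \<rightarrow> PiE {..<m} (\<lambda>_. UNIV) \<and>
     (\<forall>k\<in>PiE {..<m} (\<lambda>_. UNIV). arrival_vector m B -` {k} \<inter> space M \<in> sets M)"
    by (auto simp: arrival_vector_def)
qed (auto intro: countable_PiE)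

text \<open>Passing to the law of the vector of counts, which lives on a countable set and is
  given by \<open>poisson_prob\<close>, allows the comparison of two families of sets.\<close>

lemma nn_integral_arrival_product_step:
  assumes B: "test_sets m B" and c: "\<And>j. j < m \<Longrightarrow> 0 \<le> c j \<and> c j \<le> 1"
  shows "(\<integral>\<^sup>+w. arrival_product (step m B c) w \<partial>M) =
    (\<integral>\<^sup>+k. ennreal (\<Prod>j<m. c j ^ k j) \<partial>distr M (count_space (PiE {..<m} (\<lambda>_. UNIV))) (arrival_vector m B))"
proof -
  have "(\<integral>\<^sup>+w. arrival_product (step m B c) w \<partial>M)
      = (\<integral>\<^sup>+w. ennreal (\<Prod>j<m. c j ^ arrival_vector m B w j) \<partial>M)"
    by (intro nn_integral_cong_AE, use A_inj AE_space in eventually_elim)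
      (simp add: arrival_product_step[OF B c] arrival_vector_def)
  then show ?thesis by (simp add: nn_integral_distr arrival_vector_measurable[OF B])
qed

lemma poisson_prob_shift:
  "poisson_prob (\<lambda>_. \<gamma>) m (\<lambda>j. {x. x - s \<in> B j}) k = poisson_prob (\<lambda>_. \<gamma>) m B k"
proof -
  have "(LBINT u:{x. x - s \<in> B j}. \<gamma>) = (LBINT u:B j. \<gamma>)" for j
    unfolding set_lebesgue_integral_def
    by (subst lborel_integral_real_affine[of 1 _ s]) (auto simp: indicator_def)
  then show ?thesis by (simp add: poisson_prob_def)
qed

lemma test_sets_shift:
  assumes "test_sets m B"
  shows "test_sets m (\<lambda>j. {x::real. x - s \<in> B j})"
proof -
  have "{x. x - s \<in> B j} \<in> sets borel" if "j < m" for j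
  proof -
    have [measurable]: "B j \<in> sets borel" using assms that by (simp add: test_sets_def)
    show ?thesis by measurable
  qed
  moreover have "bounded {x. x - s \<in> B j}" if "j < m" for j
  proof -
    have "bounded ((+) s ` B j)" using assms that by (intro bounded_translation) (simp add: test_sets_def)
    moreover have "{x. x - s \<in> B j} \<subseteq> (+) s ` B j"
    proof
      fix x assume "x \<in> {x. x - s \<in> B j}"
      then have "s + (x - s) \<in> (+) s ` B j" by (intro imageI) simp
      then show "x \<in> (+) s ` B j" by simp
    qed
    ultimately show ?thesis by (rule bounded_subset)
  qed
  moreover have "disjoint_family_on (\<lambda>j. {x. x - s \<in> B j}) {..<m}"
    using assms unfolding test_sets_def disjoint_family_on_def by (simp add: set_eq_iff)
  ultimately show ?thesis by (auto simp: test_sets_def)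
qed

lemma arrival_product_step_shift:
  assumes B: "test_sets m B" and c: "\<And>j. j < m \<Longrightarrow> 0 \<le> c j \<and> c j \<le> 1"
  shows "(\<integral>\<^sup>+w. arrival_product (\<lambda>x. step m B c (x - s)) w \<partial>M) = (\<integral>\<^sup>+w. arrival_product (step m B c) w \<partial>M)"
proof -
  let ?B' = "\<lambda>j. {x::real. x - s \<in> B j}"
  let ?S = "PiE {..<m} (\<lambda>_. UNIV :: nat set)"
  note B' = test_sets_shift[OF B, of s]
  have law: "emeasure (distr M (count_space ?S) (arrival_vector m D)) {k}
      = ennreal (poisson_prob (\<lambda>_. \<gamma>) m D k)" if D: "test_sets m D" and k: "k \<in> ?S" for D k
  proof -
    have "emeasure (distr M (count_space ?S) (arrival_vector m D)) {k}
        = emeasure M (arrival_vector m D -` {k} \<inter> space M)"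
      using k by (intro emeasure_distr arrival_vector_measurable D) auto
    also have "arrival_vector m D -` {k} \<inter> space M = {w \<in> space M. \<forall>j<m. arrivals_in (D j) w = k j}"
      using k by (auto simp: arrival_vector_def PiE_def extensional_def fun_eq_iff)
    finally show ?thesis by (simp add: emeasure_eq_measure arrivals_law[OF D])
  qed
  have "distr M (count_space ?S) (arrival_vector m ?B') = distr M (count_space ?S) (arrival_vector m B)"
    by (rule measure_eqI_countable[where A="?S"])
      (auto intro: countable_PiE simp: law[OF B] law[OF B'] poisson_prob_shift)
  moreover have "(\<lambda>x. step m B c (x - s)) = step m ?B' c"
    by (simp add: step_def fun_eq_iff)
  ultimately show ?thesis
    by (simp add: nn_integral_arrival_product_step[OF B c] nn_integral_arrival_product_step[OF B' c])
qed

text \<open>Dyadic rounding of \<open>h\<close> from above, set to \<open>1\<close> far away so that only bounded sets matter.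
  The values decrease to \<open>h\<close>.\<close>

definition approx :: "(real \<Rightarrow> real) \<Rightarrow> nat \<Rightarrow> real \<Rightarrow> real" where
  "approx h i x = (if \<bar>x\<bar> \<le> real i then real_of_int \<lceil>2 ^ i * h x\<rceil> / 2 ^ i else 1)"

lemma approx_eq_step:
  assumes "\<And>x. 0 \<le> h x" "\<And>x. h x \<le> 1"
  shows "approx h i = step (Suc (2 ^ i)) (\<lambda>j. {x. \<bar>x\<bar> \<le> real i \<and> \<lceil>2 ^ i * h x\<rceil> = int j}) (\<lambda>j. real j / 2 ^ i)"
proof
  fix x
  show "approx h i x = step (Suc (2 ^ i)) (\<lambda>j. {x. \<bar>x\<bar> \<le> real i \<and> \<lceil>2 ^ i * h x\<rceil> = int j}) (\<lambda>j. real j / 2 ^ i) x"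
  proof (cases "\<bar>x\<bar> \<le> real i")
    case True
    have "0 \<le> \<lceil>2 ^ i * h x\<rceil>" 
    proof -
      have "0 \<le> 2 ^ i * h x" using assms(1)[of x] by simp
      then show ?thesis by linarith
    qed
    then obtain j where j: "\<lceil>2 ^ i * h x\<rceil> = int j" using nonneg_int_cases by blast
    have "\<lceil>2 ^ i * h x\<rceil> \<le> 2 ^ i" using assms(2)[of x] by (simp add: ceiling_le_iff)
    then have "int j \<le> int (2 ^ i)" using j by simp
    then have j': "j \<in> {..<Suc (2 ^ i)}" by (simp only: of_nat_le_iff lessThan_iff less_Suc_eq_le)
    show ?thesis
      using True j j' prod.delta[of "{..<Suc (2 ^ i)}" j "\<lambda>j. real j / 2 ^ i"]
      by (simp add: approx_def step_def eq_commute[of j] del: prod.lessThan_Suc)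
  qed (simp add: approx_def step_def)
qed

lemma approx_bounds:
  assumes "\<And>x. 0 \<le> h x" "\<And>x. h x \<le> 1"
  shows "0 \<le> approx h i x" "approx h i x \<le> 1" "h x \<le> approx h i x"
proof -
  have "2 ^ i * h x \<le> real_of_int \<lceil>2 ^ i * h x\<rceil>" by simp
  then show h: "h x \<le> approx h i x" using assms by (simp add: approx_def field_simps)
  then show "0 \<le> approx h i x" using assms(1)[of x] by simp
  have "\<lceil>2 ^ i * h x\<rceil> \<le> 2 ^ i" using assms(2)[of x] by (simp add: ceiling_le_iff)
  then have "real_of_int \<lceil>2 ^ i * h x\<rceil> \<le> real_of_int (2 ^ i)" by (simp only: of_int_le_iff)
  then show "approx h i x \<le> 1" by (simp add: approx_def)
qed

lemma approx_Suc_le: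
  assumes "\<And>x. 0 \<le> h x" "\<And>x. h x \<le> 1"
  shows "approx h (Suc i) x \<le> approx h i x"
proof (cases "\<bar>x\<bar> \<le> real i")
  case True
  have "\<lceil>2 * (2 ^ i * h x)\<rceil> \<le> 2 * \<lceil>2 ^ i * h x\<rceil>"
    by (simp add: ceiling_le_iff)
  then have "real_of_int \<lceil>2 ^ Suc i * h x\<rceil> \<le> 2 * real_of_int \<lceil>2 ^ i * h x\<rceil>"
    by (simp add: mult.assoc flip: of_int_le_iff)
  then show ?thesis using True by (simp add: approx_def field_simps)
next
  case False
  then show ?thesis using approx_bounds(2)[of h "Suc i" x] assms by (simp add: approx_def)
qed

lemma approx_tendsto:
  assumes "\<And>x. 0 \<le> h x" "\<And>x. h x \<le> 1"
  shows "(\<lambda>i. approx h i x) \<longlonglongrightarrow> h x"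
proof (rule tendsto_sandwich[where f="\<lambda>_. h x" and h="\<lambda>i. h x + (1/2) ^ i"])
  show "(\<lambda>i. h x + (1/2) ^ i) \<longlonglongrightarrow> h x"
    using tendsto_add[OF tendsto_const LIMSEQ_realpow_zero[of "1/2"], of "h x"] by simp
  obtain i0 :: nat where i0: "\<bar>x\<bar> \<le> real i0" using real_arch_simple by blast
  have "approx h i x \<le> h x + (1/2) ^ i" if "i \<ge> i0" for i
  proof -
    have "real_of_int \<lceil>2 ^ i * h x\<rceil> \<le> 2 ^ i * h x + 1" by linarith
    then have "real_of_int \<lceil>2 ^ i * h x\<rceil> / 2 ^ i \<le> (2 ^ i * h x + 1) / 2 ^ i"
      by (intro divide_right_mono) auto
    moreover have "(2 ^ i * h x + 1) / 2 ^ i = h x + (1/2) ^ i"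
      by (simp add: field_simps power_divide)
    ultimately show ?thesis using i0 that by (simp add: approx_def)
  qed
  then show "eventually (\<lambda>i. approx h i x \<le> h x + (1/2) ^ i) sequentially"
    by (auto simp: eventually_sequentially)
  show "eventually (\<lambda>i. h x \<le> approx h i x) sequentially"
    using approx_bounds(3)[of h, OF assms] by simp
qed simp

text \<open>Two decreasing limits, in the number of factors and in the precision, may be exchanged.\<close>

lemma arrival_product_approx:
  assumes "\<And>x. 0 \<le> h x" "\<And>x. h x \<le> 1"
  shows "arrival_product (\<lambda>x. h (x - s)) w = (INF i. arrival_product (\<lambda>x. approx h i (x - s)) w)"
proof -
  have "(INF i. \<Prod>n<K. ennreal (approx h i (A n w - s))) = (\<Prod>n<K. ennreal (h (A n w - s)))" for K
  proof (rule LIMSEQ_unique[OF LIMSEQ_INF])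
    show "decseq (\<lambda>i. \<Prod>n<K. ennreal (approx h i (A n w - s)))"
      by (intro decseq_SucI prod_ennreal_mono ennreal_leI approx_Suc_le assms)
    have "(\<lambda>i. ennreal (\<Prod>n<K. approx h i (A n w - s))) \<longlonglongrightarrow> ennreal (\<Prod>n<K. h (A n w - s))"
      by (intro tendsto_ennrealI tendsto_prod approx_tendsto assms)
    then show "(\<lambda>i. \<Prod>n<K. ennreal (approx h i (A n w - s))) \<longlonglongrightarrow> (\<Prod>n<K. ennreal (h (A n w - s)))"
      using assms approx_bounds(1)[of h, OF assms] by (simp add: prod_ennreal)
  qed
  then show ?thesis unfolding arrival_product_def
    by (subst INF_commute) simp
qed

lemma approx_measurable [measurable]:
  assumes [measurable]: "h \<in> borel_measurable borel"
  shows "approx h i \<in> borel_measurable borel"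
  unfolding approx_def by measurable

lemma nn_integral_arrival_product_approx:
  assumes [measurable]: "h \<in> borel_measurable borel" and h01: "\<And>x. 0 \<le> h x" "\<And>x. h x \<le> 1"
  shows "(\<integral>\<^sup>+w. arrival_product (\<lambda>x. h (x - s)) w \<partial>M)
    = (INF i. \<integral>\<^sup>+w. arrival_product (\<lambda>x. approx h i (x - s)) w \<partial>M)"
proof -
  have le1: "arrival_product (\<lambda>x. approx h i (x - s)) w \<le> 1" for i w
    unfolding arrival_product_def by (rule INF_lower2[of 0]) auto
  have "decseq (\<lambda>i w. arrival_product (\<lambda>x. approx h i (x - s)) w)"
    unfolding arrival_product_def
    by (intro decseq_SucI le_funI INF_mono, rule bexI)
      (auto intro!: prod_ennreal_mono ennreal_leI approx_Suc_le h01)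
  moreover have "(\<integral>\<^sup>+w. arrival_product (\<lambda>x. approx h 0 (x - s)) w \<partial>M) < \<infinity>"
  proof -
    have "(\<integral>\<^sup>+w. arrival_product (\<lambda>x. approx h 0 (x - s)) w \<partial>M) \<le> (\<integral>\<^sup>+w. 1 \<partial>M)"
      by (intro nn_integral_mono le1)
    then show ?thesis by (simp add: emeasure_space_1 order_le_less_trans[OF _ ennreal_one_less_top])
  qed
  ultimately show ?thesis
    unfolding arrival_product_approx[of h, OF h01]
    by (intro nn_integral_monotone_convergence_INF_decseq) auto
qed

text \<open>The invariance of the Poisson process in the form that suits an arbitrary enumeration of its
  points.\<close>

theorem arrival_product_shift:
  assumes h[measurable]: "h \<in> borel_measurable borel" and h01: "\<And>x. 0 \<le> h x" "\<And>x. h x \<le> 1"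
  shows "(\<integral>\<^sup>+w. arrival_product (\<lambda>x. h (x - s)) w \<partial>M) = (\<integral>\<^sup>+w. arrival_product h w \<partial>M)"
proof -
  have "(\<integral>\<^sup>+w. arrival_product (\<lambda>x. approx h i (x - s)) w \<partial>M) = (\<integral>\<^sup>+w. arrival_product (approx h i) w \<partial>M)" for i
    unfolding approx_eq_step[of h, OF h01]
  proof (rule arrival_product_step_shift)
    have "bounded {x. \<bar>x\<bar> \<le> real i \<and> \<lceil>2 ^ i * h x\<rceil> = int j}" for j
      by (rule boundedI[of _ "real i"]) auto
    then show "test_sets (Suc (2 ^ i)) (\<lambda>j. {x. \<bar>x\<bar> \<le> real i \<and> \<lceil>2 ^ i * h x\<rceil> = int j})"
      by (auto simp: test_sets_def disjoint_family_on_def)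
    show "0 \<le> real j / 2 ^ i \<and> real j / 2 ^ i \<le> 1" if "j < Suc (2 ^ i)" for j
    proof -
      have "real j \<le> real (2 ^ i)" using that by (simp only: of_nat_le_iff less_Suc_eq_le)
      then show ?thesis by simp
    qed
  qed
  then show ?thesis
    using nn_integral_arrival_product_approx[OF h h01, of s] nn_integral_arrival_product_approx[OF h h01, of 0]
    by simp
qed

end

section \<open>The documents of the catalog\<close>

lemma subalgebra_generated_by:
  assumes "\<And>i. (\<lambda>w. Y w i) \<in> borel_measurable M"
  shows "subalgebra M (generated_by M Y)"
  unfolding subalgebra_def generated_by_def
proof
  have "Y \<in> M \<rightarrow>\<^sub>M PiM UNIV (\<lambda>_. borel)"
    using measurable_PiM_single'[of UNIV "\<lambda>i w. Y w i" M "\<lambda>_. borel"] assms by (simp add: PiE_UNIV_domain)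
  then show "sets (vimage_algebra (space M) Y (PiM UNIV (\<lambda>_. borel))) \<subseteq> sets M"
    by (intro sets_image_in_sets) auto
qed simp

locale document_catalog = catalog_intensity M l
  for M :: "'w measure" and l :: "'w \<Rightarrow> real \<Rightarrow> real" +
  fixes \<gamma> :: real and A :: "nat \<Rightarrow> 'w \<Rightarrow> real" and \<Xi> :: "nat \<Rightarrow> 'w \<Rightarrow> real set"
  assumes \<gamma>_pos: "\<gamma> > 0"
    and documents: "document_process M \<gamma> l A \<Xi>"

sublocale document_catalog \<subseteq> poisson_arrivals M \<gamma> A
  using documents \<gamma>_pos by unfold_locales (auto simp: document_process_def)

context document_catalog
begin

lemma \<Xi>_measurable [measurable]: "\<Xi> n \<in> M \<rightarrow>\<^sub>M config"
  using documents by (simp add: document_process_def)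

text \<open>The probability that a document arriving at \<open>a\<close> has no request in \<open>B\<close>.\<close>

definition silent_prob :: "real set \<Rightarrow> real \<Rightarrow> real" where
  "silent_prob B a = (\<integral>w. exp (- (LBINT u:B. l w (u - a))) \<partial>M)"

lemma shifted_mass_measurable:
  assumes [measurable]: "B \<in> sets borel"
  shows "(\<lambda>(a, w). LBINT u:B. l w (u - a)) \<in> borel_measurable (borel \<Otimes>\<^sub>M M)"
proof -
  have "(\<lambda>p. (snd (fst p), snd p - fst (fst p))) \<in> (borel \<Otimes>\<^sub>M M) \<Otimes>\<^sub>M lborel \<rightarrow>\<^sub>M M \<Otimes>\<^sub>M borel"
    by measurable
  from measurable_compose[OF this l_measurable]
  have [measurable]: "(\<lambda>p. l (snd (fst p)) (snd p - fst (fst p))) \<in> borel_measurable ((borel \<Otimes>\<^sub>M M) \<Otimes>\<^sub>M lborel)"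
    by (simp add: split_beta)
  show ?thesis unfolding set_lebesgue_integral_def split_beta by measurable
qed

lemma shifted_mass_section [measurable]:
  "B \<in> sets borel \<Longrightarrow> (\<lambda>w. LBINT u:B. l w (u - a)) \<in> borel_measurable M"
  using measurable_Pair2[OF shifted_mass_measurable, of B a] by simp

lemma silent_prob_measurable [measurable]:
  assumes B: "B \<in> sets borel"
  shows "silent_prob B \<in> borel_measurable borel"
proof -
  note [measurable] = shifted_mass_measurable[OF B]
  show ?thesis unfolding silent_prob_def by measurable
qed

lemma shifted_mass_nonneg: "w \<in> space M \<Longrightarrow> 0 \<le> (LBINT u:B. l w (u - a))"
  unfolding set_lebesgue_integral_def by (intro integral_nonneg_AE AE_I2) (simp add: l_nonneg)

lemma integrable_exp_shifted_mass:
  "B \<in> sets borel \<Longrightarrow> integrable M (\<lambda>w. exp (- (LBINT u:B. l w (u - a))))"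
  by (intro integrable_const_bound[of _ 1] AE_I2) (auto simp: shifted_mass_nonneg)

lemma silent_prob_nonneg: "0 \<le> silent_prob B a"
  unfolding silent_prob_def by (intro integral_nonneg_AE) auto

lemma silent_prob_empty [simp]: "silent_prob {} a = 1"
  by (simp add: silent_prob_def set_lebesgue_integral_def prob_space)

lemma silent_prob_le_1: "B \<in> sets borel \<Longrightarrow> silent_prob B a \<le> 1"
  unfolding silent_prob_def
  by (intro integral_le_const integrable_exp_shifted_mass AE_I2) (auto simp: shifted_mass_nonneg)

lemma window_mass:
  assumes "integrable_intensity (l w)" "b \<le> c"
  shows "(LBINT u:{b..c}. l w (u - a)) = \<Lambda> w (c - a) - \<Lambda> w (b - a)"
proof -
  interpret integrable_intensity "l w" by fact
  have "(LBINT u:{b..c}. l w (u - a)) = (LBINT u:{b - a..c - a}. l w u)"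
    unfolding set_lebesgue_integral_def
    by (subst lborel_integral_real_affine[of 1 _ a])
      (auto intro!: Bochner_Integration.integral_cong split: split_indicator)
  then show ?thesis using assms(2) by (simp add: integral_Icc)
qed

lemma silent_prob_window_antimono:
  assumes "s \<le> t" "t \<le> t'"
  shows "silent_prob {s..t'} a \<le> silent_prob {s..t} a"
  unfolding silent_prob_def
proof (intro integral_mono_AE integrable_exp_shifted_mass)
  show "AE w in M. exp (- (LBINT u:{s..t'}. l w (u - a))) \<le> exp (- (LBINT u:{s..t}. l w (u - a)))"
    using AE_intensity
  proof eventually_elim
    case (elim w)
    then interpret integrable_intensity "l w" by simp
    have "\<Lambda> w (t - a) \<le> \<Lambda> w (t' - a)" using assms by (intro F_mono) simp
    then show ?case using assms elim by (simp add: window_mass)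
  qed
qed auto

lemma silent_prob_shift: "silent_prob {s..s + t} a = silent_prob {0..t} (a - s)"
proof -
  have "(LBINT u:{s..s + t}. l w (u - a)) = (LBINT u:{0..t}. l w (u - (a - s)))" for w
    unfolding set_lebesgue_integral_def
    by (subst lborel_integral_real_affine[of 1 _ s])
      (auto intro!: Bochner_Integration.integral_cong simp: algebra_simps split: split_indicator)
  then show ?thesis by (simp add: silent_prob_def)
qed

lemma silent_measurable [measurable]:
  assumes "B \<in> sets borel" "bounded B"
  shows "{w \<in> space M. \<Xi> n w \<inter> B = {}} \<in> sets M"
  using \<Xi>_measurable assms by (rule avoids_event)

text \<open>Conditional independence of the marks, integrated over the arrival times. Void events
  determine which documents are requested in a window, and the conditional probability of a
  void event is \<open>silent_prob\<close>.\<close>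

lemma joint_silence:
  assumes B: "\<And>i. i < n \<Longrightarrow> B i \<in> sets borel" "\<And>i. i < n \<Longrightarrow> bounded (B i)"
  shows "prob {w \<in> space M. \<forall>i<n. \<Xi> i w \<inter> B i = {}} = (\<integral>w. (\<Prod>i<n. silent_prob (B i) (A i w)) \<partial>M)"
proof -
  let ?E = "{w \<in> space M. \<forall>i<n. counts 1 (\<lambda>_. B i) (\<lambda>_. 0) (\<Xi> i w)}"
  let ?F = "generated_by M (\<lambda>w n. A n w)"
  interpret F: finite_measure_subalgebra M ?F
    by unfold_locales (simp add: subalgebra_generated_by)
  have E_eq: "?E = {w \<in> space M. \<forall>i<n. \<Xi> i w \<inter> B i = {}}"
  proof -
    have "counts 1 (\<lambda>_. B i) (\<lambda>_. 0) (\<Xi> i w) \<longleftrightarrow> \<Xi> i w \<inter> B i = {}" if "i < n" "w \<in> space M" for i w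
    proof -
      have "locally_finite_set (\<Xi> i w)"
        using measurable_space[OF \<Xi>_measurable \<open>w \<in> space M\<close>] by (simp add: space_config)
      then have "finite (\<Xi> i w \<inter> B i)" using B that by (intro locally_finite_finite) auto
      then show ?thesis by (simp add: counts_def)
    qed
    then show ?thesis by auto
  qed
  have E: "?E \<in> sets M"
  proof -
    have "{w \<in> space M. \<forall>i\<in>{..<n}. \<Xi> i w \<inter> B i = {}} \<in> sets M"
      using B by (intro sets.sets_Collect_finite_All silent_measurable) auto
    then show ?thesis unfolding E_eq by (simp only: lessThan_iff Ball_def)
  qed
  have "\<forall>i<n. test_sets 1 (\<lambda>_. B i)" using B by (simp add: test_sets_def disjoint_family_on_def)
  with documents[unfolded document_process_def, THEN conjunct2, THEN conjunct2, THEN conjunct2,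
      THEN conjunct2, THEN spec, THEN spec, THEN spec, THEN spec, THEN mp,
      of n 1 "\<lambda>i _. B i" "\<lambda>_ _. 0"]
  have "AE w in M. real_cond_exp M ?F (indicator ?E) w
      = (\<Prod>i<n. cox_prob M (shift_intensity (A i w) l) 1 (\<lambda>_. B i) (\<lambda>_. 0))" .
  then have ae: "AE w in M. real_cond_exp M ?F (indicator ?E) w = (\<Prod>i<n. silent_prob (B i) (A i w))"
  proof eventually_elim
    case (elim w)
    have "cox_prob M (shift_intensity a l) 1 (\<lambda>_. B i) (\<lambda>_. 0) = silent_prob (B i) a" for i a
      by (simp add: cox_prob_def poisson_prob_def shift_intensity_def silent_prob_def)
    then show ?case using elim by (simp only:)
  qed
  have "prob X = (\<integral>w. indicator X w \<partial>M)" if "X \<in> events" for X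
    using that by simp
  from this[OF E] have "prob ?E = (\<integral>w. indicator ?E w \<partial>M)" .
  also have "(\<integral>w. indicator ?E w \<partial>M) = (\<integral>w. real_cond_exp M ?F (indicator ?E) w \<partial>M)"
    by (rule F.real_cond_exp_int(2)[symmetric], rule integrable_real_indicator[OF E])
      (simp only: emeasure_eq_measure ennreal_less_top infinity_ennreal_def)
  also have "\<dots> = (\<integral>w. (\<Prod>i<n. silent_prob (B i) (A i w)) \<partial>M)"
  proof (rule integral_cong_AE)
    show "(\<lambda>w. \<Prod>i<n. silent_prob (B i) (A i w)) \<in> borel_measurable M"
    proof (rule borel_measurable_prod)
      fix i assume "i \<in> {..<n}"
      then have "B i \<in> sets borel" by (intro B) simp
      then show "(\<lambda>w. silent_prob (B i) (A i w)) \<in> borel_measurable M"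
        by (rule measurable_compose[OF A_measurable silent_prob_measurable])
    qed
    show "real_cond_exp M ?F (indicator ?E) \<in> borel_measurable M"
      by (rule borel_measurable_cond_exp2)
  qed (rule ae)
  finally show ?thesis by (simp only: E_eq)
qed

lemma single_silence:
  assumes B: "B \<in> sets borel" "bounded B"
  shows "prob {w \<in> space M. \<Xi> n w \<inter> B = {}} = (\<integral>w. silent_prob B (A n w) \<partial>M)"
proof -
  let ?B = "\<lambda>i. if i = n then B else {}"
  have "prob {w \<in> space M. \<forall>i<Suc n. \<Xi> i w \<inter> ?B i = {}} = (\<integral>w. (\<Prod>i<Suc n. silent_prob (?B i) (A i w)) \<partial>M)"
    using B by (intro joint_silence) auto
  moreover have "(\<forall>i<Suc n. \<Xi> i w \<inter> ?B i = {}) \<longleftrightarrow> \<Xi> n w \<inter> B = {}" for w by auto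
  moreover have "(\<Prod>i<Suc n. silent_prob (?B i) (A i w)) = silent_prob B (A n w)" for w
  proof -
    have "(\<Prod>i<n. silent_prob (?B i) (A i w)) = 1"
      by (intro prod.neutral ballI) auto
    then show ?thesis by (simp only: prod.lessThan_Suc if_True mult_1 refl)
  qed
  ultimately show ?thesis by (simp only:)
qed

text \<open>The mean number of documents requested in \<open>[-k, k]\<close> is
  \<open>\<gamma> * \<integral> (1 - silent_prob {-k..k} a) da\<close> by \<open>campbell\<close>, which is finite by
  \<open>finite_window_rate\<close> for the window length \<open>2 * k\<close>.\<close>

lemma AE_finitely_many_in_window:
  assumes "0 \<le> k"
  shows "AE w in M. finite {n. \<Xi> n w \<inter> {- k..k} \<noteq> {}}"
proof -
  let ?B = "{- k..k}"
  let ?g = "\<lambda>w v. ennreal (1 - exp (- (\<Lambda> w v - \<Lambda> w (v - 2 * k))))"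
  interpret P: pair_sigma_finite M lborel ..
  have [measurable]: "{w \<in> space M. \<Xi> n w \<inter> ?B \<noteq> {}} \<in> sets M" for n
  proof -
    have "{w \<in> space M. \<Xi> n w \<inter> ?B \<noteq> {}} = space M - {w \<in> space M. \<Xi> n w \<inter> ?B = {}}" by auto
    then show ?thesis by simp
  qed
  have "(\<Sum>n. emeasure M {w \<in> space M. \<Xi> n w \<inter> ?B \<noteq> {}}) = (\<Sum>n. \<integral>\<^sup>+w. ennreal (1 - silent_prob ?B (A n w)) \<partial>M)"
  proof (rule suminf_cong)
    fix n
    have int: "integrable M (\<lambda>w. silent_prob ?B (A n w))"
      by (intro integrable_const_bound[of _ 1] AE_I2) (auto simp: silent_prob_nonneg silent_prob_le_1)
    have "{w \<in> space M. \<Xi> n w \<inter> ?B \<noteq> {}} = space M - {w \<in> space M. \<Xi> n w \<inter> ?B = {}}" by auto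
    then have "prob {w \<in> space M. \<Xi> n w \<inter> ?B \<noteq> {}} = 1 - (\<integral>w. silent_prob ?B (A n w) \<partial>M)"
      by (simp add: prob_compl single_silence)
    also have "\<dots> = (\<integral>w. 1 - silent_prob ?B (A n w) \<partial>M)"
      using int by (simp add: prob_space)
    finally show "emeasure M {w \<in> space M. \<Xi> n w \<inter> ?B \<noteq> {}} = (\<integral>\<^sup>+w. ennreal (1 - silent_prob ?B (A n w)) \<partial>M)"
      using int by (subst nn_integral_eq_integral) (auto simp: emeasure_eq_measure silent_prob_le_1)
  qed
  also have "\<dots> = ennreal \<gamma> * (\<integral>\<^sup>+a. ennreal (1 - silent_prob ?B a) \<partial>lborel)"
    by (rule campbell) measurable
  also have "(\<integral>\<^sup>+a. ennreal (1 - silent_prob ?B a) \<partial>lborel) = (\<integral>\<^sup>+a. \<integral>\<^sup>+w. ?g w (k - a) \<partial>M \<partial>lborel)"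
  proof (rule nn_integral_cong)
    fix a
    have "ennreal (1 - silent_prob ?B a) = ennreal (\<integral>w. 1 - exp (- (LBINT u:?B. l w (u - a))) \<partial>M)"
      using integrable_exp_shifted_mass[of ?B a] by (simp add: silent_prob_def prob_space)
    also have "\<dots> = (\<integral>\<^sup>+w. ennreal (1 - exp (- (LBINT u:?B. l w (u - a)))) \<partial>M)"
      using integrable_exp_shifted_mass[of ?B a]
      by (intro nn_integral_eq_integral[symmetric] AE_I2) (auto simp: shifted_mass_nonneg)
    also have "\<dots> = (\<integral>\<^sup>+w. ?g w (k - a) \<partial>M)"
    proof (intro nn_integral_cong_AE, use AE_intensity in eventually_elim)
      case (elim w)
      have "k - a - 2 * k = - k - a" by simp
      then show ?case using elim assms by (simp only: window_mass)
    qed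
    finally show "ennreal (1 - silent_prob ?B a) = (\<integral>\<^sup>+w. ?g w (k - a) \<partial>M)" .
  qed
  also have "\<dots> = (\<integral>\<^sup>+v. \<integral>\<^sup>+w. ?g w v \<partial>M \<partial>lborel)"
    by (subst (2) nn_integral_real_affine[of _ "-1" k]) simp_all
  also have "\<dots> = (\<integral>\<^sup>+w. \<integral>\<^sup>+v. ?g w v \<partial>lborel \<partial>M)"
    by (rule P.Fubini') measurable
  also have "ennreal \<gamma> * \<dots> < \<infinity>"
    using finite_window_rate[of "2 * k"] assms by (simp add: ennreal_mult_less_top)
  finally have fin: "(\<Sum>n. emeasure M {w \<in> space M. \<Xi> n w \<inter> ?B \<noteq> {}}) < \<infinity>" .
  have "AE w in M. finite {n. w \<in> {w \<in> space M. \<Xi> n w \<inter> ?B \<noteq> {}}}"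
  proof -
    have "(\<integral>\<^sup>+w. (\<Sum>n. indicator {w \<in> space M. \<Xi> n w \<inter> ?B \<noteq> {}} w) \<partial>M) < \<infinity>"
      using fin by (subst nn_integral_suminf) auto
    then have "AE w in M. (\<Sum>n. indicator {w \<in> space M. \<Xi> n w \<inter> ?B \<noteq> {}} w :: ennreal) \<noteq> \<infinity>"
      by (intro nn_integral_PInf_AE) auto
    then show ?thesis
    proof eventually_elim
      case (elim w)
      let ?T = "{n. w \<in> {w \<in> space M. \<Xi> n w \<inter> ?B \<noteq> {}}}"
      have "(\<Sum>n. indicator {w \<in> space M. \<Xi> n w \<inter> ?B \<noteq> {}} w :: ennreal) = (\<Sum>n. indicator ?T n)"
        by (simp add: indicator_def)
      also have "\<dots> = emeasure (count_space UNIV) ?T"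
        by (simp flip: nn_integral_count_space_nat)
      finally show ?case using elim by (auto simp: emeasure_count_space split: if_splits)
    qed
  qed
  then show ?thesis using AE_space by eventually_elim simp
qed

lemma AE_finitely_requested: "AE w in M. finitely_requested (\<lambda>n. \<Xi> n w)"
  unfolding finitely_requested_def AE_all_countable by (intro allI AE_finitely_many_in_window) simp

end

section \<open>Stationarity of the exit time\<close>

text \<open>Divide by \<open>z ^ k\<close> after the first \<open>k\<close> coefficients are known to vanish, and let \<open>z\<close> tend to
  \<open>0\<close> from the right.\<close>

lemma power_series_zero_coeffs:
  fixes a :: "nat \<Rightarrow> real"
  assumes bound: "\<And>k. \<bar>a k\<bar> \<le> b"
    and zero: "\<And>z. 0 < z \<Longrightarrow> z < 1 \<Longrightarrow> (\<lambda>k. a k * z ^ k) sums 0"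
  shows "a k = 0"
proof (induction k rule: less_induct)
  case (less k)
  have summ: "summable (\<lambda>n. a (n + k) * x ^ n)" if "\<bar>x\<bar> < 1" for x
  proof (rule summable_comparison_test')
    show "summable (\<lambda>n. b * \<bar>x\<bar> ^ n)" using that by (intro summable_mult summable_geometric) simp
    show "norm (a (n + k) * x ^ n) \<le> b * \<bar>x\<bar> ^ n" if "n \<ge> 0" for n
      using bound[of "n + k"] by (simp add: abs_mult power_abs mult_right_mono)
  qed
  define f where "f x = (\<Sum>n. a (n + k) * x ^ n)" for x
  have "(f \<longlongrightarrow> a (0 + k)) (at 0)"
    using summ by (intro powser_limit_0[of 1]) (auto simp: f_def intro: summable_sums)
  then have lim: "(f \<longlongrightarrow> a k) (at_right 0)" by (simp add: filterlim_at_split)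
  have "f z = 0" if z: "0 < z" "z < 1" for z
  proof -
    have "(\<lambda>n. a (n + k) * z ^ (n + k)) sums (0 - (\<Sum>n<k. a n * z ^ n))"
      using zero[OF z] by (rule sums_split_initial_segment)
    then have "(\<lambda>n. a (n + k) * z ^ n * z ^ k) sums 0"
      using less by (simp add: power_add mult.assoc)
    then have "(\<lambda>n. a (n + k) * z ^ n) sums (0 / z ^ k)"
      using z sums_divide[of "\<lambda>n. a (n + k) * z ^ n * z ^ k" 0 "z ^ k"] by simp
    then show ?thesis by (simp add: f_def sums_iff)
  qed
  then have "eventually (\<lambda>z. f z = 0) (at_right 0)"
    unfolding eventually_at_right_field by (intro exI[of _ 1]) auto
  then have "(f \<longlongrightarrow> 0) (at_right 0)" by (rule tendsto_eventually)
  with lim show "a k = 0" using tendsto_unique trivial_limit_at_right_real by blast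
qed

context document_catalog
begin

text \<open>Both sides expand over all choices of one summand per document into the same linear
  combination, to whose terms \<open>joint_silence\<close> applies.\<close>

lemma integral_prod_silence:
  assumes J: "finite J" and W: "\<And>j. j \<in> J \<Longrightarrow> W j \<in> sets borel" "\<And>j. j \<in> J \<Longrightarrow> bounded (W j)"
  shows "(\<integral>w. (\<Prod>n<K. \<Sum>j\<in>J. c j * of_bool (\<Xi> n w \<inter> W j = {})) \<partial>M)
     = (\<integral>w. (\<Prod>n<K. \<Sum>j\<in>J. c j * silent_prob (W j) (A n w)) \<partial>M)"
proof -
  let ?G = "PiE {..<K} (\<lambda>_. J)"
  define E where "E g = {w \<in> space M. \<forall>n<K. \<Xi> n w \<inter> W (g n) = {}}" for g
  have gJ: "g n \<in> J" if "g \<in> ?G" "n < K" for g n using that by auto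
  have E_ev: "E g \<in> events" if g: "g \<in> ?G" for g
  proof -
    have "{w \<in> space M. \<forall>n\<in>{..<K}. \<Xi> n w \<inter> W (g n) = {}} \<in> events"
      using gJ[OF g] W by (intro sets.sets_Collect_finite_All silent_measurable) auto
    then show ?thesis by (simp only: E_def lessThan_iff Ball_def)
  qed
  have int: "integrable M (\<lambda>w. \<Prod>n<K. silent_prob (W (g n)) (A n w))" if g: "g \<in> ?G" for g
  proof (rule integrable_const_bound[of _ 1])
    have "\<bar>\<Prod>n<K. silent_prob (W (g n)) (A n w)\<bar> \<le> 1" for w
      unfolding abs_prod using gJ[OF g] W
      by (intro prod_le_1) (auto simp: silent_prob_nonneg silent_prob_le_1)
    then show "AE w in M. norm (\<Prod>n<K. silent_prob (W (g n)) (A n w)) \<le> 1" by simp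
    show "(\<lambda>w. \<Prod>n<K. silent_prob (W (g n)) (A n w)) \<in> borel_measurable M"
    proof (rule borel_measurable_prod)
      fix n assume "n \<in> {..<K}"
      then have "W (g n) \<in> sets borel" using gJ[OF g] W by simp
      then show "(\<lambda>w. silent_prob (W (g n)) (A n w)) \<in> borel_measurable M"
        by (rule measurable_compose[OF A_measurable silent_prob_measurable])
    qed
  qed
  have "(\<integral>w. (\<Prod>n<K. \<Sum>j\<in>J. c j * of_bool (\<Xi> n w \<inter> W j = {})) \<partial>M)
      = (\<integral>w. (\<Sum>g\<in>?G. (\<Prod>n<K. c (g n)) * indicator (E g) w) \<partial>M)"
  proof (rule Bochner_Integration.integral_cong[OF refl])
    fix w assume w: "w \<in> space M"
    have "(\<Prod>n<K. \<Sum>j\<in>J. c j * of_bool (\<Xi> n w \<inter> W j = {}))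
        = (\<Sum>g\<in>?G. \<Prod>n<K. c (g n) * of_bool (\<Xi> n w \<inter> W (g n) = {}))"
      using J by (intro prod_sum_PiE) auto
    also have "\<dots> = (\<Sum>g\<in>?G. (\<Prod>n<K. c (g n)) * indicator (E g) w)"
    proof (rule sum.cong[OF refl])
      fix g
      have "(\<Prod>n<K. of_bool (\<Xi> n w \<inter> W (g n) = {})) = (indicator (E g) w :: real)"
      proof (cases "\<forall>n<K. \<Xi> n w \<inter> W (g n) = {}")
        case True
        then show ?thesis using w by (simp add: E_def indicator_def)
      next
        case False
        then obtain n where "n < K" "\<Xi> n w \<inter> W (g n) \<noteq> {}" by auto
        then have "(\<Prod>n<K. of_bool (\<Xi> n w \<inter> W (g n) = {})) = (0::real)"
          by (intro prod_zero bexI[of _ n]) auto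
        with False show ?thesis by (simp add: E_def indicator_def)
      qed
      then show "(\<Prod>n<K. c (g n) * of_bool (\<Xi> n w \<inter> W (g n) = {}))
          = (\<Prod>n<K. c (g n)) * indicator (E g) w"
        by (simp only: prod.distrib)
    qed
    finally show "(\<Prod>n<K. \<Sum>j\<in>J. c j * of_bool (\<Xi> n w \<inter> W j = {}))
        = (\<Sum>g\<in>?G. (\<Prod>n<K. c (g n)) * indicator (E g) w)" .
  qed
  also have "\<dots> = (\<Sum>g\<in>?G. \<integral>w. (\<Prod>n<K. c (g n)) * indicator (E g) w \<partial>M)"
    by (rule Bochner_Integration.integral_sum, rule integrable_mult_right, rule integrable_real_indicator)
      (auto intro: E_ev simp: emeasure_eq_measure)
  also have "\<dots> = (\<Sum>g\<in>?G. (\<Prod>n<K. c (g n)) * prob (E g))"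
  proof (rule sum.cong[OF refl])
    fix g assume g: "g \<in> ?G"
    have "(\<integral>w. d * indicator X w \<partial>M) = d * prob X" if "X \<in> events" for X d
      using that by simp
    from this[OF E_ev[OF g]] show "(\<integral>w. (\<Prod>n<K. c (g n)) * indicator (E g) w \<partial>M) = (\<Prod>n<K. c (g n)) * prob (E g)" .
  qed
  also have "\<dots> = (\<Sum>g\<in>?G. (\<Prod>n<K. c (g n)) * (\<integral>w. (\<Prod>n<K. silent_prob (W (g n)) (A n w)) \<partial>M))"
  proof (rule sum.cong[OF refl])
    fix g assume g: "g \<in> ?G"
    have "prob (E g) = (\<integral>w. (\<Prod>n<K. silent_prob (W (g n)) (A n w)) \<partial>M)"
      using gJ[OF g] W unfolding E_def by (intro joint_silence) auto
    then show "(\<Prod>n<K. c (g n)) * prob (E g)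
        = (\<Prod>n<K. c (g n)) * (\<integral>w. (\<Prod>n<K. silent_prob (W (g n)) (A n w)) \<partial>M)"
      by (simp only:)
  qed
  also have "\<dots> = (\<Sum>g\<in>?G. \<integral>w. (\<Prod>n<K. c (g n)) * (\<Prod>n<K. silent_prob (W (g n)) (A n w)) \<partial>M)"
    by (simp only: integral_mult_right_zero)
  also have "\<dots> = (\<integral>w. (\<Sum>g\<in>?G. (\<Prod>n<K. c (g n)) * (\<Prod>n<K. silent_prob (W (g n)) (A n w))) \<partial>M)"
    by (rule Bochner_Integration.integral_sum[symmetric], rule integrable_mult_right, rule int)
  also have "\<dots> = (\<integral>w. (\<Prod>n<K. \<Sum>j\<in>J. c j * silent_prob (W j) (A n w)) \<partial>M)"
  proof (rule Bochner_Integration.integral_cong[OF refl])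
    fix w
    have "(\<Prod>n<K. \<Sum>j\<in>J. c j * silent_prob (W j) (A n w))
        = (\<Sum>g\<in>?G. \<Prod>n<K. c (g n) * silent_prob (W (g n)) (A n w))"
      using J by (intro prod_sum_PiE) auto
    then show "(\<Sum>g\<in>?G. (\<Prod>n<K. c (g n)) * (\<Prod>n<K. silent_prob (W (g n)) (A n w)))
        = (\<Prod>n<K. \<Sum>j\<in>J. c j * silent_prob (W j) (A n w))"
      by (simp only: prod.distrib)
  qed
  finally show ?thesis .
qed

definition requested :: "real \<Rightarrow> real \<Rightarrow> 'w \<Rightarrow> nat set" where
  "requested s q w = {n. \<Xi> n w \<inter> {s..s + q} \<noteq> {}}"

lemma requested_mono: "q \<le> q' \<Longrightarrow> requested s q w \<subseteq> requested s q' w"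
  by (fastforce simp: requested_def)

lemma requested_member_measurable [measurable]:
  "{w \<in> space M. n \<in> requested s q w} \<in> events"
proof -
  have "{w \<in> space M. n \<in> requested s q w} = space M - {w \<in> space M. \<Xi> n w \<inter> {s..s+q} = {}}"
    by (auto simp: requested_def)
  then show ?thesis by simp
qed

lemma requested_card_measurable [measurable]:
  "(\<lambda>w. card (requested s q w)) \<in> M \<rightarrow>\<^sub>M count_space UNIV"
  by (rule measurable_card) (rule requested_member_measurable)

definition settled :: "real \<Rightarrow> real \<Rightarrow> real \<Rightarrow> nat \<Rightarrow> 'w set" where
  "settled s t t' k = {w \<in> space M. requested s t w = requested s t' w \<and> card (requested s t w) = k}"

lemma settled_measurable [measurable]: "settled s t t' k \<in> events"
proof -
  have "settled s t t' k = {w \<in> space M. (\<forall>n. n \<in> requested s t w \<longleftrightarrow> n \<in> requested s t' w) \<and> card (requested s t w) = k}"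
    by (auto simp: settled_def)
  also have "\<dots> \<in> events" by measurable
  finally show ?thesis .
qed

text \<open>The mean over the mark of a document arriving at \<open>a\<close> of the factor that is \<open>z\<close> if the document
  is requested in \<open>[0, t]\<close>, \<open>0\<close> if it is requested in \<open>(t, t']\<close> for the first time, and \<open>1\<close>
  otherwise.\<close>

definition mark_pgf :: "real \<Rightarrow> real \<Rightarrow> real \<Rightarrow> real \<Rightarrow> real" where
  "mark_pgf z t t' a = z - z * silent_prob {0..t} a + silent_prob {0..t'} a"

lemma mark_pgf_measurable [measurable]: "mark_pgf z t t' \<in> borel_measurable borel"
  unfolding mark_pgf_def by measurable

lemma mark_pgf_bounds:
  assumes "0 \<le> z" "z \<le> 1" "0 \<le> t" "t \<le> t'"
  shows "0 \<le> mark_pgf z t t' a" "mark_pgf z t t' a \<le> 1"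
proof -
  let ?q = "silent_prob {0..t} a" and ?q' = "silent_prob {0..t'} a"
  have q: "0 \<le> ?q'" "?q' \<le> ?q" "?q \<le> 1"
    using assms by (auto simp: silent_prob_nonneg silent_prob_le_1 silent_prob_window_antimono)
  have "0 \<le> z * (1 - ?q)" using assms q by (intro mult_nonneg_nonneg) auto
  moreover have "z * (1 - ?q) \<le> 1 * (1 - ?q)"
    using assms q by (intro mult_right_mono) auto
  ultimately show "0 \<le> mark_pgf z t t' a" "mark_pgf z t t' a \<le> 1"
    using q by (auto simp: mark_pgf_def algebra_simps)
qed

text \<open>The product of these factors over all documents is \<open>z ^ k\<close> on \<open>settled s t t' k\<close> and vanishes
  off the union of these events, so its mean is the generating function on the left. Since only
  finitely many documents are requested, almost every partial product is eventually constant.\<close>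

lemma settled_pgf:
  assumes z: "0 < z" "z < 1" and t: "0 \<le> t" "t \<le> t'"
  shows "(\<lambda>k. prob (settled s t t' k) * z ^ k) sums
    enn2real (\<integral>\<^sup>+w. arrival_product (\<lambda>x. mark_pgf z t t' (x - s)) w \<partial>M)"
proof -
  let ?h = "\<lambda>x. mark_pgf z t t' (x - s)"
  let ?f = "\<lambda>n w. if n \<in> requested s t w then z else if n \<in> requested s t' w then 0 else 1"
  let ?Z = "\<lambda>w. if requested s t w = requested s t' w then z ^ card (requested s t w) else 0"
  have h01: "0 \<le> ?h x" "?h x \<le> 1" for x using mark_pgf_bounds[of z t t'] z t by auto
  have f_meas: "?f n \<in> borel_measurable M" for n by measurable
  have prod_f: "(\<lambda>w. \<Prod>n<K. ?f n w) \<in> borel_measurable M" for K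
    by (rule borel_measurable_prod) (rule f_meas)
  have f01: "0 \<le> ?f n w" "?f n w \<le> 1" for n w using z by auto
  have prod01: "0 \<le> (\<Prod>n<K. ?f n w)" "(\<Prod>n<K. ?f n w) \<le> 1" for K w
    using f01 by (intro prod_nonneg prod_le_1, blast)+
  have expect: "(\<integral>w. (\<Prod>n<K. ?f n w) \<partial>M) = (\<integral>w. (\<Prod>n<K. ?h (A n w)) \<partial>M)" for K
  proof -
    \<comment> \<open>The factor is \<open>z - z * 1{silent on [s, s + t]} + 1{silent on [s, s + t']}\<close>, a combination
      of void events; the constant term is the void event of the empty set.\<close>
    let ?W = "\<lambda>j::nat. if j = 0 then {} else if j = 1 then {s..s + t} else {s..s + t'}"
    let ?c = "\<lambda>j::nat. if j = 0 then z else if j = 1 then - z else 1"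
    have "{..<3::nat} = {0, 1, 2}" by auto
    then have f_eq: "?f n w = (\<Sum>j<3. ?c j * of_bool (\<Xi> n w \<inter> ?W j = {}))" for n w
      using requested_mono[of t t' s w] t by (auto simp: requested_def)
    have h_eq: "?h a = (\<Sum>j<3. ?c j * silent_prob (?W j) a)" for a
      using \<open>{..<3::nat} = {0, 1, 2}\<close> by (simp add: mark_pgf_def silent_prob_shift)
    show ?thesis unfolding f_eq h_eq
      by (rule integral_prod_silence) auto
  qed
  have lim1: "(\<lambda>K. ennreal (\<integral>w. (\<Prod>n<K. ?f n w) \<partial>M)) \<longlonglongrightarrow> (\<integral>\<^sup>+w. arrival_product ?h w \<partial>M)"
  proof -
    have "ennreal (\<integral>w. (\<Prod>n<K. ?h (A n w)) \<partial>M) = (\<integral>\<^sup>+w. (\<Prod>n<K. ennreal (?h (A n w))) \<partial>M)" for K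
    proof -
      have "integrable M (\<lambda>w. \<Prod>n<K. ?h (A n w))"
      proof (rule integrable_const_bound[of _ 1])
        have "\<bar>\<Prod>n<K. ?h (A n w)\<bar> \<le> 1" for w
          unfolding abs_prod using h01 by (intro prod_le_1) auto
        then show "AE w in M. norm (\<Prod>n<K. ?h (A n w)) \<le> 1" by simp
      qed measurable
      then have "(\<integral>\<^sup>+w. ennreal (\<Prod>n<K. ?h (A n w)) \<partial>M) = ennreal (\<integral>w. (\<Prod>n<K. ?h (A n w)) \<partial>M)"
        using h01 by (intro nn_integral_eq_integral AE_I2 prod_nonneg) auto
      then show ?thesis using h01 by (simp add: prod_ennreal)
    qed
    then show ?thesis
      using nn_integral_arrival_product_tendsto[of ?h] h01 by (simp add: expect)
  qed
  have lim_ptw: "AE w in M. (\<lambda>K. \<Prod>n<K. ?f n w) \<longlonglongrightarrow> ?Z w"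
    using AE_finitely_requested
  proof eventually_elim
    case (elim w)
    have fin: "finite (requested s q w)" for q
      using finitely_requested_window[OF elim] by (simp add: requested_def)
    from fin[of t'] obtain K0 where K0: "\<And>n. n \<in> requested s t' w \<Longrightarrow> n < K0"
      unfolding finite_nat_set_iff_bounded by blast
    have sub: "requested s t w \<subseteq> requested s t' w" using t by (intro requested_mono) simp
    have "(\<Prod>n<K. ?f n w) = ?Z w" if K: "K0 \<le> K" for K
    proof (cases "requested s t w = requested s t' w")
      case True
      have "(\<Prod>n<K. ?f n w) = (\<Prod>n<K. if n \<in> requested s t w then z else 1)"
        using True by (intro prod.cong) auto
      also have "\<dots> = z ^ card ({..<K} \<inter> requested s t w)"
        by (simp add: prod.If_cases)
      also have "{..<K} \<inter> requested s t w = requested s t w" using K0 K sub by force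
      finally show ?thesis using True by simp
    next
      case False
      then obtain n where n: "n \<in> requested s t' w" "n \<notin> requested s t w" using sub by auto
      then have "(\<Prod>n<K. ?f n w) = 0"
        using K0[of n] K by (intro prod_zero bexI[of _ n]) auto
      with False show ?thesis by simp
    qed
    then show ?case by (rule tendsto_eventually[OF eventually_sequentiallyI[of K0]])
  qed
  have Z_eq: "?Z w = (\<Sum>k. z ^ k * indicator (settled s t t' k) w)" if "w \<in> space M" for w
  proof -
    have "(\<Sum>k. z ^ k * indicator (settled s t t' k) w)
       = (\<Sum>k\<in>{card (requested s t w)}. z ^ k * indicator (settled s t t' k) w)"
      by (rule suminf_finite) (auto simp: settled_def)
    then show ?thesis using that by (simp add: settled_def indicator_def)
  qed
  have sums: "(\<lambda>k. \<integral>w. z ^ k * indicator (settled s t t' k) w \<partial>M) sums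
      (\<integral>w. (\<Sum>k. z ^ k * indicator (settled s t t' k) w) \<partial>M)"
  proof (rule sums_integral)
    show "AE w in M. summable (\<lambda>k. norm (z ^ k * indicator (settled s t t' k) w))"
      using z by (intro AE_I2 summable_comparison_test'[OF summable_geometric[of z]])
        (auto simp: abs_mult split: split_indicator)
    show "summable (\<lambda>k. \<integral>w. norm (z ^ k * indicator (settled s t t' k) w) \<partial>M)"
      using z by (intro summable_comparison_test'[OF summable_geometric[of z]])
        (auto simp: abs_mult mult_left_le)
  qed (simp add: emeasure_eq_measure)
  have Z_meas: "?Z \<in> borel_measurable M"
    by (subst measurable_cong[OF Z_eq]) measurable
  have lim2: "(\<lambda>K. \<integral>w. (\<Prod>n<K. ?f n w) \<partial>M) \<longlonglongrightarrow> (\<integral>w. ?Z w \<partial>M)"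
  proof (rule integral_dominated_convergence[where w="\<lambda>_. 1"])
    show "AE w in M. norm (\<Prod>n<K. ?f n w) \<le> 1" for K
      using prod01 by (intro AE_I2) (simp only: real_norm_def abs_of_nonneg)
  qed (fact lim_ptw Z_meas prod_f | simp)+
  have "(\<integral>\<^sup>+w. arrival_product ?h w \<partial>M) = ennreal (\<integral>w. ?Z w \<partial>M)"
    using lim1 tendsto_ennrealI[OF lim2] by (rule LIMSEQ_unique)
  moreover have "0 \<le> (\<integral>w. ?Z w \<partial>M)" using z by (intro integral_nonneg_AE AE_I2) auto
  ultimately have "enn2real (\<integral>\<^sup>+w. arrival_product ?h w \<partial>M) = (\<integral>w. ?Z w \<partial>M)"
    by simp
  also have "\<dots> = (\<integral>w. (\<Sum>k. z ^ k * indicator (settled s t t' k) w) \<partial>M)"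
    by (rule Bochner_Integration.integral_cong[OF refl Z_eq])
  finally show ?thesis using sums by (simp add: mult.commute)
qed

lemma settled_shift:
  assumes t: "0 \<le> t" "t \<le> t'"
  shows "prob (settled s t t' k) = prob (settled 0 t t' k)"
proof -
  have "prob (settled s t t' k) - prob (settled 0 t t' k) = 0"
  proof (rule power_series_zero_coeffs[where b=1])
    show "\<bar>prob (settled s t t' k) - prob (settled 0 t t' k)\<bar> \<le> 1" for k
      by (simp add: abs_diff_le_iff abs_le_iff add_increasing2 le_diff_eq diff_le_eq)
    fix z :: real assume z: "0 < z" "z < 1"
    have "(\<integral>\<^sup>+w. arrival_product (\<lambda>x. mark_pgf z t t' (x - s)) w \<partial>M) = (\<integral>\<^sup>+w. arrival_product (mark_pgf z t t') w \<partial>M)"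
      using z t by (intro arrival_product_shift mark_pgf_bounds) auto
    then have "(\<lambda>k. prob (settled s t t' k) * z ^ k - prob (settled 0 t t' k) * z ^ k) sums 0"
      using sums_diff[OF settled_pgf[OF z t, of s] settled_pgf[OF z t, of 0]] by simp
    then show "(\<lambda>k. (prob (settled s t t' k) - prob (settled 0 t t' k)) * z ^ k) sums 0"
      by (simp add: left_diff_distrib)
  qed
  then show ?thesis by simp
qed

definition level :: "nat \<Rightarrow> real \<Rightarrow> real \<Rightarrow> 'w set" where
  "level C s q = {w \<in> space M. card (requested s q w) = C}"

lemma level_measurable [measurable]: "level C s q \<in> events"
  unfolding level_def by measurable

lemma level_Int_eq_settled:
  assumes "q \<le> q'" "C \<ge> 1"
  shows "level C s q \<inter> level C s q' = settled s q q' C"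
proof -
  have "requested s q w = requested s q' w"
    if "card (requested s q w) = C" "card (requested s q' w) = C" for w
    using that assms requested_mono[of q q' s w]
    by (intro card_subset_eq) (auto intro: card_ge_0_finite)
  then show ?thesis by (auto simp: level_def settled_def)
qed

text \<open>The sets of requested documents increase with time, so equal finite cardinalities at the two
  ends make them constant in between.\<close>

lemma level_between:
  assumes "w \<in> level C s p" "w \<in> level C s q" "p \<le> r" "r \<le> q" "C \<ge> 1"
  shows "w \<in> level C s r"
proof -
  have "requested s p w = requested s q w"
    using assms level_Int_eq_settled[of p q C s] by (auto simp: settled_def)
  then have "requested s r w = requested s q w"
    using requested_mono[OF assms(3), of s w] requested_mono[OF assms(4), of s w] by auto
  then show ?thesis using assms by (simp add: level_def)
qed

text \<open>Add the times in increasing order. If the level \<open>C\<close> is attained at the new, latest time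
  and at an earlier one, then by monotonicity it is attained at the latest of the earlier times, so
  the overlap in the inclusion-exclusion formula is a two-time event.\<close>

lemma finite_levels_shift:
  assumes "finite F" "F \<subseteq> {0..}" and C: "C \<ge> 1"
  shows "prob (\<Union>q\<in>F. level C s q) = prob (\<Union>q\<in>F. level C 0 q)"
  using assms(1,2)
proof (induction F rule: finite_linorder_max_induct)
  case (insert b F)
  have single: "prob (level C s b) = prob (level C 0 b)"
    using settled_shift[of b b s C] level_Int_eq_settled[of b b C] insert.prems C by simp
  show ?case
  proof (cases "F = {}")
    case False
    define m where "m = Max F"
    have m: "m \<in> F" "\<And>q. q \<in> F \<Longrightarrow> q \<le> m" using insert.hyps False by (auto simp: m_def)
    then have mb: "0 \<le> m" "m \<le> b" using insert by force+
    have "(\<Union>q\<in>F. level C s q) \<inter> level C s b = settled s m b C" for s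
    proof -
      have "(\<Union>q\<in>F. level C s q) \<inter> level C s b = level C s m \<inter> level C s b"
        using m mb C level_between[of _ C s _ b m] by auto
      then show ?thesis using mb C by (simp add: level_Int_eq_settled)
    qed
    moreover have "(\<Union>q\<in>F. level C s q) \<in> events" for s
      using insert.hyps by (intro sets.finite_UN) auto
    then have "prob ((\<Union>q\<in>F. level C s q) \<union> level C s b)
       = prob (\<Union>q\<in>F. level C s q) + prob (level C s b) - prob ((\<Union>q\<in>F. level C s q) \<inter> level C s b)" for s
      by (intro measure_Un3) (auto simp: fmeasurable_eq_sets)
    moreover have "(\<Union>q\<in>insert b F. level C s q) = (\<Union>q\<in>F. level C s q) \<union> level C s b" for s by auto
    moreover have "prob (\<Union>q\<in>F. level C s q) = prob (\<Union>q\<in>F. level C 0 q)" using insert by simp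
    ultimately show ?thesis using single settled_shift[OF mb, of s C] by simp
  qed (simp add: single)
qed simp

text \<open>The stationarity of \<open>T\<^sup>s - s\<close>, by exhausting the rational times by finite sets.\<close>

lemma filled_before_shift:
  assumes C: "C \<ge> 1"
  shows "prob {w \<in> space M. filled_before C (\<lambda>n. \<Xi> n w) s y}
    = prob {w \<in> space M. filled_before C (\<lambda>n. \<Xi> n w) 0 (y - s)}"
proof -
  define D where "D = {q \<in> \<rat>. 0 \<le> q \<and> q < y - s}"
  define F where "F k = D \<inter> from_nat_into \<rat> ` {..k}" for k :: nat
  have finF: "finite (F k)" "F k \<subseteq> {0..}" for k by (auto simp: F_def D_def)
  have "range (from_nat_into (\<rat>::real set)) = \<rat>"
    using countable_rat by (intro range_from_nat_into) auto
  then have UF: "(\<Union>k. F k) = D" unfolding F_def D_def by blast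
  have level_eq: "w \<in> level C s q \<longleftrightarrow> w \<in> space M \<and> distinct_requested (\<lambda>n. \<Xi> n w) s (s + q) = C" for w s q
    by (simp add: level_def distinct_requested_def requested_def)
  have before: "q < y - s \<longleftrightarrow> s + q < y" for q by auto
  have 1: "{w \<in> space M. filled_before C (\<lambda>n. \<Xi> n w) s y} = (\<Union>k. \<Union>q\<in>F k. level C s q)"
  proof -
    have "{w \<in> space M. filled_before C (\<lambda>n. \<Xi> n w) s y} = (\<Union>q\<in>D. level C s q)"
      unfolding set_eq_iff filled_before_def D_def UN_iff level_eq mem_Collect_eq before by blast
    then show ?thesis unfolding UF[symmetric] by simp
  qed
  have 2: "{w \<in> space M. filled_before C (\<lambda>n. \<Xi> n w) 0 (y - s)} = (\<Union>k. \<Union>q\<in>F k. level C 0 q)"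
  proof -
    have "{w \<in> space M. filled_before C (\<lambda>n. \<Xi> n w) 0 (y - s)} = (\<Union>q\<in>D. level C 0 q)"
      unfolding set_eq_iff filled_before_def D_def UN_iff level_eq mem_Collect_eq add_0_left by blast
    then show ?thesis unfolding UF[symmetric] by simp
  qed
  have lim: "(\<lambda>k. prob (\<Union>q\<in>F k. level C s q)) \<longlonglongrightarrow> prob (\<Union>k. \<Union>q\<in>F k. level C s q)" for s
  proof (rule finite_Lim_measure_incseq)
    show "range (\<lambda>k. \<Union>q\<in>F k. level C s q) \<subseteq> events"
      using finF by (auto intro!: sets.finite_UN)
    show "incseq (\<lambda>k. \<Union>q\<in>F k. level C s q)"
      unfolding incseq_def F_def by (intro allI impI UN_mono Int_mono image_mono) auto
  qed
  have "prob (\<Union>q\<in>F k. level C s q) = prob (\<Union>q\<in>F k. level C 0 q)" for k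
    by (rule finite_levels_shift[OF finF C])
  then have "(\<lambda>k. prob (\<Union>q\<in>F k. level C s q)) \<longlonglongrightarrow> prob (\<Union>k. \<Union>q\<in>F k. level C 0 q)"
    using lim[of 0] by simp
  with lim[of s] show ?thesis unfolding 1 2 by (rule LIMSEQ_unique)
qed

end

section \<open>Gaps on a dyadic grid\<close>

lemma bounded_Ico: "bounded {a..<b::real}"
  by (rule bounded_subset[OF bounded_closed_interval[of a b]]) auto

definition cell :: "nat \<Rightarrow> nat \<Rightarrow> real set" where
  "cell n i = {real i / 2 ^ n..<real (Suc i) / 2 ^ n}"

definition ahead :: "real \<Rightarrow> nat \<Rightarrow> nat \<Rightarrow> real set" where
  "ahead \<tau> n i = {real (Suc i) / 2 ^ n..<real (Suc i) / 2 ^ n + \<tau>}"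

lemma in_cell_iff: "x \<in> cell n i \<longleftrightarrow> 0 \<le> x \<and> nat \<lfloor>x * 2 ^ n\<rfloor> = i"
proof -
  have "x \<in> cell n i \<longleftrightarrow> real i \<le> x * 2 ^ n \<and> x * 2 ^ n < real i + 1"
    by (simp add: cell_def pos_divide_le_eq pos_less_divide_eq add.commute)
  also have "\<dots> \<longleftrightarrow> \<lfloor>x * 2 ^ n\<rfloor> = int i" by (simp add: floor_eq_iff)
  also have "\<dots> \<longleftrightarrow> 0 \<le> x \<and> nat \<lfloor>x * 2 ^ n\<rfloor> = i"
  proof -
    have "0 \<le> x \<longleftrightarrow> 0 \<le> \<lfloor>x * 2 ^ n\<rfloor>"
      using mult_le_cancel_right_pos[of "2 ^ n" 0 x] by simp
    moreover have "k = int i \<longleftrightarrow> 0 \<le> k \<and> nat k = i" for k by linarith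
    ultimately show ?thesis by blast
  qed
  finally show ?thesis .
qed

definition grid_gaps :: "nat \<Rightarrow> real \<Rightarrow> nat \<Rightarrow> real set \<Rightarrow> nat" where
  "grid_gaps K \<tau> n R = card {i \<in> {..<K * 2 ^ n}. R \<inter> cell n i \<noteq> {} \<and> R \<inter> ahead \<tau> n i = {}}"

definition gaps_below :: "nat \<Rightarrow> real \<Rightarrow> real set \<Rightarrow> nat" where
  "gaps_below K \<tau> R = card {x \<in> R \<inter> {0..<real K}. R \<inter> {x<..x + \<tau>} = {}}"

lemma index_less:
  assumes "0 \<le> x" "x < real K"
  shows "nat \<lfloor>x * 2 ^ n\<rfloor> < K * 2 ^ n"
proof -
  have "x * 2 ^ n < real K * 2 ^ n" using assms by simp
  then have "\<lfloor>x * 2 ^ n\<rfloor> < int (K * 2 ^ n)" by (simp add: floor_less_iff)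
  then show ?thesis using assms by (simp add: nat_less_iff)
qed

lemma cell_subset: "i < K * 2 ^ n \<Longrightarrow> cell n i \<subseteq> {0..<real K}"
proof
  fix x assume i: "i < K * 2 ^ n" and x: "x \<in> cell n i"
  have "x < real (Suc i) / 2 ^ n" "0 \<le> x" using x by (auto simp: cell_def intro: order_trans[rotated])
  moreover have "real (Suc i) / 2 ^ n \<le> real K"
  proof -
    have "real (Suc i) \<le> real (K * 2 ^ n)" using i by (simp only: of_nat_le_iff Suc_le_eq)
    then show ?thesis by (simp add: pos_divide_le_eq)
  qed
  ultimately show "x \<in> {0..<real K}" by simp
qed

text \<open>Provides the bound for dominated convergence as the mesh tends to \<open>0\<close>.\<close>

lemma grid_gaps_le:
  assumes "locally_finite_set R"
  shows "grid_gaps K \<tau> n R \<le> card (R \<inter> {0..<real K})"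
proof -
  have fin: "finite (R \<inter> {0..<real K})" using assms by (intro locally_finite_finite bounded_Ico)
  have "{i \<in> {..<K * 2 ^ n}. R \<inter> cell n i \<noteq> {} \<and> R \<inter> ahead \<tau> n i = {}}
      \<subseteq> (\<lambda>x. nat \<lfloor>x * 2 ^ n\<rfloor>) ` (R \<inter> {0..<real K})"
  proof
    fix i assume "i \<in> {i \<in> {..<K * 2 ^ n}. R \<inter> cell n i \<noteq> {} \<and> R \<inter> ahead \<tau> n i = {}}"
    then obtain x where "x \<in> R" "x \<in> cell n i" "i < K * 2 ^ n" by auto
    then show "i \<in> (\<lambda>x. nat \<lfloor>x * 2 ^ n\<rfloor>) ` (R \<inter> {0..<real K})"
      using cell_subset[of i K n] by (intro image_eqI[of _ _ x]) (auto simp: in_cell_iff)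
  qed
  then have "grid_gaps K \<tau> n R \<le> card ((\<lambda>x. nat \<lfloor>x * 2 ^ n\<rfloor>) ` (R \<inter> {0..<real K}))"
    unfolding grid_gaps_def using fin by (intro card_mono) auto
  also have "\<dots> \<le> card (R \<inter> {0..<real K})" using fin by (rule card_image_le)
  finally show ?thesis .
qed

lemma eventually_mesh_less:
  assumes "0 < e"
  shows "eventually (\<lambda>n. 1 / 2 ^ n < (e::real)) sequentially"
proof -
  have "(\<lambda>n. (1/2) ^ n :: real) \<longlonglongrightarrow> 0" by (rule LIMSEQ_realpow_zero) auto
  then have "eventually (\<lambda>n. (1/2) ^ n < e) sequentially" using assms by (rule order_tendstoD)
  then show ?thesis by (simp add: power_one_over)
qed

text \<open>On a fine grid every cell contains at most one of the finitely many requests below \<open>K\<close>. The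
  cell of \<open>x\<close> ends at a point \<open>b > x\<close> close to \<open>x\<close>. For the closed right end of \<open>(x, x + \<tau>]\<close> it
  matters that \<open>[b, b + \<tau>)\<close> reaches beyond \<open>x + \<tau>\<close>, but not beyond the next request after \<open>x + \<tau>\<close>.
  So there is no exceptional set of configurations.\<close>

lemma eventually_grid_gaps_eq:
  assumes lf: "locally_finite_set R" and \<tau>: "0 \<le> \<tau>"
  shows "eventually (\<lambda>n. grid_gaps K \<tau> n R = gaps_below K \<tau> R) sequentially"
proof -
  let ?D = "R \<inter> {0..<real K}"
  let ?idx = "\<lambda>n x. nat \<lfloor>x * 2 ^ n\<rfloor>"
  have fin: "finite ?D" using lf by (intro locally_finite_finite bounded_Ico)
  have "eventually (\<lambda>n. \<forall>x\<in>?D. \<forall>y\<in>?D. x < y \<longrightarrow> ?idx n x \<noteq> ?idx n y) sequentially"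
  proof (intro eventually_ball_finite fin ballI)
    fix x y assume xy: "x \<in> ?D" "y \<in> ?D"
    show "eventually (\<lambda>n. x < y \<longrightarrow> ?idx n x \<noteq> ?idx n y) sequentially"
    proof (cases "x < y")
      case True
      then have "eventually (\<lambda>n. 1 / 2 ^ n < y - x) sequentially" by (intro eventually_mesh_less) simp
      then show ?thesis
      proof eventually_elim
        case (elim n)
        then have "1 < (y - x) * 2 ^ n" by (simp add: pos_divide_less_eq)
        then have "x * 2 ^ n + 1 < y * 2 ^ n" by (simp add: algebra_simps)
        then have "\<lfloor>x * 2 ^ n\<rfloor> < \<lfloor>y * 2 ^ n\<rfloor>" by linarith
        moreover have "0 \<le> \<lfloor>x * 2 ^ n\<rfloor>" using xy by simp
        ultimately have "?idx n x < ?idx n y" by linarith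
        then show ?case using less_imp_neq by blast
      qed
    qed simp
  qed
  moreover have "eventually (\<lambda>n. \<forall>x\<in>?D. R \<inter> ahead \<tau> n (?idx n x) = {} \<longleftrightarrow> R \<inter> {x<..x + \<tau>} = {}) sequentially"
  proof (intro eventually_ball_finite fin ballI)
    fix x assume x: "x \<in> ?D"
    have b: "x < real (Suc (?idx n x)) / 2 ^ n" "real (Suc (?idx n x)) / 2 ^ n \<le> x + 1 / 2 ^ n" for n
    proof -
      have e: "real (?idx n x) = real_of_int \<lfloor>x * 2 ^ n\<rfloor>" using x by simp
      have "x * 2 ^ n < real (Suc (?idx n x))" "real (Suc (?idx n x)) \<le> x * 2 ^ n + 1"
        unfolding of_nat_Suc e by linarith+
      then show "x < real (Suc (?idx n x)) / 2 ^ n" "real (Suc (?idx n x)) / 2 ^ n \<le> x + 1 / 2 ^ n"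
        by (simp_all add: pos_less_divide_eq pos_divide_le_eq distrib_right del: of_nat_Suc)
    qed
    show "eventually (\<lambda>n. R \<inter> ahead \<tau> n (?idx n x) = {} \<longleftrightarrow> R \<inter> {x<..x + \<tau>} = {}) sequentially"
    proof (cases "R \<inter> {x<..x + \<tau>} = {}")
      case True
      obtain e where e: "e > 0" "R \<inter> {x + \<tau><..x + \<tau> + e} = {}"
        using locally_finite_gap[OF lf, of "x + \<tau>"] by metis
      from eventually_mesh_less[OF e(1)] show ?thesis
      proof eventually_elim
        case (elim n)
        have "R \<inter> ahead \<tau> n (?idx n x) = {}"
        proof (rule ccontr)
          assume "R \<inter> ahead \<tau> n (?idx n x) \<noteq> {}"
          then obtain y where y: "y \<in> R" "real (Suc (?idx n x)) / 2 ^ n \<le> y" "y < real (Suc (?idx n x)) / 2 ^ n + \<tau>"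
            unfolding ahead_def by auto
          then have "x < y" "y \<le> x + \<tau> + e" using b[of n] elim by linarith+
          then have "y \<in> R \<inter> {x<..x + \<tau>} \<or> y \<in> R \<inter> {x + \<tau><..x + \<tau> + e}" using y by auto
          then show False using True e by auto
        qed
        with True show ?case by simp
      qed
    next
      case False
      then obtain y where y: "y \<in> R" "x < y" "y \<le> x + \<tau>" by auto
      then have "eventually (\<lambda>n. 1 / 2 ^ n < y - x) sequentially" by (intro eventually_mesh_less) simp
      then show ?thesis
      proof eventually_elim
        case (elim n)
        have "real (Suc (?idx n x)) / 2 ^ n \<le> y" "y < real (Suc (?idx n x)) / 2 ^ n + \<tau>"
          using b[of n] elim y by linarith+
        then have "y \<in> R \<inter> ahead \<tau> n (?idx n x)" using y unfolding ahead_def by simp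
        with False show ?case by auto
      qed
    qed
  qed
  ultimately show ?thesis
  proof eventually_elim
    case (elim n)
    let ?S = "{x \<in> ?D. R \<inter> {x<..x + \<tau>} = {}}"
    have "inj_on (?idx n) ?S"
    proof (rule inj_onI)
      fix x y assume "x \<in> ?S" "y \<in> ?S" "?idx n x = ?idx n y"
      then show "x = y" using elim(1) by (cases x y rule: linorder_cases) (force+)
    qed
    moreover have "{i \<in> {..<K * 2 ^ n}. R \<inter> cell n i \<noteq> {} \<and> R \<inter> ahead \<tau> n i = {}} = ?idx n ` ?S"
    proof (intro set_eqI iffI)
      fix i assume "i \<in> {i \<in> {..<K * 2 ^ n}. R \<inter> cell n i \<noteq> {} \<and> R \<inter> ahead \<tau> n i = {}}"
      then obtain x where x: "x \<in> R" "x \<in> cell n i" "i < K * 2 ^ n" "R \<inter> ahead \<tau> n i = {}" by auto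
      then have "x \<in> ?D" "?idx n x = i" using cell_subset[of i K n] by (auto simp: in_cell_iff)
      with x elim(2) show "i \<in> ?idx n ` ?S" by blast
    next
      fix i assume "i \<in> ?idx n ` ?S"
      then obtain x where x: "x \<in> ?S" "i = ?idx n x" by auto
      then have "x \<in> cell n i" by (simp add: in_cell_iff)
      moreover have "i < K * 2 ^ n" using x index_less[of x K n] by simp
      moreover have "R \<inter> ahead \<tau> n i = {}" using x elim(2) by blast
      ultimately show "i \<in> {i \<in> {..<K * 2 ^ n}. R \<inter> cell n i \<noteq> {} \<and> R \<inter> ahead \<tau> n i = {}}"
        using x by auto
    qed
    ultimately show ?case unfolding grid_gaps_def gaps_below_def by (simp add: card_image)
  qed
qed

lemma grid_gaps_measurable [measurable]: "grid_gaps K \<tau> n \<in> config \<rightarrow>\<^sub>M count_space UNIV"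
  unfolding grid_gaps_def
proof (rule measurable_card)
  fix i
  have 1: "{R \<in> space config. R \<inter> cell n i = {}} \<in> sets config"
    by (rule avoids_measurable) (auto simp: cell_def bounded_Ico)
  have 2: "{R \<in> space config. R \<inter> ahead \<tau> n i = {}} \<in> sets config"
    by (rule avoids_measurable) (auto simp: ahead_def bounded_Ico)
  have "{R \<in> space config. i \<in> {i \<in> {..<K * 2 ^ n}. R \<inter> cell n i \<noteq> {} \<and> R \<inter> ahead \<tau> n i = {}}}
    = (if i < K * 2 ^ n then {R \<in> space config. R \<inter> ahead \<tau> n i = {}} - {R \<in> space config. R \<inter> cell n i = {}} else {})"
    by auto
  also have "\<dots> \<in> sets config" using 1 2 by auto
  finally show "{R \<in> space config. i \<in> {i \<in> {..<K * 2 ^ n}. R \<inter> cell n i \<noteq> {} \<and> R \<inter> ahead \<tau> n i = {}}} \<in> sets config" .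
qed

lemma gaps_below_measurable:
  assumes "0 \<le> \<tau>"
  shows "gaps_below K \<tau> \<in> config \<rightarrow>\<^sub>M count_space UNIV"
proof (subst measurable_count_space_eq2_countable, safe)
  fix k
  have "gaps_below K \<tau> R = k \<longleftrightarrow> (\<exists>N. \<forall>n\<ge>N. grid_gaps K \<tau> n R = k)" if R: "R \<in> space config" for R
  proof -
    obtain N where N: "\<And>n. N \<le> n \<Longrightarrow> grid_gaps K \<tau> n R = gaps_below K \<tau> R"
      using eventually_grid_gaps_eq[of R \<tau> K] assms R
      by (auto simp: space_config eventually_sequentially)
    show ?thesis
    proof
      assume "\<exists>N. \<forall>n\<ge>N. grid_gaps K \<tau> n R = k"
      then obtain N' where "\<And>n. N' \<le> n \<Longrightarrow> grid_gaps K \<tau> n R = k" by auto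
      from this[of "max N N'"] N[of "max N N'"] show "gaps_below K \<tau> R = k" by simp
    qed (use N in auto)
  qed
  then have "gaps_below K \<tau> -` {k} \<inter> space config
      = {R \<in> space config. \<exists>N. \<forall>n\<ge>N. grid_gaps K \<tau> n R = k}" by auto
  also have "\<dots> \<in> sets config" by measurable
  finally show "gaps_below K \<tau> -` {k} \<inter> space config \<in> sets config" .
qed auto

section \<open>The requests of the tagged document\<close>

locale tagged_document = tagged_intensity M l
  for M :: "'w measure" and l :: "'w \<Rightarrow> real \<Rightarrow> real" +
  fixes \<xi> :: "'w \<Rightarrow> real set"
  assumes cox: "cox_process M l \<xi>"
begin

abbreviation history where "history \<equiv> generated_by M l"

sublocale history: finite_measure_subalgebra M history
proof unfold_locales
  have "(\<lambda>w. l w u) \<in> borel_measurable M" for u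
    using measurable_compose[OF _ l_measurable, of "\<lambda>w. (w, u)" M] by simp
  then show "subalgebra M history" by (rule subalgebra_generated_by)
qed

lemma \<xi>_measurable [measurable]: "\<xi> \<in> M \<rightarrow>\<^sub>M config"
  using cox by (simp add: cox_process_def)

lemma \<xi>_locally_finite: "w \<in> space M \<Longrightarrow> locally_finite_set (\<xi> w)"
  using measurable_space[OF \<xi>_measurable] by (simp add: space_config)

lemma history_events: "G \<in> sets history \<Longrightarrow> G \<in> events"
  using history.subalg by (auto simp: subalgebra_def)

lemma mass_measurable:
  assumes [measurable]: "B \<in> sets borel"
  shows "(\<lambda>w. LBINT u:B. l w u) \<in> borel_measurable M"
  unfolding set_lebesgue_integral_def by measurable

lemma mass_nonneg: "w \<in> space M \<Longrightarrow> 0 \<le> (LBINT u:B. l w u)"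
  unfolding set_lebesgue_integral_def by (intro integral_nonneg_AE AE_I2) (simp add: l_nonneg)

lemma poisson_prob_measurable:
  assumes "test_sets m B"
  shows "(\<lambda>w. poisson_prob (l w) m B k) \<in> borel_measurable M"
  unfolding poisson_prob_def
proof (rule borel_measurable_prod)
  fix j assume "j \<in> {..<m}"
  then have L: "(\<lambda>w. LBINT u:B j. l w u) \<in> borel_measurable M"
    using assms by (intro mass_measurable) (simp add: test_sets_def)
  have "(\<lambda>w. exp (- L w) * L w ^ k j / fact (k j)) \<in> borel_measurable M"
    if "L \<in> borel_measurable M" for L :: "'w \<Rightarrow> real"
    using that by measurable
  from this[OF L] show "(\<lambda>w. exp (- (LBINT u:B j. l w u)) * (LBINT u:B j. l w u) ^ k j / fact (k j)) \<in> borel_measurable M" .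
qed

lemma poisson_prob_nonneg:
  assumes "w \<in> space M"
  shows "0 \<le> poisson_prob (l w) m B k"
  unfolding poisson_prob_def
proof (rule prod_nonneg)
  fix j
  have "0 \<le> exp (- x) * x ^ n / fact n" if "0 \<le> x" for x :: real and n
    using that by simp
  from this[OF mass_nonneg[OF assms]]
  show "0 \<le> exp (- (LBINT u:B j. l w u)) * (LBINT u:B j. l w u) ^ k j / fact (k j)" .
qed

lemma counts_event:
  assumes "test_sets m B"
  shows "{w \<in> space M. counts m B k (\<xi> w)} \<in> events"
proof -
  have ev: "{w \<in> space M. card (\<xi> w \<inter> B j) = k j} \<in> events" if "j \<in> {..<m}" for j
  proof -
    have "(\<lambda>S. card (S \<inter> B j)) \<in> config \<rightarrow>\<^sub>M count_space UNIV"
      using that assms by (intro count_measurable) (auto simp: test_sets_def)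
    then have "(\<lambda>w. card (\<xi> w \<inter> B j)) \<in> M \<rightarrow>\<^sub>M count_space UNIV"
      by (rule measurable_compose[OF \<xi>_measurable])
    then have "(\<lambda>w. card (\<xi> w \<inter> B j)) -` {k j} \<inter> space M \<in> events"
      by (rule measurable_sets) simp
    also have "(\<lambda>w. card (\<xi> w \<inter> B j)) -` {k j} \<inter> space M = {w \<in> space M. card (\<xi> w \<inter> B j) = k j}"
      by auto
    finally show ?thesis .
  qed
  have "{w \<in> space M. \<forall>j\<in>{..<m}. card (\<xi> w \<inter> B j) = k j} \<in> events"
    by (rule sets.sets_Collect_finite_All[OF ev]) auto
  then show ?thesis by (simp only: counts_def Ball_def lessThan_iff)
qed

text \<open>The Cox property integrated over an event of the intensity. Restricting to such events
  matters because the mean number of requests may be infinite, whereas it is finite on events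
  that bound the mass of the intensity.\<close>

lemma counts_restricted:
  assumes B: "test_sets m B" and G: "G \<in> sets history"
  shows "emeasure M (G \<inter> {w \<in> space M. counts m B k (\<xi> w)}) = (\<integral>\<^sup>+w\<in>G. ennreal (poisson_prob (l w) m B k) \<partial>M)"
proof -
  define E where "E = {w \<in> space M. counts m B k (\<xi> w)}"
  have E: "E \<in> events" unfolding E_def by (rule counts_event[OF B])
  note G' = history_events[OF G]
  have int: "integrable M (indicator E :: 'w \<Rightarrow> real)" using E by (simp add: emeasure_eq_measure)
  have ae: "AE w in M. real_cond_exp M history (indicator E) w = poisson_prob (l w) m B k"
    using cox B unfolding cox_process_def E_def by blast
  have pint: "integrable M (\<lambda>w. poisson_prob (l w) m B k)"
    using integrable_cong_AE[OF borel_measurable_cond_exp2 poisson_prob_measurable[OF B] ae]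
      history.real_cond_exp_int(1)[OF int] by blast
  have "prob (G \<inter> E) = (\<integral>w\<in>G. indicator E w \<partial>M)"
  proof -
    have "(\<integral>w\<in>G. indicator E w \<partial>M) = (\<integral>w. indicator (G \<inter> E) w \<partial>M)"
      unfolding set_lebesgue_integral_def by (intro Bochner_Integration.integral_cong) (auto split: split_indicator)
    also have "\<dots> = prob (G \<inter> E)" using E G' by simp
    finally show ?thesis ..
  qed
  also have "\<dots> = (\<integral>w\<in>G. real_cond_exp M history (indicator E) w \<partial>M)"
    by (rule history.real_cond_exp_intA[OF int G])
  also have "\<dots> = (\<integral>w. indicator G w * poisson_prob (l w) m B k \<partial>M)"
    unfolding set_lebesgue_integral_def
  proof (rule integral_cong_AE)
    show "AE w in M. indicator G w *\<^sub>R real_cond_exp M history (indicator E) w = indicator G w * poisson_prob (l w) m B k"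
      using ae by eventually_elim simp
  qed (use G' poisson_prob_measurable[OF B] borel_measurable_cond_exp2 in \<open>auto intro!: borel_measurable_times borel_measurable_scaleR borel_measurable_indicator\<close>)
  finally have "emeasure M (G \<inter> E) = ennreal (\<integral>w. indicator G w * poisson_prob (l w) m B k \<partial>M)"
    by (simp add: emeasure_eq_measure)
  also have "\<dots> = (\<integral>\<^sup>+w. ennreal (indicator G w * poisson_prob (l w) m B k) \<partial>M)"
    using integrable_real_mult_indicator[OF G' pint]
    by (intro nn_integral_eq_integral[symmetric] AE_I2) (auto simp: poisson_prob_nonneg mult.commute)
  also have "\<dots> = (\<integral>\<^sup>+w\<in>G. ennreal (poisson_prob (l w) m B k) \<partial>M)"
    by (intro nn_integral_cong) (auto split: split_indicator)
  finally show ?thesis by (simp add: E_def)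
qed

lemma silence_restricted:
  assumes B: "B \<in> sets borel" "bounded B" and G: "G \<in> sets history"
  shows "emeasure M (G \<inter> {w \<in> space M. \<xi> w \<inter> B = {}}) = (\<integral>\<^sup>+w\<in>G. ennreal (exp (- (LBINT u:B. l w u))) \<partial>M)"
proof -
  have "{w \<in> space M. counts 1 (\<lambda>_. B) (\<lambda>_. 0) (\<xi> w)} = {w \<in> space M. \<xi> w \<inter> B = {}}"
    using locally_finite_finite[OF \<xi>_locally_finite B(2)] by (auto simp: counts_def)
  moreover have "test_sets 1 (\<lambda>_. B)" using B by (simp add: test_sets_def disjoint_family_on_def)
  ultimately show ?thesis
    using counts_restricted[of 1 "\<lambda>_. B" G "\<lambda>_. 0"] G by (simp add: poisson_prob_def)
qed

lemma silence_event: "B \<in> sets borel \<Longrightarrow> bounded B \<Longrightarrow> {w \<in> space M. \<xi> w \<inter> B = {}} \<in> events"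
  using \<xi>_measurable by (rule avoids_event)

text \<open>The event that \<open>D\<close> is silent splits according to whether \<open>B\<close> is silent as well, so two
  void probabilities suffice.\<close>

lemma request_then_silence_restricted:
  assumes B: "B \<in> sets borel" "bounded B" and D: "D \<in> sets borel" "bounded D" and BD: "B \<inter> D = {}"
    and G: "G \<in> sets history"
  shows "emeasure M (G \<inter> {w \<in> space M. \<xi> w \<inter> B \<noteq> {} \<and> \<xi> w \<inter> D = {}})
    = (\<integral>\<^sup>+w\<in>G. ennreal ((1 - exp (- (LBINT u:B. l w u))) * exp (- (LBINT u:D. l w u))) \<partial>M)"
proof -
  let ?LB = "\<lambda>w. LBINT u:B. l w u" and ?LD = "\<lambda>w. LBINT u:D. l w u"
  let ?X = "G \<inter> {w \<in> space M. \<xi> w \<inter> B \<noteq> {} \<and> \<xi> w \<inter> D = {}}"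
  let ?Y = "G \<inter> {w \<in> space M. \<xi> w \<inter> B = {} \<and> \<xi> w \<inter> D = {}}"
  note [measurable] = mass_measurable[OF B(1)] mass_measurable[OF D(1)] history_events[OF G]
    silence_event[OF B] silence_event[OF D]
  have Y: "emeasure M ?Y = (\<integral>\<^sup>+w\<in>G. ennreal (exp (- ?LB w) * exp (- ?LD w)) \<partial>M)"
  proof -
    let ?T = "\<lambda>j::nat. if j = 0 then B else D"
    have "{..<2::nat} = {0, 1}" by auto
    then have p: "poisson_prob (l w) 2 ?T (\<lambda>_. 0) = exp (- ?LB w) * exp (- ?LD w)" for w
      by (simp add: poisson_prob_def)
    have "(\<forall>j<2::nat. P j) \<longleftrightarrow> P 0 \<and> P 1" for P by (auto simp: less_2_cases_iff)
    then have e: "{w \<in> space M. counts 2 ?T (\<lambda>_. 0) (\<xi> w)} = {w \<in> space M. \<xi> w \<inter> B = {} \<and> \<xi> w \<inter> D = {}}"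
      using locally_finite_finite[OF \<xi>_locally_finite B(2)] locally_finite_finite[OF \<xi>_locally_finite D(2)]
      by (auto simp: counts_def)
    have "test_sets 2 ?T" using B D BD by (auto simp: test_sets_def disjoint_family_on_def)
    from counts_restricted[OF this G, of "\<lambda>_. 0"] show ?thesis unfolding p e .
  qed
  have "emeasure M ?X + emeasure M ?Y = emeasure M (?X \<union> ?Y)"
    by (rule plus_emeasure) (measurable, auto)
  also have "?X \<union> ?Y = G \<inter> {w \<in> space M. \<xi> w \<inter> D = {}}" by auto
  also have "emeasure M \<dots> = (\<integral>\<^sup>+w\<in>G. ennreal (exp (- ?LD w)) \<partial>M)"
    by (rule silence_restricted[OF D G])
  also have "\<dots> = (\<integral>\<^sup>+w. ennreal ((1 - exp (- ?LB w)) * exp (- ?LD w)) * indicator G w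
      + ennreal (exp (- ?LB w) * exp (- ?LD w)) * indicator G w \<partial>M)"
  proof (rule nn_integral_cong)
    fix w assume "w \<in> space M"
    then have "0 \<le> (1 - exp (- ?LB w)) * exp (- ?LD w)" by (intro mult_nonneg_nonneg) (auto simp: mass_nonneg)
    then have "ennreal ((1 - exp (- ?LB w)) * exp (- ?LD w)) + ennreal (exp (- ?LB w) * exp (- ?LD w)) = ennreal (exp (- ?LD w))"
      by (subst ennreal_plus[symmetric]) (auto simp: algebra_simps)
    then show "ennreal (exp (- ?LD w)) * indicator G w = ennreal ((1 - exp (- ?LB w)) * exp (- ?LD w)) * indicator G w
      + ennreal (exp (- ?LB w) * exp (- ?LD w)) * indicator G w"
      by (simp only: distrib_right[symmetric])
  qed
  also have "\<dots> = (\<integral>\<^sup>+w\<in>G. ennreal ((1 - exp (- ?LB w)) * exp (- ?LD w)) \<partial>M) + emeasure M ?Y"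
    unfolding Y by (rule nn_integral_add) measurable
  finally have "emeasure M ?X + emeasure M ?Y
      = (\<integral>\<^sup>+w\<in>G. ennreal ((1 - exp (- ?LB w)) * exp (- ?LD w)) \<partial>M) + emeasure M ?Y" .
  then show ?thesis by (simp only: add.commute[of _ "emeasure M ?Y"] ennreal_add_left_cancel) (simp add: emeasure_eq_measure)
qed

end

lemma nn_integral_split_Ioc:
  fixes c :: "nat \<Rightarrow> real" and g :: "real \<Rightarrow> ennreal"
  assumes [measurable]: "g \<in> borel_measurable borel" and c: "\<And>i. c i \<le> c (Suc i)"
  shows "(\<integral>\<^sup>+u\<in>{c 0<..c m}. g u \<partial>lborel) = (\<Sum>i<m. \<integral>\<^sup>+u\<in>{c i<..c (Suc i)}. g u \<partial>lborel)"
proof (induction m)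
  case (Suc m)
  have "c 0 \<le> c m" using c by (rule lift_Suc_mono_le) simp
  then have "(\<integral>\<^sup>+u\<in>{c 0<..c (Suc m)}. g u \<partial>lborel)
      = (\<integral>\<^sup>+u. g u * indicator {c 0<..c m} u + g u * indicator {c m<..c (Suc m)} u \<partial>lborel)"
    using c[of m] by (intro nn_integral_cong) (auto split: split_indicator)
  also have "\<dots> = (\<integral>\<^sup>+u\<in>{c 0<..c m}. g u \<partial>lborel) + (\<integral>\<^sup>+u\<in>{c m<..c (Suc m)}. g u \<partial>lborel)"
    by (rule nn_integral_add) measurable
  finally show ?case using Suc by simp
qed simp

lemma nn_integral_exhaust:
  assumes g[measurable]: "g \<in> borel_measurable M" and G: "\<And>j. G j \<in> sets M" and inc: "incseq G"
    and cover: "AE x in M. \<exists>j. x \<in> G j"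
  shows "(\<integral>\<^sup>+x. g x \<partial>M) = (SUP j::nat. \<integral>\<^sup>+x\<in>G j. g x \<partial>M)"
proof -
  note [measurable] = G
  have "(SUP j. \<integral>\<^sup>+x\<in>G j. g x \<partial>M) = (\<integral>\<^sup>+x. (SUP j. g x * indicator (G j) x) \<partial>M)"
  proof (rule nn_integral_monotone_convergence_SUP[symmetric])
    show "incseq (\<lambda>j x. g x * indicator (G j) x)"
      using inc by (auto simp: incseq_def le_fun_def intro!: mult_left_mono split: split_indicator)
  qed measurable
  also have "\<dots> = (\<integral>\<^sup>+x. g x \<partial>M)"
  proof (intro nn_integral_cong_AE, use cover in eventually_elim)
    case (elim x)
    then obtain j where "x \<in> G j" by auto
    then show "(SUP j. g x * indicator (G j) x) = g x"
      by (intro antisym SUP_least SUP_upper2[of j]) (auto split: split_indicator)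
  qed
  finally show ?thesis ..
qed

context tagged_document
begin

text \<open>Up to a null set, the event that the intensity has mass at most \<open>J\<close> on \<open>B\<close>. The mass is an
  integral over uncountably many coordinates and need not be measurable with respect to the
  \<open>\<sigma>\<close>-algebra generated by the intensity. The conditional void probability is measurable by
  construction, and it equals \<open>exp (- mass)\<close> almost surely.\<close>

definition low_mass :: "real set \<Rightarrow> nat \<Rightarrow> 'w set" where
  "low_mass B J = {w \<in> space M. exp (- real J) \<le>
     real_cond_exp M history (indicator {w \<in> space M. counts 1 (\<lambda>_. B) (\<lambda>_. 0) (\<xi> w)}) w}"

lemma low_mass_history: "low_mass B J \<in> sets history"
proof -
  have sp: "space history = space M" using history.subalg by (simp add: subalgebra_def)
  have [measurable]: "real_cond_exp M history f \<in> borel_measurable history" for f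
    by (rule borel_measurable_cond_exp)
  show ?thesis unfolding low_mass_def sp[symmetric] by measurable
qed

lemma AE_low_mass_iff:
  assumes B: "B \<in> sets borel" "bounded B"
  shows "AE w in M. \<forall>J. w \<in> low_mass B J \<longleftrightarrow> (LBINT u:B. l w u) \<le> real J"
proof -
  have "test_sets 1 (\<lambda>_. B)" using B by (simp add: test_sets_def disjoint_family_on_def)
  then have "AE w in M. real_cond_exp M history
      (indicator {w \<in> space M. counts 1 (\<lambda>_. B) (\<lambda>_. 0) (\<xi> w)}) w = poisson_prob (l w) 1 (\<lambda>_. B) (\<lambda>_. 0)"
    using cox unfolding cox_process_def by blast
  then show ?thesis
    using AE_space
  proof eventually_elim
    case (elim w)
    have "poisson_prob (l w) 1 (\<lambda>_. B) (\<lambda>_. 0) = exp (- (LBINT u:B. l w u))"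
      by (simp add: poisson_prob_def)
    then show ?case using elim by (simp add: low_mass_def)
  qed
qed

lemma incseq_low_mass: "incseq (low_mass B)"
  unfolding incseq_def low_mass_def by (auto intro: order_trans[rotated])

lemma mean_requests_restricted:
  assumes B: "B \<in> sets borel" "bounded B" and G: "G \<in> sets history"
  shows "(\<integral>\<^sup>+w\<in>G. of_nat (card (\<xi> w \<inter> B)) \<partial>M) = (\<integral>\<^sup>+w\<in>G. ennreal (LBINT u:B. l w u) \<partial>M)"
proof (rule nn_integral_of_nat_poisson)
  show "(\<lambda>w. card (\<xi> w \<inter> B)) \<in> M \<rightarrow>\<^sub>M count_space UNIV"
    using measurable_compose[OF \<xi>_measurable count_measurable[OF B]] .
  show "(\<lambda>w. LBINT u:B. l w u) \<in> borel_measurable M" by (rule mass_measurable[OF B(1)])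
  show "G \<in> events" by (rule history_events[OF G])
  show "0 \<le> (LBINT u:B. l w u)" if "w \<in> space M" for w using that by (rule mass_nonneg)
  fix k
  have "test_sets 1 (\<lambda>_. B)" using B by (simp add: test_sets_def disjoint_family_on_def)
  from counts_restricted[OF this G, of "\<lambda>_. k"]
  show "emeasure M (G \<inter> {w \<in> space M. card (\<xi> w \<inter> B) = k})
      = (\<integral>\<^sup>+w\<in>G. ennreal (exp (- (LBINT u:B. l w u)) * (LBINT u:B. l w u) ^ k / fact k) \<partial>M)"
    by (simp add: counts_def poisson_prob_def)
qed

definition mesh_ceiling :: "nat \<Rightarrow> real \<Rightarrow> real" where
  "mesh_ceiling n u = real_of_int \<lceil>u * 2 ^ n\<rceil> / 2 ^ n"

lemma mesh_ceiling_measurable [measurable]: "mesh_ceiling n \<in> borel_measurable borel"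
  unfolding mesh_ceiling_def by measurable

lemma mesh_ceiling_cell:
  assumes "u \<in> {real i / 2 ^ n<..real (Suc i) / 2 ^ n}"
  shows "mesh_ceiling n u = real (Suc i) / 2 ^ n"
proof -
  have "real i < u * 2 ^ n" "u * 2 ^ n \<le> real (Suc i)"
    using assms by (simp_all add: pos_divide_less_eq pos_le_divide_eq del: of_nat_Suc)
  then have "\<lceil>u * 2 ^ n\<rceil> = int (Suc i)" by (simp add: ceiling_eq_iff)
  then show ?thesis by (simp add: mesh_ceiling_def)
qed

lemma mesh_ceiling_bounds: "u \<le> mesh_ceiling n u" "mesh_ceiling n u \<le> u + 1 / 2 ^ n"
proof -
  have "u * 2 ^ n \<le> real_of_int \<lceil>u * 2 ^ n\<rceil>" "real_of_int \<lceil>u * 2 ^ n\<rceil> \<le> u * 2 ^ n + 1" by linarith+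
  then show "u \<le> mesh_ceiling n u" "mesh_ceiling n u \<le> u + 1 / 2 ^ n"
    by (simp_all add: mesh_ceiling_def pos_le_divide_eq pos_divide_le_eq distrib_right)
qed

lemma mesh_ceiling_tendsto: "(\<lambda>n. mesh_ceiling n u) \<longlonglongrightarrow> u"
proof (rule tendsto_sandwich[where f="\<lambda>_. u" and h="\<lambda>n. u + 1 / 2 ^ n"])
  have "(\<lambda>n. u + (1/2) ^ n) \<longlonglongrightarrow> u + 0"
    by (intro tendsto_add tendsto_const LIMSEQ_realpow_zero) auto
  then show "(\<lambda>n. u + 1 / 2 ^ n) \<longlonglongrightarrow> u" by (simp add: power_one_over)
qed (auto simp: mesh_ceiling_bounds)

text \<open>In each cell, \<open>nn_integral_exp_Ioc\<close> turns the probability of a request into an integral over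
  the position \<open>u\<close>; multiplied by the probability of the silence that follows, the integrand
  becomes that of \<open>m\<close> with \<open>u + \<tau>\<close> replaced by the rounded time \<open>mesh_ceiling n u + \<tau>\<close>.\<close>

lemma grid_mass:
  assumes "integrable_intensity (l w)" and \<tau>: "0 \<le> \<tau>"
  shows "(\<Sum>i<K * 2 ^ n. ennreal ((1 - exp (- (LBINT u:cell n i. l w u))) * exp (- (LBINT u:ahead \<tau> n i. l w u))))
    = (\<integral>\<^sup>+u\<in>{0<..real K}. ennreal (survival (l w) u (mesh_ceiling n u + \<tau>)) \<partial>lborel)"
proof -
  interpret integrable_intensity "l w" by fact
  let ?c = "\<lambda>i. real i / 2 ^ n"
  let ?g = "\<lambda>u. ennreal (survival (l w) u (mesh_ceiling n u + \<tau>))"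
  have "ennreal ((1 - exp (- (LBINT u:cell n i. l w u))) * exp (- (LBINT u:ahead \<tau> n i. l w u)))
      = (\<integral>\<^sup>+u\<in>{?c i<..?c (Suc i)}. ?g u \<partial>lborel)" for i
  proof -
    let ?a = "?c i" and ?b = "?c (Suc i)"
    have ab: "?a \<le> ?b" by (simp add: divide_right_mono)
    have "(\<integral>\<^sup>+u\<in>{?a<..?b}. ?g u \<partial>lborel)
        = (\<integral>\<^sup>+u. ennreal (exp (- (F (?b + \<tau>) - F ?b))) * (ennreal (survival (l w) u ?b) * indicator {?a<..?b} u) \<partial>lborel)"
    proof (rule nn_integral_cong)
      fix u
      show "?g u * indicator {?a<..?b} u
        = ennreal (exp (- (F (?b + \<tau>) - F ?b))) * (ennreal (survival (l w) u ?b) * indicator {?a<..?b} u)"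
      proof (cases "u \<in> {?a<..?b}")
        case True
        have "exp (- (F (?b + \<tau>) - F u)) = exp (- (F (?b + \<tau>) - F ?b)) * exp (- (F ?b - F u))"
          by (simp flip: exp_add)
        then have "survival (l w) u (?b + \<tau>) = exp (- (F (?b + \<tau>) - F ?b)) * (survival (l w) u ?b)"
          by (simp only: mult.left_commute)
        then have "?g u = ennreal (exp (- (F (?b + \<tau>) - F ?b))) * ennreal (survival (l w) u ?b)"
          unfolding mesh_ceiling_cell[OF True] using nonneg by (simp only: ennreal_mult exp_ge_zero mult_nonneg_nonneg)
        with True show ?thesis by (simp only: indicator_simps mult_1_right)
      qed simp
    qed
    also have "\<dots> = ennreal (exp (- (F (?b + \<tau>) - F ?b))) * (\<integral>\<^sup>+u\<in>{?a<..?b}. ennreal (survival (l w) u ?b) \<partial>lborel)"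
      by (rule nn_integral_cmult) measurable
    also have "\<dots> = ennreal (exp (- (F (?b + \<tau>) - F ?b))) * ennreal (1 - exp (- (F ?b - F ?a)))"
      by (simp only: nn_integral_exp_Ioc[OF ab])
    also have "\<dots> = ennreal ((1 - exp (- (F ?b - F ?a))) * exp (- (F (?b + \<tau>) - F ?b)))"
      using F_mono[OF ab] by (subst ennreal_mult'[symmetric]) (auto simp: mult.commute)
    finally show ?thesis using ab \<tau> unfolding cell_def ahead_def by (simp add: integral_Ico del: of_nat_Suc)
  qed
  then have "(\<Sum>i<K * 2 ^ n. ennreal ((1 - exp (- (LBINT u:cell n i. l w u))) * exp (- (LBINT u:ahead \<tau> n i. l w u))))
      = (\<Sum>i<K * 2 ^ n. \<integral>\<^sup>+u\<in>{?c i<..?c (Suc i)}. ?g u \<partial>lborel)"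
    by (intro sum.cong) auto
  also have "\<dots> = (\<integral>\<^sup>+u\<in>{?c 0<..?c (K * 2 ^ n)}. ?g u \<partial>lborel)"
    by (rule nn_integral_split_Ioc[symmetric]) (measurable, simp add: divide_right_mono)
  finally show ?thesis by simp
qed

lemma mean_grid_gaps_restricted:
  assumes \<tau>: "0 \<le> \<tau>" and G: "G \<in> sets history"
  shows "(\<integral>\<^sup>+w\<in>G. of_nat (grid_gaps K \<tau> n (\<xi> w)) \<partial>M)
    = (\<integral>\<^sup>+w\<in>G. (\<integral>\<^sup>+u\<in>{0<..real K}. ennreal (survival (l w) u (mesh_ceiling n u + \<tau>)) \<partial>lborel) \<partial>M)"
proof -
  define E where "E i = {w \<in> space M. \<xi> w \<inter> cell n i \<noteq> {} \<and> \<xi> w \<inter> ahead \<tau> n i = {}}" for i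
  have B: "cell n i \<in> sets borel" "bounded (cell n i)" "ahead \<tau> n i \<in> sets borel" "bounded (ahead \<tau> n i)"
    "cell n i \<inter> ahead \<tau> n i = {}" for i
    by (auto simp: cell_def ahead_def bounded_Ico)
  have E: "E i \<in> events" for i
  proof -
    have "E i = {w \<in> space M. \<xi> w \<inter> ahead \<tau> n i = {}} - {w \<in> space M. \<xi> w \<inter> cell n i = {}}"
      by (auto simp: E_def)
    then show ?thesis using silence_event[OF B(1,2)[of i]] silence_event[OF B(3,4)[of i]] by auto
  qed
  have G': "G \<in> events" by (rule history_events[OF G])
  define q where "q i w = ennreal ((1 - exp (- (LBINT u:cell n i. l w u))) * exp (- (LBINT u:ahead \<tau> n i. l w u)))" for i w
  have q: "q i \<in> borel_measurable M" for i
  proof -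
    have "(\<lambda>w. ennreal ((1 - exp (- x w)) * exp (- y w))) \<in> borel_measurable M"
      if "x \<in> borel_measurable M" "y \<in> borel_measurable M" for x y :: "'w \<Rightarrow> real"
      using that by measurable
    from this[OF mass_measurable[OF B(1)] mass_measurable[OF B(3)]] show ?thesis unfolding q_def .
  qed
  have "(\<integral>\<^sup>+w\<in>G. of_nat (grid_gaps K \<tau> n (\<xi> w)) \<partial>M) = (\<integral>\<^sup>+w. (\<Sum>i<K * 2 ^ n. indicator (G \<inter> E i) w) \<partial>M)"
  proof (rule nn_integral_cong)
    fix w assume w: "w \<in> space M"
    have "grid_gaps K \<tau> n (\<xi> w) = (\<Sum>i<K * 2 ^ n. of_bool (\<xi> w \<inter> cell n i \<noteq> {} \<and> \<xi> w \<inter> ahead \<tau> n i = {}))"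
      unfolding grid_gaps_def by (rule card_eq_sum_of_bool) simp
    then have "of_nat (grid_gaps K \<tau> n (\<xi> w)) = (\<Sum>i<K * 2 ^ n. indicator (E i) w :: ennreal)"
      using w by (auto simp: E_def indicator_def of_bool_def intro!: sum.cong)
    then show "of_nat (grid_gaps K \<tau> n (\<xi> w)) * indicator G w = (\<Sum>i<K * 2 ^ n. indicator (G \<inter> E i) w :: ennreal)"
      by (cases "w \<in> G") (simp_all add: indicator_inter_arith)
  qed
  also have "\<dots> = (\<Sum>i<K * 2 ^ n. emeasure M (G \<inter> E i))"
    using E G' by (subst nn_integral_sum) auto
  also have "\<dots> = (\<Sum>i<K * 2 ^ n. \<integral>\<^sup>+w. q i w * indicator G w \<partial>M)"
    unfolding E_def q_def by (intro sum.cong refl request_then_silence_restricted B G)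
  also have "\<dots> = (\<integral>\<^sup>+w. (\<Sum>i<K * 2 ^ n. q i w * indicator G w) \<partial>M)"
    using q G' by (intro nn_integral_sum[symmetric] borel_measurable_times_ennreal borel_measurable_indicator) auto
  also have "\<dots> = (\<integral>\<^sup>+w\<in>G. (\<integral>\<^sup>+u\<in>{0<..real K}. ennreal (survival (l w) u (mesh_ceiling n u + \<tau>)) \<partial>lborel) \<partial>M)"
  proof (intro nn_integral_cong_AE, use AE_intensity in eventually_elim)
    case (elim w)
    then have "(\<Sum>i<K * 2 ^ n. q i w) = (\<integral>\<^sup>+u\<in>{0<..real K}. ennreal (survival (l w) u (mesh_ceiling n u + \<tau>)) \<partial>lborel)"
      unfolding q_def using \<tau> by (intro grid_mass) auto
    then show ?case by (simp only: sum_distrib_right[symmetric])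
  qed
  finally show ?thesis .
qed

definition surviving_mass_below :: "nat \<Rightarrow> real \<Rightarrow> 'w \<Rightarrow> ennreal" where
  "surviving_mass_below K \<tau> w =
    (\<integral>\<^sup>+u\<in>{0<..real K}. ennreal (survival (l w) u (u + \<tau>)) \<partial>lborel)"

lemma surviving_mass_below_measurable [measurable]: "surviving_mass_below K \<tau> \<in> borel_measurable M"
  unfolding surviving_mass_below_def by measurable

text \<open>Let the mesh tend to \<open>0\<close> in \<open>mean_grid_gaps_restricted\<close>. On the left the number of
  requests dominates, whose mean on \<open>low_mass\<close> is at most \<open>J\<close>; on the right the mass of the
  intensity does.\<close>

lemma mean_gaps_below_restricted:
  assumes \<tau>: "0 \<le> \<tau>"
  shows "(\<integral>\<^sup>+w\<in>low_mass {0..<real K} J. of_nat (gaps_below K \<tau> (\<xi> w)) \<partial>M)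
    = (\<integral>\<^sup>+w\<in>low_mass {0..<real K} J. surviving_mass_below K \<tau> w \<partial>M)"
proof (rule LIMSEQ_unique)
  let ?W = "{0..<real K}"
  let ?G = "low_mass ?W J"
  let ?r = "\<lambda>n w. \<integral>\<^sup>+u\<in>{0<..real K}. ennreal (survival (l w) u (mesh_ceiling n u + \<tau>)) \<partial>lborel"
  have G: "?G \<in> sets history" by (rule low_mass_history)
  note G'[measurable] = history_events[OF G]
  have W: "?W \<in> sets borel" "bounded ?W" by (auto simp: bounded_Ico)
  note ae = AE_low_mass_iff[OF W]
  have card_meas: "(\<lambda>w. card (\<xi> w \<inter> ?W)) \<in> M \<rightarrow>\<^sub>M count_space UNIV"
    using measurable_compose[OF \<xi>_measurable count_measurable[OF W]] .
  show "(\<lambda>n. \<integral>\<^sup>+w\<in>?G. of_nat (grid_gaps K \<tau> n (\<xi> w)) \<partial>M) \<longlonglongrightarrow> (\<integral>\<^sup>+w\<in>?G. of_nat (gaps_below K \<tau> (\<xi> w)) \<partial>M)"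
  proof (rule nn_integral_dominated_convergence[where w="\<lambda>w. of_nat (card (\<xi> w \<inter> ?W)) * indicator ?G w"])
    show "(\<lambda>w. of_nat (grid_gaps K \<tau> n (\<xi> w)) * indicator ?G w :: ennreal) \<in> borel_measurable M" for n
      by measurable
    show "(\<lambda>w. of_nat (gaps_below K \<tau> (\<xi> w)) * indicator ?G w :: ennreal) \<in> borel_measurable M"
      using measurable_compose[OF \<xi>_measurable gaps_below_measurable[OF \<tau>]] by measurable
    show "(\<lambda>w. of_nat (card (\<xi> w \<inter> ?W)) * indicator ?G w :: ennreal) \<in> borel_measurable M"
      using card_meas by measurable
    show "AE w in M. of_nat (grid_gaps K \<tau> n (\<xi> w)) * indicator ?G w
        \<le> (of_nat (card (\<xi> w \<inter> ?W)) * indicator ?G w :: ennreal)" for n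
      using grid_gaps_le[OF \<xi>_locally_finite] by (intro AE_I2 mult_right_mono) auto
    show "AE w in M. (\<lambda>n. of_nat (grid_gaps K \<tau> n (\<xi> w)) * indicator ?G w :: ennreal)
        \<longlonglongrightarrow> of_nat (gaps_below K \<tau> (\<xi> w)) * indicator ?G w"
    proof (intro AE_I2 tendsto_eventually)
      fix w assume "w \<in> space M"
      from eventually_grid_gaps_eq[OF \<xi>_locally_finite[OF this] \<tau>, of K]
      show "eventually (\<lambda>n. of_nat (grid_gaps K \<tau> n (\<xi> w)) * indicator ?G w = (of_nat (gaps_below K \<tau> (\<xi> w)) * indicator ?G w :: ennreal)) sequentially"
        by eventually_elim (simp only:)
    qed
    have "(\<integral>\<^sup>+w\<in>?G. of_nat (card (\<xi> w \<inter> ?W)) \<partial>M) = (\<integral>\<^sup>+w\<in>?G. ennreal (LBINT u:?W. l w u) \<partial>M)"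
      by (rule mean_requests_restricted[OF W G])
    also have "\<dots> \<le> (\<integral>\<^sup>+w. ennreal (real J) \<partial>M)"
    proof (intro nn_integral_mono_AE, use ae in eventually_elim)
      case (elim w)
      then show ?case by (cases "w \<in> ?G") (auto intro: ennreal_leI simp del: ennreal_of_nat_eq_real_of_nat)
    qed
    also have "\<dots> < \<infinity>" by (simp add: emeasure_space_1)
    finally show "(\<integral>\<^sup>+w\<in>?G. of_nat (card (\<xi> w \<inter> ?W)) \<partial>M) < \<infinity>" .
  qed
  have "(\<lambda>n. \<integral>\<^sup>+w\<in>?G. ?r n w \<partial>M) \<longlonglongrightarrow> (\<integral>\<^sup>+w\<in>?G. surviving_mass_below K \<tau> w \<partial>M)"
  proof (rule nn_integral_dominated_convergence[where w="\<lambda>_. ennreal (real J)"])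
    show "AE w in M. ?r n w * indicator ?G w \<le> ennreal (real J)" for n
      using ae AE_intensity
    proof eventually_elim
      case (elim w)
      then interpret integrable_intensity "l w" by simp
      show ?case
      proof (cases "w \<in> ?G")
        case True
        have "?r n w \<le> (\<integral>\<^sup>+u. ennreal (l w u) * indicator {0<..real K} u \<partial>lborel)"
        proof (intro nn_integral_mono mult_right_mono ennreal_leI)
          fix u
          have "F u \<le> F (mesh_ceiling n u + \<tau>)" using mesh_ceiling_bounds(1)[of u n] \<tau> by (intro F_mono) simp
          then show "survival (l w) u (mesh_ceiling n u + \<tau>) \<le> l w u"
            using nonneg by (intro mult_left_le) auto
        qed simp
        also have "\<dots> = ennreal (LBINT u:{0<..real K}. l w u)"
          using emeasure_eq[of "{0<..real K}"] by (simp add: emeasure_density)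
        also have "\<dots> = ennreal (LBINT u:?W. l w u)" by (simp add: integral_Ioc integral_Ico)
        also have "\<dots> \<le> ennreal (real J)" using elim True by (intro ennreal_leI) simp
        finally show ?thesis using True by simp
      qed simp
    qed
    show "AE w in M. (\<lambda>n. ?r n w * indicator ?G w) \<longlonglongrightarrow> surviving_mass_below K \<tau> w * indicator ?G w"
      using AE_intensity
    proof eventually_elim
      case (elim w)
      then interpret integrable_intensity "l w" by simp
      have "(\<lambda>n. ?r n w) \<longlonglongrightarrow> surviving_mass_below K \<tau> w"
        unfolding surviving_mass_below_def
      proof (rule nn_integral_dominated_convergence[where w="\<lambda>u. ennreal (l w u)"])
        show "(\<integral>\<^sup>+u. ennreal (l w u) \<partial>lborel) < \<infinity>"
          using nn_integral_eq_integral[OF integrable] nonneg by simp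
        show "AE u in lborel. ennreal (survival (l w) u (mesh_ceiling n u + \<tau>)) * indicator {0<..real K} u \<le> ennreal (l w u)" for n
        proof (rule AE_I2)
          fix u
          have "F u \<le> F (mesh_ceiling n u + \<tau>)" using mesh_ceiling_bounds(1)[of u n] \<tau> by (intro F_mono) simp
          then have "survival (l w) u (mesh_ceiling n u + \<tau>) \<le> l w u"
            using nonneg by (intro mult_left_le) auto
          then have "ennreal (survival (l w) u (mesh_ceiling n u + \<tau>)) \<le> ennreal (l w u)" by (rule ennreal_leI)
          then show "ennreal (survival (l w) u (mesh_ceiling n u + \<tau>)) * indicator {0<..real K} u \<le> ennreal (l w u)"
            by (cases "u \<in> {0<..real K}") (simp_all only: indicator_simps mult_1_right mult_zero_right zero_le not_False_eq_True)
        qed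
        show "AE u in lborel. (\<lambda>n. ennreal (survival (l w) u (mesh_ceiling n u + \<tau>)) * indicator {0<..real K} u)
          \<longlonglongrightarrow> ennreal (survival (l w) u (u + \<tau>)) * indicator {0<..real K} u"
        proof (rule AE_I2)
          fix u
          have "(\<lambda>n. F (mesh_ceiling n u + \<tau>)) \<longlonglongrightarrow> F (u + \<tau>)"
            by (intro isCont_tendsto_compose[OF F_isCont] tendsto_add tendsto_const mesh_ceiling_tendsto)
          then have "(\<lambda>n. ennreal (survival (l w) u (mesh_ceiling n u + \<tau>))) \<longlonglongrightarrow> ennreal (survival (l w) u (u + \<tau>))"
            by (intro tendsto_ennrealI tendsto_intros)
          then show "(\<lambda>n. ennreal (survival (l w) u (mesh_ceiling n u + \<tau>)) * indicator {0<..real K} u)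
            \<longlonglongrightarrow> ennreal (survival (l w) u (u + \<tau>)) * indicator {0<..real K} u"
            by (cases "u \<in> {0<..real K}") (simp_all only: indicator_simps mult_1_right mult_zero_right tendsto_const not_False_eq_True)
        qed
      qed measurable
      then show ?case
        by (cases "w \<in> ?G") (simp_all only: indicator_simps mult_1_right mult_zero_right tendsto_const not_False_eq_True)
    qed
  qed (measurable, simp add: emeasure_space_1)
  then show "(\<lambda>n. \<integral>\<^sup>+w\<in>?G. of_nat (grid_gaps K \<tau> n (\<xi> w)) \<partial>M) \<longlonglongrightarrow> (\<integral>\<^sup>+w\<in>?G. surviving_mass_below K \<tau> w \<partial>M)"
    by (simp only: mean_grid_gaps_restricted[OF \<tau> G])
qed

text \<open>The bound on the mass is removed by monotone convergence.\<close>

lemma mean_gaps_below: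
  assumes \<tau>: "0 \<le> \<tau>"
  shows "(\<integral>\<^sup>+w. of_nat (gaps_below K \<tau> (\<xi> w)) \<partial>M) = (\<integral>\<^sup>+w. surviving_mass_below K \<tau> w \<partial>M)"
proof -
  let ?G = "low_mass {0..<real K}"
  have W: "{0..<real K} \<in> sets borel" "bounded {0..<real K}" by (auto simp: bounded_Ico)
  have G: "?G J \<in> events" for J by (rule history_events[OF low_mass_history])
  have cover: "AE w in M. \<exists>J. w \<in> ?G J"
    using AE_low_mass_iff[OF W] by eventually_elim (simp add: real_arch_simple)
  have "(\<lambda>w. of_nat (gaps_below K \<tau> (\<xi> w)) :: ennreal) \<in> borel_measurable M"
    using measurable_compose[OF \<xi>_measurable gaps_below_measurable[OF \<tau>]] by measurable
  from nn_integral_exhaust[OF this G incseq_low_mass cover]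
  show ?thesis
    using nn_integral_exhaust[OF surviving_mass_below_measurable G incseq_low_mass cover, of K \<tau>]
    by (simp only: mean_gaps_below_restricted[OF \<tau>])
qed

lemma AE_no_negative_requests: "AE w in M. \<xi> w \<subseteq> {0..}"
proof -
  have "AE w in M. \<xi> w \<inter> {- real n..<0} = {}" for n
  proof -
    let ?B = "{- real n..<0}"
    have B: "?B \<in> sets borel" "bounded ?B" by (auto simp: bounded_Ico)
    have "emeasure M {w \<in> space M. \<xi> w \<inter> ?B = {}} = emeasure M (space M \<inter> {w \<in> space M. \<xi> w \<inter> ?B = {}})"
      by (intro arg_cong[where f="emeasure M"]) auto
    also have "\<dots> = (\<integral>\<^sup>+w\<in>space M. ennreal (exp (- (LBINT u:?B. l w u))) \<partial>M)"
      by (rule silence_restricted[OF B]) (metis history.subalg sets.top subalgebra_def)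
    also have "\<dots> = (\<integral>\<^sup>+w. 1 \<partial>M)"
    proof (rule nn_integral_cong)
      fix w assume w: "w \<in> space M"
      have "(LBINT u:?B. l w u) = 0"
        unfolding set_lebesgue_integral_def using zero_before_arrival[OF w]
        by (intro integral_eq_zero_AE AE_I2) (auto split: split_indicator)
      with w show "ennreal (exp (- (LBINT u:?B. l w u))) * indicator (space M) w = 1" by simp
    qed
    finally have "prob {w \<in> space M. \<xi> w \<inter> ?B = {}} = 1"
      by (simp add: emeasure_space_1 emeasure_eq_measure prob_space)
    from AE_prob_1[OF this] show ?thesis by eventually_elim simp
  qed
  then have "AE w in M. \<forall>n. \<xi> w \<inter> {- real n..<0} = {}" by (simp add: AE_all_countable)
  then show ?thesis
  proof eventually_elim
    case (elim w)
    show ?case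
    proof
      fix x assume x: "x \<in> \<xi> w"
      obtain n :: nat where "\<bar>x\<bar> \<le> real n" using real_arch_simple by blast
      then have "x \<in> {- real n..<0}" if "x < 0" using that by auto
      moreover have "\<xi> w \<inter> {- real n..<0} = {}" using elim by blast
      ultimately show "x \<in> {0..}" using x by (cases "x < 0") (blast, simp)
    qed
  qed
qed

definition silent_after :: "nat \<Rightarrow> 'w set" where
  "silent_after j = {w \<in> space M. \<xi> w \<inter> {real j..} = {}}"

lemma silent_after_eq:
  "silent_after j = (\<Inter>n. {w \<in> space M. \<xi> w \<inter> {real j..<real j + real n} = {}})"
proof -
  have "(\<xi> w \<inter> {real j..} = {}) \<longleftrightarrow> (\<forall>n. \<xi> w \<inter> {real j..<real j + real n} = {})" for w
  proof
    assume n: "\<forall>n. \<xi> w \<inter> {real j..<real j + real n} = {}"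
    show "\<xi> w \<inter> {real j..} = {}"
    proof (rule ccontr)
      assume "\<xi> w \<inter> {real j..} \<noteq> {}"
      then obtain x where x: "x \<in> \<xi> w" "real j \<le> x" by auto
      obtain n :: nat where "x - real j < real n" using reals_Archimedean2 by blast
      then have "x \<in> \<xi> w \<inter> {real j..<real j + real n}" using x by auto
      with n show False by auto
    qed
  qed fastforce
  then show ?thesis unfolding silent_after_def by auto
qed

lemma silent_after_event [measurable]: "silent_after j \<in> events"
  unfolding silent_after_eq by (intro sets.countable_INT image_subsetI silence_event) (auto simp: bounded_Ico)

text \<open>Used for \<open>j = 0\<close> to find the probability of a request, and for \<open>j\<close> tending to infinity to
  see that requests stop.\<close>

lemma emeasure_silent_after:
  "emeasure M (silent_after j) = (\<integral>\<^sup>+w. ennreal (exp (- ((LBINT u. l w u) - \<Lambda> w (real j)))) \<partial>M)"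
proof (rule LIMSEQ_unique)
  let ?B = "\<lambda>n. {real j..<real j + real n}"
  let ?E = "\<lambda>n. {w \<in> space M. \<xi> w \<inter> ?B n = {}}"
  have B: "?B n \<in> sets borel" "bounded (?B n)" for n by (auto simp: bounded_Ico)
  show "(\<lambda>n. emeasure M (?E n)) \<longlonglongrightarrow> emeasure M (silent_after j)"
    unfolding silent_after_eq
  proof (rule Lim_emeasure_decseq)
    show "range ?E \<subseteq> events" using silence_event[OF B] by auto
    show "decseq ?E" unfolding decseq_def
    proof (intro allI impI subsetI)
      fix m n w assume "m \<le> n" "w \<in> ?E n"
      moreover have "?B m \<subseteq> ?B n" using \<open>m \<le> n\<close> by auto
      ultimately show "w \<in> ?E m" by auto
    qed
  qed (simp add: emeasure_eq_measure)
  have e: "emeasure M (?E n) = (\<integral>\<^sup>+w. ennreal (exp (- (LBINT u:?B n. l w u))) \<partial>M)" for n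
  proof -
    have "emeasure M (?E n) = emeasure M (space M \<inter> ?E n)"
      by (intro arg_cong[where f="emeasure M"]) auto
    also have "\<dots> = (\<integral>\<^sup>+w\<in>space M. ennreal (exp (- (LBINT u:?B n. l w u))) \<partial>M)"
      by (rule silence_restricted[OF B]) (metis history.subalg sets.top subalgebra_def)
    also have "\<dots> = (\<integral>\<^sup>+w. ennreal (exp (- (LBINT u:?B n. l w u))) \<partial>M)"
      by (rule nn_integral_cong) simp
    finally show ?thesis .
  qed
  show "(\<lambda>n. emeasure M (?E n)) \<longlonglongrightarrow> (\<integral>\<^sup>+w. ennreal (exp (- ((LBINT u. l w u) - \<Lambda> w (real j)))) \<partial>M)"
    unfolding e
  proof (rule nn_integral_dominated_convergence[where w="\<lambda>_. 1"])
    have ex: "(\<lambda>w. ennreal (exp (- x w))) \<in> borel_measurable M" if "x \<in> borel_measurable M" for x :: "'w \<Rightarrow> real"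
      using that by measurable
    show "(\<lambda>w. ennreal (exp (- (LBINT u:?B n. l w u)))) \<in> borel_measurable M" for n
      by (rule ex[OF mass_measurable[OF B(1)]])
    show "(\<lambda>w. ennreal (exp (- ((LBINT u. l w u) - \<Lambda> w (real j))))) \<in> borel_measurable M"
      by measurable
    show "AE w in M. ennreal (exp (- (LBINT u:?B n. l w u))) \<le> 1" for n
      by (intro AE_I2) (simp add: mass_nonneg)
    show "AE w in M. (\<lambda>n. ennreal (exp (- (LBINT u:?B n. l w u))))
       \<longlonglongrightarrow> ennreal (exp (- ((LBINT u. l w u) - \<Lambda> w (real j))))"
      using AE_intensity
    proof eventually_elim
      case (elim w)
      then interpret integrable_intensity "l w" by simp
      have "filterlim (\<lambda>n. real j + real n) at_top sequentially"
        by (rule filterlim_tendsto_add_at_top[OF tendsto_const filterlim_real_sequentially])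
      then have "(\<lambda>n. F (real j + real n)) \<longlonglongrightarrow> (LBINT u. l w u)" by (rule filterlim_compose[OF F_lim])
      then have "(\<lambda>n. ennreal (exp (- (F (real j + real n) - F (real j))))) \<longlonglongrightarrow> ennreal (exp (- ((LBINT u. l w u) - F (real j))))"
        by (intro tendsto_ennrealI tendsto_intros)
      moreover have "(LBINT u:?B n. l w u) = F (real j + real n) - F (real j)" for n
        by (rule integral_Ico) simp
      ultimately show ?case by (simp only:)
    qed
  qed (auto simp: emeasure_space_1)
qed

lemma AE_finite_requests: "AE w in M. finite (\<xi> w)"
proof -
  have "(\<lambda>j. emeasure M (silent_after j)) \<longlonglongrightarrow> (\<integral>\<^sup>+w. 1 \<partial>M)"
    unfolding emeasure_silent_after
  proof (rule nn_integral_dominated_convergence[where w="\<lambda>_. 1"])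
    show "AE w in M. ennreal (exp (- ((LBINT u. l w u) - \<Lambda> w (real j)))) \<le> 1" for j
      using AE_intensity by eventually_elim (simp add: integrable_intensity.F_bounded)
    show "AE w in M. (\<lambda>j. ennreal (exp (- ((LBINT u. l w u) - \<Lambda> w (real j))))) \<longlonglongrightarrow> 1"
      using AE_intensity
    proof eventually_elim
      case (elim w)
      then interpret integrable_intensity "l w" by simp
      have "(\<lambda>j. F (real j)) \<longlonglongrightarrow> (LBINT u. l w u)" by (rule filterlim_compose[OF F_lim filterlim_real_sequentially])
      then have "(\<lambda>j. ennreal (exp (- ((LBINT u. l w u) - F (real j))))) \<longlonglongrightarrow> ennreal (exp (- ((LBINT u. l w u) - (LBINT u. l w u))))"
        by (intro tendsto_ennrealI tendsto_intros)
      then show ?case by simp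
    qed
  qed (measurable, simp add: emeasure_space_1)
  moreover have "(\<lambda>j. emeasure M (silent_after j)) \<longlonglongrightarrow> emeasure M (\<Union>j. silent_after j)"
    by (rule Lim_emeasure_incseq) (use silent_after_event in blast, auto simp: incseq_def silent_after_def)
  ultimately have "emeasure M (\<Union>j. silent_after j) = 1"
    by (simp add: LIMSEQ_unique emeasure_space_1)
  then have "prob (\<Union>j. silent_after j) = 1" by (simp add: measure_def)
  from AE_prob_1[OF this] AE_no_negative_requests show ?thesis
    using AE_space
  proof eventually_elim
    case (elim w)
    then obtain j where j: "\<xi> w \<inter> {real j..} = {}" by (auto simp: silent_after_def)
    have "\<xi> w = \<xi> w \<inter> {0..<real j}" using j elim by fastforce
    moreover have "finite (\<xi> w \<inter> {0..<real j})"
      by (rule locally_finite_finite[OF \<xi>_locally_finite[OF elim(3)] bounded_Ico])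
    ultimately show ?case by simp
  qed
qed

lemma prob_requested:
  "(\<integral>\<^sup>+w. of_bool (card (\<xi> w) \<ge> 1) \<partial>M) = (\<integral>\<^sup>+w. ennreal (1 - exp (- (LBINT u. l w u))) \<partial>M)"
proof -
  let ?p = "\<lambda>w. exp (- (LBINT u. l w u))"
  have mass: "0 \<le> (LBINT u. l w u)" if "w \<in> space M" for w
    using l_nonneg[OF that] by (intro integral_nonneg_AE AE_I2)
  have "(\<integral>\<^sup>+w. of_bool (card (\<xi> w) \<ge> 1) \<partial>M) = (\<integral>\<^sup>+w. indicator (space M - silent_after 0) w \<partial>M)"
  proof (intro nn_integral_cong_AE, use AE_finite_requests AE_no_negative_requests AE_space in eventually_elim)
    case (elim w)
    then have "\<xi> w \<inter> {0..} = \<xi> w" by auto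
    with elim show ?case by (auto simp: silent_after_def card_gt_0_iff Suc_le_eq split: split_indicator)
  qed
  also have "\<dots> = emeasure M (space M - silent_after 0)" by simp
  also have "\<dots> = 1 - emeasure M (silent_after 0)"
    by (subst emeasure_compl) (auto simp: emeasure_space_1)
  also have "emeasure M (silent_after 0) = (\<integral>\<^sup>+w. ennreal (?p w) \<partial>M)"
    unfolding emeasure_silent_after
  proof (intro nn_integral_cong_AE, use AE_intensity in eventually_elim)
    case (elim w)
    then have "\<Lambda> w 0 = 0"
      by (intro integrable_intensity.F_eq_0) (auto simp: zero_before_arrival)
    then show ?case by simp
  qed
  also have "1 - \<dots> = (\<integral>\<^sup>+w. ennreal (1 - ?p w) \<partial>M)"
  proof -
    have "(\<integral>\<^sup>+w. ennreal (?p w) \<partial>M) + (\<integral>\<^sup>+w. ennreal (1 - ?p w) \<partial>M) = (\<integral>\<^sup>+w. ennreal (?p w) + ennreal (1 - ?p w) \<partial>M)"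
      by (rule nn_integral_add[symmetric]) measurable
    also have "\<dots> = (\<integral>\<^sup>+w. 1 \<partial>M)"
      using mass by (intro nn_integral_cong) (simp flip: ennreal_plus)
    finally have sum: "(\<integral>\<^sup>+w. ennreal (?p w) \<partial>M) + (\<integral>\<^sup>+w. ennreal (1 - ?p w) \<partial>M) = 1"
      by (simp add: emeasure_space_1)
    then have "(\<integral>\<^sup>+w. ennreal (?p w) \<partial>M) \<noteq> \<infinity>" by auto
    then show ?thesis unfolding sum[symmetric] by (simp add: ennreal_add_diff_cancel_left)
  qed
  finally show ?thesis .
qed

text \<open>Both sides of \<open>mean_gaps_below\<close> increase with the horizon \<open>K\<close>.\<close>

theorem mean_gaps:
  assumes \<tau>: "0 \<le> \<tau>"
  shows "(\<integral>\<^sup>+w. of_nat (card {x \<in> \<xi> w. \<xi> w \<inter> {x<..x + \<tau>} = {}}) \<partial>M) = mean_misses M l \<tau>"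
proof -
  let ?f = "\<lambda>K w. of_nat (gaps_below K \<tau> (\<xi> w)) :: ennreal"
  have f_meas: "?f K \<in> borel_measurable M" for K
    using measurable_compose[OF \<xi>_measurable gaps_below_measurable[OF \<tau>]] by measurable
  have fmono: "gaps_below K \<tau> R \<le> gaps_below L \<tau> R" if "finite R" "K \<le> L" for K L R
    unfolding gaps_below_def using that by (intro card_mono) auto
  have "(\<integral>\<^sup>+w. of_nat (card {x \<in> \<xi> w. \<xi> w \<inter> {x<..x + \<tau>} = {}}) \<partial>M) = (\<integral>\<^sup>+w. (SUP K. ?f K w) \<partial>M)"
  proof (intro nn_integral_cong_AE, use AE_finite_requests AE_no_negative_requests in eventually_elim)
    case (elim w)
    let ?S = "{x \<in> \<xi> w. \<xi> w \<inter> {x<..x + \<tau>} = {}}"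
    have "bounded (\<xi> w)" using elim by (intro finite_imp_bounded)
    then obtain b where b: "\<And>x. x \<in> \<xi> w \<Longrightarrow> \<bar>x\<bar> \<le> b" by (auto simp: bounded_iff)
    obtain K :: nat where "b < real K" using reals_Archimedean2 by blast
    then have "\<xi> w \<inter> {0..<real K} = \<xi> w" using b elim by force
    then have K: "gaps_below K \<tau> (\<xi> w) = card ?S" by (simp add: gaps_below_def)
    have "gaps_below L \<tau> (\<xi> w) \<le> card ?S" for L
      unfolding gaps_below_def using elim by (intro card_mono) auto
    then show "of_nat (card ?S) = (SUP K. ?f K w)"
      using K by (intro antisym SUP_least SUP_upper2[of K]) auto
  qed
  also have "\<dots> = (SUP K. \<integral>\<^sup>+w. ?f K w \<partial>M)"
  proof (rule nn_integral_monotone_convergence_SUP_AE)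
    show "AE w in M. ?f K w \<le> ?f (Suc K) w" for K
      using AE_finite_requests by eventually_elim (simp add: fmono)
  qed (rule f_meas)
  also have "\<dots> = (SUP K. \<integral>\<^sup>+w. surviving_mass_below K \<tau> w \<partial>M)"
    by (simp only: mean_gaps_below[OF \<tau>])
  also have "\<dots> = (\<integral>\<^sup>+w. (SUP K. surviving_mass_below K \<tau> w) \<partial>M)"
  proof (rule nn_integral_monotone_convergence_SUP[symmetric])
    show "incseq (\<lambda>K. surviving_mass_below K \<tau>)"
      unfolding incseq_def le_fun_def surviving_mass_below_def
      by (auto intro!: nn_integral_mono mult_left_mono split: split_indicator)
  qed measurable
  also have "\<dots> = (\<integral>\<^sup>+w. surviving_mass \<tau> w \<partial>M)"
  proof (intro nn_integral_cong)
    fix w assume w: "w \<in> space M"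
    let ?g = "\<lambda>u. ennreal (survival (l w) u (u + \<tau>))"
    have g: "?g \<in> borel_measurable borel"
    proof -
      have "\<Lambda> w \<in> borel_measurable borel"
        using measurable_Pair2[OF prim_measurable w] by simp
      moreover have "l w \<in> borel_measurable borel" by (rule l_section[OF w])
      ultimately show ?thesis by measurable
    qed
    have "surviving_mass \<tau> w = (\<integral>\<^sup>+u. ?g u * indicator {0<..} u \<partial>lborel)"
      unfolding surviving_mass_def
      by (intro nn_integral_cong_AE, use AE_lborel_singleton[of 0] in eventually_elim)
        (use zero_before_arrival[OF w] in \<open>auto split: split_indicator\<close>)
    also have "\<dots> = (\<integral>\<^sup>+u. (SUP K. ?g u * indicator {0<..real K} u) \<partial>lborel)"
    proof (rule nn_integral_cong)
      fix u :: real
      obtain K :: nat where "u \<le> real K" using real_arch_simple by blast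
      then show "?g u * indicator {0<..} u = (SUP K. ?g u * indicator {0<..real K} u)"
        by (intro antisym SUP_least SUP_upper2[of K]) (auto split: split_indicator)
    qed
    also have "\<dots> = (SUP K. surviving_mass_below K \<tau> w)"
      unfolding surviving_mass_below_def
    proof (rule nn_integral_monotone_convergence_SUP)
      show "incseq (\<lambda>K u. ?g u * indicator {0<..real K} u)"
        by (auto simp: incseq_def le_fun_def intro!: mult_left_mono split: split_indicator)
      show "(\<lambda>u. ?g u * indicator {0<..real K} u) \<in> borel_measurable lborel" for K
        using g by measurable
    qed
    finally show "(SUP K. surviving_mass_below K \<tau> w) = surviving_mass \<tau> w" ..
  qed
  finally show ?thesis by (simp add: mean_misses_eq)
qed

end

section \<open>Expected misses\<close>

text \<open>The joint law of independent elements is the product of their laws.\<close>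

lemma nn_integral_independent_elements:
  assumes M: "prob_space M" and ind: "independent_elements M P X Q Y"
    and f[measurable]: "f \<in> borel_measurable (P \<Otimes>\<^sub>M Q)"
  shows "(\<integral>\<^sup>+w. f (X w, Y w) \<partial>M) = (\<integral>\<^sup>+w. \<integral>\<^sup>+w'. f (X w, Y w') \<partial>M \<partial>M)"
proof -
  interpret prob_space M by fact
  have X[measurable]: "X \<in> M \<rightarrow>\<^sub>M P" and Y[measurable]: "Y \<in> M \<rightarrow>\<^sub>M Q"
    and indep: "indep_set (sets (vimage_algebra (space M) X P)) (sets (vimage_algebra (space M) Y Q))"
    using ind by (auto simp: independent_elements_def)
  interpret DX: prob_space "distr M P X" by (rule prob_space_distr) fact
  interpret DY: prob_space "distr M Q Y" by (rule prob_space_distr) fact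
  have "distr M P X \<Otimes>\<^sub>M distr M Q Y = distr M (P \<Otimes>\<^sub>M Q) (\<lambda>w. (X w, Y w))"
  proof (rule pair_measure_eqI)
    show "sigma_finite_measure (distr M P X)" "sigma_finite_measure (distr M Q Y)" by unfold_locales
    show "sets (distr M P X \<Otimes>\<^sub>M distr M Q Y) = sets (distr M (P \<Otimes>\<^sub>M Q) (\<lambda>w. (X w, Y w)))"
      by (simp cong: sets_pair_measure_cong)
    fix B D assume "B \<in> sets (distr M P X)" "D \<in> sets (distr M Q Y)"
    then have B[measurable]: "B \<in> sets P" and D[measurable]: "D \<in> sets Q" by auto
    have "prob ((X -` B \<inter> space M) \<inter> (Y -` D \<inter> space M)) = prob (X -` B \<inter> space M) * prob (Y -` D \<inter> space M)"
      using indep by (rule indep_setD) (auto intro: in_vimage_algebra B D)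
    moreover have "(\<lambda>w. (X w, Y w)) -` (B \<times> D) \<inter> space M = (X -` B \<inter> space M) \<inter> (Y -` D \<inter> space M)" by auto
    ultimately show "emeasure (distr M P X) B * emeasure (distr M Q Y) D
        = emeasure (distr M (P \<Otimes>\<^sub>M Q) (\<lambda>w. (X w, Y w))) (B \<times> D)"
      by (simp add: emeasure_distr emeasure_eq_measure ennreal_mult)
  qed
  then have "(\<integral>\<^sup>+w. f (X w, Y w) \<partial>M) = (\<integral>\<^sup>+p. f p \<partial>(distr M P X \<Otimes>\<^sub>M distr M Q Y))"
    by (simp add: nn_integral_distr)
  also have "\<dots> = (\<integral>\<^sup>+x. \<integral>\<^sup>+y. f (x, y) \<partial>distr M Q Y \<partial>distr M P X)"
    by (rule DY.nn_integral_fst[symmetric]) (simp cong: measurable_cong_sets sets_pair_measure_cong)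
  also have "\<dots> = (\<integral>\<^sup>+x. \<integral>\<^sup>+w'. f (x, Y w') \<partial>M \<partial>distr M P X)"
    by (intro nn_integral_cong nn_integral_distr) (auto simp: measurable_Pair2[OF f])
  also have "\<dots> = (\<integral>\<^sup>+w. \<integral>\<^sup>+w'. f (X w, Y w') \<partial>M \<partial>M)"
    by (rule nn_integral_distr) measurable
  finally show ?thesis .
qed

text \<open>The number of misses as a function of the condition \<open>Q r\<close> on the requests \<open>r + 1\<close> and \<open>r + 2\<close>.
  The sum over all \<open>r\<close>, with the bound by \<open>card R\<close> moved into the summand, can be integrated
  term by term.\<close>

definition gap_count :: "(nat \<Rightarrow> real set \<Rightarrow> bool) \<Rightarrow> real set \<Rightarrow> ennreal" where
  "gap_count Q R = of_bool (finite R \<and> 1 \<le> card R) + (\<Sum>r. of_bool ((finite R \<and> r + 2 \<le> card R) \<and> Q r R))"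

lemma gap_count_eq:
  assumes R: "finite R" and PQ: "\<And>r. r + 2 \<le> card R \<Longrightarrow> P (r + 2) \<longleftrightarrow> Q r R"
  shows "of_nat (of_bool (card R \<ge> 1) + (\<Sum>r = 2..card R. of_bool (P r))) = gap_count Q R"
proof -
  have "(\<Sum>r. of_bool ((finite R \<and> r + 2 \<le> card R) \<and> Q r R) :: ennreal)
      = (\<Sum>r<card R - 1. of_bool ((finite R \<and> r + 2 \<le> card R) \<and> Q r R))"
    by (rule suminf_finite) auto
  also have "\<dots> = (\<Sum>r = 2..card R. of_bool (P r))"
    by (rule sum.reindex_bij_witness[of _ "\<lambda>r. r - 2" "\<lambda>r. r + 2"]) (use R PQ in auto)
  finally show ?thesis using R by (simp add: gap_count_def)
qed

lemma misses_eq_gap_count: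
  assumes R: "finite R" and S: "finitely_requested S" "\<And>n. locally_finite_set (S n)"
  shows "of_nat (misses C S R) = gap_count (\<lambda>r R. filled_before C S (nth_request (r + 1) R) (nth_request (r + 2) R)) R"
proof -
  have "misses C S R = of_bool (card R \<ge> 1) +
       (\<Sum>r = 2..card R. of_bool (ereal (request_time R r) > exit_time C S (request_time R (r - 1))))"
    by (cases "2 \<le> card R") (simp_all add: misses_def)
  then show ?thesis
    by (simp only:) (intro gap_count_eq R, simp add: nth_request_def R exit_time_less_iff[OF S])
qed

lemma gaps_eq_gap_count:
  assumes R: "finite R" and \<tau>: "0 \<le> \<tau>"
  shows "of_nat (card {x \<in> R. R \<inter> {x<..x + \<tau>} = {}}) = gap_count (\<lambda>r R. \<tau> < nth_request (r + 2) R - nth_request (r + 1) R) R"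
  unfolding card_last_before_gap[OF R \<tau>, symmetric]
  by (intro gap_count_eq R) (simp add: nth_request_def R)

lemma filled_before_nth_request_measurable:
  assumes [measurable]: "a \<in> borel_measurable config" "b \<in> borel_measurable config"
  shows "Measurable.pred (config \<Otimes>\<^sub>M PiM UNIV (\<lambda>_. config)) (\<lambda>(R, S). filled_before C S (a R) (b R))"
proof -
  have "(\<lambda>p. (snd p, a (fst p), b (fst p))) \<in> config \<Otimes>\<^sub>M PiM UNIV (\<lambda>_. config) \<rightarrow>\<^sub>M PiM UNIV (\<lambda>_. config) \<Otimes>\<^sub>M (borel \<Otimes>\<^sub>M borel)"
    by measurable
  from measurable_compose[OF this filled_before_measurable] show ?thesis by (simp add: split_beta)
qed

lemma gap_count_measurable:
  assumes Q: "\<And>r. Measurable.pred (config \<Otimes>\<^sub>M N) (\<lambda>(R, S). Q S r R)"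
  shows "(\<lambda>(R, S). gap_count (Q S) R) \<in> borel_measurable (config \<Otimes>\<^sub>M N)"
proof -
  have [measurable]: "Measurable.pred (config \<Otimes>\<^sub>M N) (\<lambda>p. Q (snd p) r (fst p))" for r
    using Q[of r] by (simp add: split_beta)
  show ?thesis unfolding gap_count_def split_beta of_bool_def by measurable
qed

locale cache_model = document_catalog M l \<gamma> A \<Xi> + tagged_document M l \<xi>
  for M :: "'w measure" and l :: "'w \<Rightarrow> real \<Rightarrow> real" and \<gamma> :: real
    and A :: "nat \<Rightarrow> 'w \<Rightarrow> real" and \<Xi> :: "nat \<Rightarrow> 'w \<Rightarrow> real set" and \<xi> :: "'w \<Rightarrow> real set" +
  assumes independent: "independent_elements M
           (PiM UNIV (\<lambda>_. borel) \<Otimes>\<^sub>M config) (\<lambda>w. (l w, \<xi> w))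
           (PiM UNIV (\<lambda>_. borel \<Otimes>\<^sub>M config)) (\<lambda>w n. (A n w, \<Xi> n w))"
begin

lemma rest_measurable [measurable]: "(\<lambda>w n. \<Xi> n w) \<in> M \<rightarrow>\<^sub>M PiM UNIV (\<lambda>_. config)"
  using measurable_PiM_single'[of UNIV "\<lambda>n w. \<Xi> n w" M "\<lambda>_. config"] measurable_space[OF \<Xi>_measurable]
  by (simp add: PiE_UNIV_domain)

lemma nn_integral_tagged_rest:
  assumes [measurable]: "f \<in> borel_measurable (config \<Otimes>\<^sub>M PiM UNIV (\<lambda>_. config))"
  shows "(\<integral>\<^sup>+w. f (\<xi> w, \<lambda>n. \<Xi> n w) \<partial>M) = (\<integral>\<^sup>+w. \<integral>\<^sup>+w'. f (\<xi> w, \<lambda>n. \<Xi> n w') \<partial>M \<partial>M)"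
proof -
  let ?P = "PiM UNIV (\<lambda>_::real. borel :: real measure) \<Otimes>\<^sub>M config" and ?Q = "PiM UNIV (\<lambda>_::nat. (borel :: real measure) \<Otimes>\<^sub>M config)"
  have "(\<lambda>S n. snd (S n)) \<in> ?Q \<rightarrow>\<^sub>M PiM UNIV (\<lambda>_. config)"
    by (rule measurable_PiM_single') (auto simp: PiE_UNIV_domain space_PiM space_pair_measure Pi_iff mem_Times_iff)
  then have "(\<lambda>p. (snd (fst p), \<lambda>n. snd (snd p n))) \<in> ?P \<Otimes>\<^sub>M ?Q \<rightarrow>\<^sub>M config \<Otimes>\<^sub>M PiM UNIV (\<lambda>_. config)"
    by measurable
  then have "(\<lambda>p. f (snd (fst p), \<lambda>n. snd (snd p n))) \<in> borel_measurable (?P \<Otimes>\<^sub>M ?Q)"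
    by measurable
  from nn_integral_independent_elements[OF prob_space_axioms independent this] show ?thesis by simp
qed

text \<open>The rest \<open>S\<close> is fixed here and enters only through its exit time \<open>\<tau>\<close>: for finite \<open>\<tau>\<close> the count
  is that of the requests with no successor within \<open>\<tau>\<close>, for \<open>\<tau> = \<infinity>\<close> it is \<open>1\<close> if there is a
  request at all.\<close>

lemma mean_misses_at_exit:
  assumes S: "finitely_requested S" "\<And>n. locally_finite_set (S n)"
  shows "(\<integral>\<^sup>+w. gap_count (\<lambda>r R. filled_before C S 0 (nth_request (r + 2) R - nth_request (r + 1) R)) (\<xi> w) \<partial>M)
    = mean_misses_ext M l (exit_time C S 0)"
proof (cases "exit_time C S 0")
  case (real \<tau>)
  then have \<tau>: "0 \<le> \<tau>" using exit_time_ge[of 0 C S] by (simp add: zero_ereal_def[symmetric])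
  have iff: "filled_before C S 0 d \<longleftrightarrow> \<tau> < d" for d
    using exit_time_less_iff[OF S, of C 0 d] real by simp
  have "(\<integral>\<^sup>+w. gap_count (\<lambda>r R. \<tau> < nth_request (r + 2) R - nth_request (r + 1) R) (\<xi> w) \<partial>M)
      = (\<integral>\<^sup>+w. of_nat (card {x \<in> \<xi> w. \<xi> w \<inter> {x<..x + \<tau>} = {}}) \<partial>M)"
    by (intro nn_integral_cong_AE, use AE_finite_requests in eventually_elim)
      (simp only: gaps_eq_gap_count[OF _ \<tau>])
  then show ?thesis using real by (simp add: iff mean_gaps[OF \<tau>] mean_misses_ext_def)
next
  case PInf
  have iff: "\<not> filled_before C S 0 d" for d
    using exit_time_less_iff[OF S, of C 0 d] PInf by simp
  have "(\<integral>\<^sup>+w. gap_count (\<lambda>r R. filled_before C S 0 (nth_request (r + 2) R - nth_request (r + 1) R)) (\<xi> w) \<partial>M)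
      = (\<integral>\<^sup>+w. of_bool (card (\<xi> w) \<ge> 1) \<partial>M)"
    by (intro nn_integral_cong_AE, use AE_finite_requests in eventually_elim)
      (simp add: gap_count_def iff)
  also have "\<dots> = Lim at_top (mean_misses M l)"
    unfolding prob_requested by (rule tendsto_Lim[OF _ mean_misses_tendsto, symmetric]) simp
  finally show ?thesis using PInf by (simp add: mean_misses_ext_def)
next
  case MInf
  then show ?thesis using exit_time_ge[of 0 C S] by simp
qed

text \<open>Average over the rest with the tagged document fixed. Each summand then involves the exit
  time from one fixed time only and may be shifted to \<open>0\<close>; the shifted expression involves the
  single exit time \<open>T\<^sup>0\<close>, and averaging over the tagged document first gives the claim.\<close>

theorem mean_misses_LRU:
  assumes C: "C \<ge> 1"
  shows "(\<integral>\<^sup>+w. of_nat (misses C (\<lambda>n. \<Xi> n w) (\<xi> w)) \<partial>M)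
       = (\<integral>\<^sup>+w. mean_misses_ext M l (exit_time C (\<lambda>n. \<Xi> n w) 0) \<partial>M)"
proof -
  interpret MM: pair_sigma_finite M M ..
  let ?actual = "\<lambda>S r R. filled_before C S (nth_request (r + 1) R) (nth_request (r + 2) R)"
  let ?shifted = "\<lambda>S r R. filled_before C S 0 (nth_request (r + 2) R - nth_request (r + 1) R)"
  have [measurable]: "nth_request (r + 1) \<in> borel_measurable config" "nth_request (r + 2) \<in> borel_measurable config" for r
    by (rule nth_request_measurable; simp)+
  have Q: "Measurable.pred (config \<Otimes>\<^sub>M PiM UNIV (\<lambda>_. config)) (\<lambda>(R, S). ?actual S r R)" for r
    by (rule filled_before_nth_request_measurable) measurable
  have Q0: "Measurable.pred (config \<Otimes>\<^sub>M PiM UNIV (\<lambda>_. config)) (\<lambda>(R, S). ?shifted S r R)" for r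
    by (rule filled_before_nth_request_measurable) measurable
  note g = gap_count_measurable[where Q = ?actual, OF Q] and g0 = gap_count_measurable[where Q = ?shifted, OF Q0]
  have rest_lf: "locally_finite_set (\<Xi> n w)" if "w \<in> space M" for n w
    using measurable_space[OF \<Xi>_measurable that] by (simp add: space_config)
  have filled_event: "{w \<in> space M. filled_before C (\<lambda>n. \<Xi> n w) s y} \<in> events" for s y
  proof -
    have "(\<lambda>w. ((\<lambda>n. \<Xi> n w), s, y)) \<in> M \<rightarrow>\<^sub>M PiM UNIV (\<lambda>_. config) \<Otimes>\<^sub>M (borel \<Otimes>\<^sub>M borel)" by measurable
    from measurable_compose[OF this filled_before_measurable] show ?thesis by (simp add: pred_def)
  qed
  have mean_gap_count: "(\<integral>\<^sup>+w'. gap_count (\<lambda>r R. filled_before C (\<lambda>n. \<Xi> n w') (a r) (b r)) R \<partial>M)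
      = of_bool (finite R \<and> 1 \<le> card R) + (\<Sum>r. of_bool (finite R \<and> r + 2 \<le> card R)
          * ennreal (prob {w \<in> space M. filled_before C (\<lambda>n. \<Xi> n w) (a r) (b r)}))" for R a b
  proof -
    let ?E = "\<lambda>r. {w \<in> space M. filled_before C (\<lambda>n. \<Xi> n w) (a r) (b r)}"
    have "(\<integral>\<^sup>+w'. gap_count (\<lambda>r R. filled_before C (\<lambda>n. \<Xi> n w') (a r) (b r)) R \<partial>M)
        = (\<integral>\<^sup>+w'. of_bool (finite R \<and> 1 \<le> card R) + (\<Sum>r. of_bool (finite R \<and> r + 2 \<le> card R) * indicator (?E r) w') \<partial>M)"
      unfolding gap_count_def
      by (intro nn_integral_cong arg_cong2[where f="(+)"] suminf_cong refl) (simp add: indicator_def)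
    also have "\<dots> = (\<integral>\<^sup>+w'. of_bool (finite R \<and> 1 \<le> card R) \<partial>M)
        + (\<integral>\<^sup>+w'. (\<Sum>r. of_bool (finite R \<and> r + 2 \<le> card R) * indicator (?E r) w') \<partial>M)"
      by (rule nn_integral_add) (use filled_event in \<open>auto intro!: borel_measurable_suminf_order\<close>)
    also have "(\<integral>\<^sup>+w'. (\<Sum>r. of_bool (finite R \<and> r + 2 \<le> card R) * indicator (?E r) w') \<partial>M)
        = (\<Sum>r. \<integral>\<^sup>+w'. of_bool (finite R \<and> r + 2 \<le> card R) * indicator (?E r) w' \<partial>M)"
      by (rule nn_integral_suminf) (use filled_event in auto)
    also have "\<dots> = (\<Sum>r. of_bool (finite R \<and> r + 2 \<le> card R) * ennreal (prob (?E r)))"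
      by (intro suminf_cong, subst nn_integral_cmult_indicator[OF filled_event]) (simp only: emeasure_eq_measure)
    finally show ?thesis by (simp add: emeasure_space_1)
  qed
  have "(\<integral>\<^sup>+w. of_nat (misses C (\<lambda>n. \<Xi> n w) (\<xi> w)) \<partial>M) = (\<integral>\<^sup>+w. gap_count (?actual (\<lambda>n. \<Xi> n w)) (\<xi> w) \<partial>M)"
    by (intro nn_integral_cong_AE, use AE_finite_requests AE_finitely_requested AE_space in eventually_elim)
      (simp add: misses_eq_gap_count rest_lf)
  also have "\<dots> = (\<integral>\<^sup>+w. \<integral>\<^sup>+w'. gap_count (?actual (\<lambda>n. \<Xi> n w')) (\<xi> w) \<partial>M \<partial>M)"
    using nn_integral_tagged_rest[OF g] by simp
  also have "\<dots> = (\<integral>\<^sup>+w. \<integral>\<^sup>+w'. gap_count (?shifted (\<lambda>n. \<Xi> n w')) (\<xi> w) \<partial>M \<partial>M)"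
  proof (rule nn_integral_cong)
    fix w
    let ?R = "\<xi> w"
    \<comment> \<open>With \<open>R\<close> fixed, the request times become constants, as \<open>mean_gap_count\<close> requires.\<close>
    have fix_R: "gap_count Q R = gap_count (\<lambda>r _. Q r R) R" for Q R by (simp add: gap_count_def)
    show "(\<integral>\<^sup>+w'. gap_count (?actual (\<lambda>n. \<Xi> n w')) ?R \<partial>M) = (\<integral>\<^sup>+w'. gap_count (?shifted (\<lambda>n. \<Xi> n w')) ?R \<partial>M)"
      unfolding fix_R[of "?actual _"] fix_R[of "?shifted _"] mean_gap_count
      by (simp only: filled_before_shift[OF C, symmetric])
  qed
  also have "\<dots> = (\<integral>\<^sup>+w'. \<integral>\<^sup>+w. gap_count (?shifted (\<lambda>n. \<Xi> n w')) (\<xi> w) \<partial>M \<partial>M)"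
  proof (rule MM.Fubini'[symmetric])
    have "(\<lambda>p. (\<xi> (fst p), \<lambda>n. \<Xi> n (snd p))) \<in> M \<Otimes>\<^sub>M M \<rightarrow>\<^sub>M config \<Otimes>\<^sub>M PiM UNIV (\<lambda>_. config)"
      using measurable_compose[OF measurable_snd rest_measurable] by measurable
    from measurable_compose[OF this g0]
    show "(\<lambda>(w, w'). gap_count (?shifted (\<lambda>n. \<Xi> n w')) (\<xi> w)) \<in> borel_measurable (M \<Otimes>\<^sub>M M)"
      by (simp add: split_beta)
  qed
  also have "\<dots> = (\<integral>\<^sup>+w'. mean_misses_ext M l (exit_time C (\<lambda>n. \<Xi> n w') 0) \<partial>M)"
    by (intro nn_integral_cong_AE, use AE_finitely_requested AE_space in eventually_elim)
      (intro mean_misses_at_exit rest_lf)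
  finally show ?thesis .
qed

end

theorem theorem3:
  fixes M :: "'w measure"
    and \<gamma> :: real
    and l :: "'w \<Rightarrow> real \<Rightarrow> real"
    and \<xi> :: "'w \<Rightarrow> real set"
    and A :: "nat \<Rightarrow> 'w \<Rightarrow> real"
    and \<Xi> :: "nat \<Rightarrow> 'w \<Rightarrow> real set"
    and C :: nat
  assumes "prob_space M"
    and "\<gamma> > 0"
    and "random_intensity M l"
    and "\<And>\<omega> u. \<omega> \<in> space M \<Longrightarrow> u < 0 \<Longrightarrow> l \<omega> u = 0"
    and "AE \<omega> in M. integrable lborel (l \<omega>)"
    and "\<And>s t. s \<le> t \<Longrightarrow>
      (\<integral>\<^sup>+a\<in>{..t}. (\<integral>\<^sup>+\<omega>. ennreal (1 - exp (- (cumulative (shift_intensity a l \<omega>) a t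
                                         - cumulative (shift_intensity a l \<omega>) a s))) \<partial>M)
        \<partial>lborel) < \<infinity>"
    and "cox_process M l \<xi>"
    and "document_process M \<gamma> l A \<Xi>"
    and "independent_elements M
           (PiM UNIV (\<lambda>_. borel) \<Otimes>\<^sub>M config) (\<lambda>\<omega>. (l \<omega>, \<xi> \<omega>))
           (PiM UNIV (\<lambda>_. borel \<Otimes>\<^sub>M config)) (\<lambda>\<omega> n. (A n \<omega>, \<Xi> n \<omega>))"
    and "C \<ge> 1"
  shows "(\<integral>\<^sup>+\<omega>. of_nat (misses C (\<lambda>n. \<Xi> n \<omega>) (\<xi> \<omega>)) \<partial>M)
           = (\<integral>\<^sup>+\<omega>. mean_misses_ext M l (exit_time C (\<lambda>n. \<Xi> n \<omega>) 0) \<partial>M)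
    \<and> antimono_on {0..} (mean_misses M l)
    \<and> (mean_misses M l \<longlongrightarrow> ennreal (\<integral>\<omega>. 1 - exp (- (LBINT u:{0..}. l \<omega> u)) \<partial>M)) at_top"
proof -
  interpret cache_model M l \<gamma> A \<Xi> \<xi>
    unfolding cache_model_def cache_model_axioms_def document_catalog_def document_catalog_axioms_def
      catalog_intensity_def catalog_intensity_axioms_def tagged_document_def tagged_document_axioms_def
      tagged_intensity_def tagged_intensity_axioms_def
    by (intro conjI allI impI assms)
  have mass: "(LBINT u:{0..}. l w u) = (LBINT u. l w u)" if "w \<in> space M" for w
    unfolding set_lebesgue_integral_def using zero_before_arrival[OF that]
    by (intro Bochner_Integration.integral_cong) (auto split: split_indicator)
  have int: "integrable M (\<lambda>w. 1 - exp (- (LBINT u:{0..}. l w u)))"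
  proof (rule integrable_const_bound[of _ 1])
    show "AE w in M. norm (1 - exp (- (LBINT u:{0..}. l w u))) \<le> 1"
      by (intro AE_I2) (simp add: mass_nonneg)
    have "(\<lambda>w. 1 - exp (- x w)) \<in> borel_measurable M" if "x \<in> borel_measurable M" for x :: "'w \<Rightarrow> real"
      using that by measurable
    from this[OF mass_measurable] show "(\<lambda>w. 1 - exp (- (LBINT u:{0..}. l w u))) \<in> borel_measurable M"
      by simp
  qed
  have "ennreal (\<integral>w. 1 - exp (- (LBINT u:{0..}. l w u)) \<partial>M) = (\<integral>\<^sup>+w. ennreal (1 - exp (- (LBINT u:{0..}. l w u))) \<partial>M)"
    using int by (intro nn_integral_eq_integral[symmetric] AE_I2) (auto simp: mass_nonneg)
  also have "\<dots> = (\<integral>\<^sup>+w. ennreal (1 - exp (- (LBINT u. l w u))) \<partial>M)"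
    by (intro nn_integral_cong) (simp only: mass)
  finally show ?thesis
    using mean_misses_LRU[OF assms(10)] mean_misses_tendsto
    by (auto intro!: monotone_onI mean_misses_antimono)
qed

end
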